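(* Let $q$ be a prime power and let $\mathcal C$ be an $[n,k,d]_q$ linear code with locality $r$ and with $\ell$-dimensional Euclidean hull, i.e. $\dim(\mathcal C\cap\mathcal C^\perp)=\ell$. Then the EA-CSS code $\mathcal Q(\mathcal C,\mathcal C)$ is an $[[n,k-\ell,\delta;n-k-\ell]]_q$ EAQLRC of locality $r$, where $$\delta=\begin{cases}d,&\text{if }\mathcal C\subseteq\mathcal C^\perp,\\ \mathrm{wt}\bigl(\mathcal C\setminus(\mathcal C\cap\mathcal C^\perp)\bigr),&\text{otherwise.}\end{cases}$$ Moreover, the EAQLRC $\mathcal Q(\mathcal C,\mathcal C)$ is pure if $\delta=d$ and impure otherwise.
   Context: Notation. $[m]=\{1,\dots,m\}$. An $[n,k,d]_q$ linear code is a $k$-dimensional subspace of $\mathbb F_q^n$ with minimum distance $d$; $\mathcal C^\perp$ is the Euclidean dual; a parity-check matrix of an $[n,k]_q$ code $\mathcal C$ is an $(n-k)\times n$ matrix $\mathbf H$ with $\mathcal C=\ker\mathbf H$ and $\mathcal C^\perp$ equal to the row space of $\mathbf H$. For a set $S\subseteq\mathbb F_q^n$ containing a nonzero vector, $\mathrm{wt}(S)$ is the minimum Hamming weight of its nonzero vectors. Classical locality. An $[n,k,d]_q$ linear code $\mathcal C$ has locality $r$ if for each $i\in[n]$ there are a subset $I_i=\{i_1,\dots,i_{s_i}\}\subseteq[n]\setminus\{i\}$ with $s_i\le r$ and a function $f_i:\mathbb F_q^{s_i}\to\mathbb F_q$ such that $c_i=f_i(c_{i_1},\dots,c_{i_{s_i}})$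 for every $(c_1,\dots,c_n)\in\mathcal C$. Registers and Paulis. A qudit has Hilbert space $\mathbb C^q$ with basis $\{|x\rangle:x\in\mathbb F_q\}$, $q=p^m$. $Q=Q_{[n]}=(Q_1,\dots,Q_n)$ is the transmitted register, $B=B_{[c]}$ is Bob's noiseless register of $c$ qudits, $\mathcal H_A$ is the Hilbert space of a register $A$. With ${\rm tr}:\mathbb F_q\to\mathbb F_p$ the trace and $\omega_p=e^{2\pi i/p}$: $X(a)|x\rangle=|x+a\rangle$, $Z(b)|x\rangle=\omega_p^{{\rm tr}(bx)}|x\rangle$; $X_A(\mathbf a)=\bigotimes_jX(a_j)$, $Z_A(\mathbf b)=\bigotimes_jZ(b_j)$. EAQECC. An $[[n,\kappa,\delta;c]]_q$ EAQECC $\mathcal Q\subseteq\mathcal H_{Q_{[n]}}\otimes\mathcal H_{B_{[c]}}$ ($0\le c\le n-\kappa$) is the image of an isometry $V:(\mathbb C^q)^{\otimes\kappa}\to(\mathbb C^q)^{\otimes n}\otimes(\mathbb C^q)^{\otimes c}$ of the form $V|\phi\rangle=q^{-c/2}\sum_{\mathbf x\in\mathbb F_q^c}U_{\rm enc}(|\phi\rangle\otimes|0\rangle^{\otimes(n-\kappa-c)}\otimes|\mathbf x\rangle)\otimes|\mathbf x\rangle_{B_{[c]}}$ with $U_{\rm enc}$ unitary on $n$ qudits; it has minimum distance $\delta$, meaning it can correct every set of erasures of at most $\delta-1$ transmitted qudits. EA-CSS code. Given an $[n,k_X,d_X]_q$ code $\mathcal C_X$ and an $[n,k_Z,d_Z]_q$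 code $\mathcal C_Z$ with parity-check matrices $\mathbf H_X,\mathbf H_Z$, put $c=\mathrm{rank}(\mathbf H_X\mathbf H_Z^\top)$ and choose a rank factorization $-\mathbf H_X\mathbf H_Z^\top=\mathbf F_X\mathbf F_Z^\top$ with $\mathbf F_X\in\mathbb F_q^{(n-k_X)\times c}$, $\mathbf F_Z\in\mathbb F_q^{(n-k_Z)\times c}$. The EA-CSS code $\mathcal Q(\mathcal C_X,\mathcal C_Z)$ is the subspace of $\mathcal H_Q\otimes\mathcal H_B$ fixed pointwise by all operators $X_Q(\mathbf u\mathbf H_X)Z_Q(\mathbf v\mathbf H_Z)\otimes X_B(\mathbf u\mathbf F_X)Z_B(\mathbf v\mathbf F_Z)$ with $\mathbf u\in\mathbb F_q^{n-k_X},\mathbf v\in\mathbb F_q^{n-k_Z}$. It is a known result (Galindo, Hernando, Matsumoto, Ruano) that it is an $[[n,\kappa,\delta;c]]_q$ EAQECC with $c=n-k_X-\dim(\mathcal C_X^\perp\cap\mathcal C_Z)$, $\kappa=k_X+k_Z-n+c$, and $\delta=\min\{d_X,d_Z\}$ if $\mathcal C_X\subseteq\mathcal C_Z^\perp$, $\delta=\min\{\mathrm{wt}(\mathcal C_X\setminus(\mathcal C_X\cap\mathcal C_Z^\perp)),\mathrm{wt}(\mathcal C_Z\setminus(\mathcal C_X^\perp\cap\mathcal C_Z))\}$ otherwise. It is called pure if $\delta=\min\{d_X,d_Z\}$ and impure otherwise. Locality of EAQECCs. $\mathcal M(A)$ is the set of density operators on $\mathcal H_A$; a quantum channel is a completely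 positive trace-preserving linear map. The erasure of qudit $i$ is $\Gamma_i(\rho)=\frac{I_{Q_i}}{q}\otimes{\rm Tr}_{Q_i}(\rho)$. A set $R\subseteq[n]\setminus\{i\}$ is a recovery set for $Q_i$ if there is a quantum channel ${\rm Rec}_{i,R}$ from $\mathcal M(Q_{\{i\}\cup R}\cup B_{[c]})$ to itself such that $({\rm Rec}_{i,R}\otimes{\rm id}_{Q_{[n]\setminus(\{i\}\cup R)}})(\Gamma_i(|\psi\rangle\langle\psi|))=|\psi\rangle\langle\psi|$ for every unit vector $|\psi\rangle\in\mathcal Q$. An EAQECC is an EAQLRC with (of) locality $r$ if for every $i\in[n]$ there is a recovery set $R_i\subseteq[n]\setminus\{i\}$ for $Q_i$ with $|R_i|\le r$. *)

theory Defs
  imports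
    "HOL-Library.FuncSet"
    "HOL-Library.Cardinality"
    "HOL-Library.Complex_Order"
    "HOL-Computational_Algebra.Primes"
    "Jordan_Normal_Form.DL_Rank"
    "Jordan_Normal_Form.Matrix_Kernel"
begin

text \<open>
  The field with \<open>q\<close> elements is a type \<open>'a\<close> of sort \<open>{field, finite}\<close>, so \<open>q = CARD('a)\<close>.
  Words of length \<open>n\<close> are the elements of \<open>carrier_vec n\<close>; positions run over \<open>{..<n}\<close>
  instead of \<open>{1..n}\<close>.
\<close>

section \<open>Linear codes\<close>

definition code_dim :: "nat \<Rightarrow> 'a::field vec set \<Rightarrow> nat" where
  "code_dim n S = vectorspace.dim class_ring ((module_vec TYPE('a) n)\<lparr>carrier := S\<rparr>)"

definition hamming_dist :: "'a vec \<Rightarrow> 'a vec \<Rightarrow> nat" where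
  "hamming_dist x y = card {i. i < dim_vec x \<and> x $ i \<noteq> y $ i}"

definition hamming_weight :: "'a::zero vec \<Rightarrow> nat" where
  "hamming_weight x = card {i. i < dim_vec x \<and> x $ i \<noteq> 0}"

definition min_dist :: "'a vec set \<Rightarrow> nat" where
  "min_dist C = Min {hamming_dist x y |x y. x \<in> C \<and> y \<in> C \<and> x \<noteq> y}"

definition wt :: "'a::zero vec set \<Rightarrow> nat" where
  "wt S = Min {hamming_weight x |x. x \<in> S \<and> x \<noteq> 0\<^sub>v (dim_vec x)}"

text \<open>The zero code is excluded, since it has no minimum distance.\<close>

definition linear_code :: "nat \<Rightarrow> nat \<Rightarrow> nat \<Rightarrow> 'a::{field,finite} vec set \<Rightarrow> bool" where
  "linear_code n k d C \<longleftrightarrow>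
     VectorSpace.subspace class_ring C (module_vec TYPE('a) n) \<and>
     code_dim n C = k \<and> C \<noteq> {0\<^sub>v n} \<and> min_dist C = d"

definition dual_code :: "nat \<Rightarrow> 'a::field vec set \<Rightarrow> 'a vec set" where
  "dual_code n C = {v \<in> carrier_vec n. \<forall>w\<in>C. v \<bullet> w = 0}"

definition parity_check_matrix :: "nat \<Rightarrow> 'a::field vec set \<Rightarrow> 'a mat \<Rightarrow> bool" where
  "parity_check_matrix n C H \<longleftrightarrow>
     H \<in> carrier_mat (n - code_dim n C) n \<and> C = mat_kernel H \<and>
     dual_code n C = vec_space.row_space n H"

text \<open>The list \<open>js\<close> enumerates the recovery set; the word restricted to it is the list of its
  entries there.\<close>

definition has_locality :: "nat \<Rightarrow> 'a vec set \<Rightarrow> nat \<Rightarrow> bool" where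
  "has_locality n C r \<longleftrightarrow>
     (\<forall>i<n. \<exists>js. distinct js \<and> set js \<subseteq> {..<n} - {i} \<and> length js \<le> r \<and>
        (\<exists>f. \<forall>w\<in>C. w $ i = f (map (($) w) js)))"


section \<open>Operators on a Hilbert space with a finite orthonormal basis\<close>

text \<open>
  For a finite set \<open>L\<close> of basis labels, vectors are functions and operators are matrices that
  vanish off \<open>L\<close>; the entry \<open>M x y\<close> is \<open>\<langle>x|M|y\<rangle>\<close>.
\<close>

type_synonym 'l state = "'l \<Rightarrow> complex"
type_synonym 'l oper = "'l \<Rightarrow> 'l \<Rightarrow> complex"

definition states :: "'l set \<Rightarrow> 'l state set" where
  "states L = {\<psi>. \<forall>x. x \<notin> L \<longrightarrow> \<psi> x = 0}"

definition opers :: "'l set \<Rightarrow> 'l oper set" where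
  "opers L = {M. \<forall>x y. x \<notin> L \<or> y \<notin> L \<longrightarrow> M x y = 0}"

definition unit_state :: "'l set \<Rightarrow> 'l state \<Rightarrow> bool" where
  "unit_state L \<psi> \<longleftrightarrow> (\<Sum>x\<in>L. (cmod (\<psi> x))\<^sup>2) = 1"

definition proj_op :: "'l state \<Rightarrow> 'l oper" where
  "proj_op \<psi> = (\<lambda>x y. \<psi> x * cnj (\<psi> y))"

definition op_apply :: "'l set \<Rightarrow> 'l oper \<Rightarrow> 'l state \<Rightarrow> 'l state" where
  "op_apply L M \<psi> = (\<lambda>x. \<Sum>y\<in>L. M x y * \<psi> y)"

definition op_mult :: "'l set \<Rightarrow> 'l oper \<Rightarrow> 'l oper \<Rightarrow> 'l oper" where
  "op_mult L M N = (\<lambda>x z. \<Sum>y\<in>L. M x y * N y z)"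

definition op_adjoint :: "'l oper \<Rightarrow> 'l oper" where
  "op_adjoint M = (\<lambda>x y. cnj (M y x))"

definition op_id :: "'l set \<Rightarrow> 'l oper" where
  "op_id L = (\<lambda>x y. of_bool (x \<in> L \<and> x = y))"

definition op_trace :: "'l set \<Rightarrow> 'l oper \<Rightarrow> complex" where
  "op_trace L M = (\<Sum>x\<in>L. M x x)"

definition unitary_op :: "'l set \<Rightarrow> 'l oper \<Rightarrow> bool" where
  "unitary_op L U \<longleftrightarrow> U \<in> opers L \<and>
     op_mult L U (op_adjoint U) = op_id L \<and> op_mult L (op_adjoint U) U = op_id L"

text \<open>The order on \<open>complex\<close> makes \<open>0 \<le> z\<close> say that \<open>z\<close> is real and nonnegative.\<close>

definition psd :: "'l set \<Rightarrow> 'l oper \<Rightarrow> bool" where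
  "psd L M \<longleftrightarrow> M \<in> opers L \<and> (\<forall>v. 0 \<le> (\<Sum>x\<in>L. \<Sum>y\<in>L. cnj (v x) * M x y * v y))"

text \<open>\<open>\<Phi> \<otimes> id\<close>, where the second factor has an arbitrary basis: its action on
  \<open>M = (\<Sum>i j. M\<^bsub>i j\<^esub> \<otimes> |i\<rangle>\<langle>j|)\<close> is to apply \<open>\<Phi>\<close> to each block \<open>M\<^bsub>i j\<^esub>\<close>.\<close>

definition amplify :: "('l oper \<Rightarrow> 'l oper) \<Rightarrow> ('l \<times> 'k) oper \<Rightarrow> ('l \<times> 'k) oper" where
  "amplify \<Phi> M = (\<lambda>(x, i) (y, j). \<Phi> (\<lambda>x' y'. M (x', i) (y', j)) x y)"

definition completely_positive :: "'l set \<Rightarrow> ('l oper \<Rightarrow> 'l oper) \<Rightarrow> bool" where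
  "completely_positive L \<Phi> \<longleftrightarrow>
     (\<forall>m::nat. \<forall>M. psd (L \<times> {..<m}) M \<longrightarrow> psd (L \<times> {..<m}) (amplify \<Phi> M))"

definition quantum_channel :: "'l set \<Rightarrow> ('l oper \<Rightarrow> 'l oper) \<Rightarrow> bool" where
  "quantum_channel L \<Phi> \<longleftrightarrow>
     \<Phi> \<in> opers L \<rightarrow> opers L \<and>
     (\<forall>M\<in>opers L. \<forall>N\<in>opers L. \<Phi> (\<lambda>x y. M x y + N x y) = (\<lambda>x y. \<Phi> M x y + \<Phi> N x y)) \<and>
     (\<forall>a. \<forall>M\<in>opers L. \<Phi> (\<lambda>x y. a * M x y) = (\<lambda>x y. a * \<Phi> M x y)) \<and>
     (\<forall>M\<in>opers L. op_trace L (\<Phi> M) = op_trace L M) \<and>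
     completely_positive L \<Phi>"


section \<open>Qudit registers\<close>

text \<open>
  A register is a finite set of sites; its computational basis is labelled by the extensional
  functions from the sites to the field.
\<close>

definition labels :: "'s set \<Rightarrow> ('s \<Rightarrow> 'a) set" where
  "labels A = A \<rightarrow>\<^sub>E UNIV"

definition op_tensor ::
  "'s set \<Rightarrow> 's set \<Rightarrow> ('s \<Rightarrow> 'a) oper \<Rightarrow> ('s \<Rightarrow> 'a) oper \<Rightarrow> ('s \<Rightarrow> 'a) oper" where
  "op_tensor A B M N = (\<lambda>x y.
     if x \<in> labels (A \<union> B) \<and> y \<in> labels (A \<union> B)
     then M (restrict x A) (restrict y A) * N (restrict x B) (restrict y B) else 0)"

definition site_tensor :: "'s set \<Rightarrow> ('s \<Rightarrow> 'a oper) \<Rightarrow> ('s \<Rightarrow> 'a) oper" where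
  "site_tensor A M = (\<lambda>x y.
     if x \<in> labels A \<and> y \<in> labels A then \<Prod>s\<in>A. M s (x s) (y s) else 0)"

text \<open>\<open>partial_trace A E \<rho>\<close> traces out the sites \<open>E\<close> of the register \<open>A\<close>.\<close>

definition partial_trace ::
  "'s set \<Rightarrow> 's set \<Rightarrow> ('s \<Rightarrow> 'a) oper \<Rightarrow> ('s \<Rightarrow> 'a) oper" where
  "partial_trace A E \<rho> = (\<lambda>x y.
     if x \<in> labels (A - E) \<and> y \<in> labels (A - E)
     then \<Sum>e\<in>labels E. \<rho> (override_on x e E) (override_on y e E) else 0)"

definition erasure ::
  "'s set \<Rightarrow> 's set \<Rightarrow> ('s \<Rightarrow> 'a::finite) oper \<Rightarrow> ('s \<Rightarrow> 'a) oper" where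
  "erasure A E \<rho> = op_tensor E (A - E)
     (\<lambda>x y. op_id (labels E) x y / of_nat (CARD('a) ^ card E)) (partial_trace A E \<rho>)"

text \<open>\<open>on_subregister A S \<Phi>\<close> is \<open>\<Phi> \<otimes> id\<close>, with \<open>\<Phi>\<close> acting on the sites \<open>S\<close> of \<open>A\<close> and the
  identity on \<open>A - S\<close>.\<close>

definition on_subregister ::
  "'s set \<Rightarrow> 's set \<Rightarrow> (('s \<Rightarrow> 'a) oper \<Rightarrow> ('s \<Rightarrow> 'a) oper) \<Rightarrow> ('s \<Rightarrow> 'a) oper \<Rightarrow> ('s \<Rightarrow> 'a) oper" where
  "on_subregister A S \<Phi> \<rho> = (\<lambda>x y.
     if x \<in> labels A \<and> y \<in> labels A
     then \<Phi> (\<lambda>x' y'. if x' \<in> labels S \<and> y' \<in> labels S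
                      then \<rho> (override_on x x' S) (override_on y y' S) else 0)
            (restrict x S) (restrict y S)
     else 0)"


section \<open>Generalized Pauli operators\<close>

text \<open>The absolute trace, as an element of the prime subfield of \<open>'a\<close>, and the additive
  character \<open>x \<mapsto> exp (2 \<pi> i tr(x) / p)\<close> obtained by lifting it to its least representative.\<close>

definition field_degree :: "'a::{field,finite} itself \<Rightarrow> nat" where
  "field_degree _ = (THE m. CARD('a) = CHAR('a) ^ m)"

definition field_trace :: "'a::{field,finite} \<Rightarrow> 'a" where
  "field_trace x = (\<Sum>i<field_degree TYPE('a). x ^ (CHAR('a) ^ i))"

definition add_char :: "'a::{field,finite} \<Rightarrow> complex" where
  "add_char x = cis (2 * pi / real CHAR('a)) ^ (LEAST t::nat. of_nat t = field_trace x)"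

definition qudit_X :: "'a::{field,finite} \<Rightarrow> 'a oper" where
  "qudit_X a = (\<lambda>y x. of_bool (y = x + a))"

definition qudit_Z :: "'a::{field,finite} \<Rightarrow> 'a oper" where
  "qudit_Z b = (\<lambda>y x. of_bool (y = x) * add_char (b * x))"

definition pauli_X :: "'s set \<Rightarrow> ('s \<Rightarrow> 'a::{field,finite}) \<Rightarrow> ('s \<Rightarrow> 'a) oper" where
  "pauli_X A a = site_tensor A (\<lambda>s. qudit_X (a s))"

definition pauli_Z :: "'s set \<Rightarrow> ('s \<Rightarrow> 'a::{field,finite}) \<Rightarrow> ('s \<Rightarrow> 'a) oper" where
  "pauli_Z A b = site_tensor A (\<lambda>s. qudit_Z (b s))"

definition pauli_XZ ::
  "'s set \<Rightarrow> ('s \<Rightarrow> 'a::{field,finite}) \<Rightarrow> ('s \<Rightarrow> 'a) \<Rightarrow> ('s \<Rightarrow> 'a) oper" where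
  "pauli_XZ A a b = op_mult (labels A) (pauli_X A a) (pauli_Z A b)"


section \<open>Entanglement-assisted codes\<close>

text \<open>The transmitted qudits are the sites \<open>Inl j\<close>, Bob's noiseless qudits the sites \<open>Inr j\<close>.\<close>

type_synonym site = "nat + nat"

definition reg_Q :: "nat \<Rightarrow> site set" where
  "reg_Q n = Inl ` {..<n}"

definition reg_B :: "nat \<Rightarrow> site set" where
  "reg_B c = Inr ` {..<c}"

definition reg :: "nat \<Rightarrow> nat \<Rightarrow> site set" where
  "reg n c = reg_Q n \<union> reg_B c"

text \<open>\<open>encoder_input n \<kappa> c \<phi> w\<close> is \<open>|\<phi>\<rangle> \<otimes> |0\<rangle>\<^bsup>n-\<kappa>-c\<^esup> \<otimes> |w\<rangle>\<close> on the \<open>n\<close> transmitted qudits.\<close>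

definition encoder_input ::
  "nat \<Rightarrow> nat \<Rightarrow> nat \<Rightarrow> (site \<Rightarrow> 'a::{field,finite}) state \<Rightarrow> 'a vec \<Rightarrow> (site \<Rightarrow> 'a) state" where
  "encoder_input n \<kappa> c \<phi> w = (\<lambda>z.
     if z \<in> labels (reg_Q n) \<and> (\<forall>j\<in>{\<kappa>..<n - c}. z (Inl j) = 0) \<and>
        (\<forall>j<c. z (Inl (n - c + j)) = w $ j)
     then \<phi> (restrict z (reg_Q \<kappa>)) else 0)"

definition ea_isometry ::
  "nat \<Rightarrow> nat \<Rightarrow> nat \<Rightarrow> (site \<Rightarrow> 'a::{field,finite}) oper \<Rightarrow>
   (site \<Rightarrow> 'a) state \<Rightarrow> (site \<Rightarrow> 'a) state" where
  "ea_isometry n \<kappa> c U \<phi> = (\<lambda>z.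
     if z \<in> labels (reg n c)
     then complex_of_real (real CARD('a) powr (- real c / 2)) *
          (\<Sum>w\<in>carrier_vec c.
             op_apply (labels (reg_Q n)) U (encoder_input n \<kappa> c \<phi> w) (restrict z (reg_Q n)) *
             of_bool (\<forall>j<c. z (Inr j) = w $ j))
     else 0)"

definition corrects_erasure ::
  "nat \<Rightarrow> nat \<Rightarrow> (site \<Rightarrow> 'a::{field,finite}) state set \<Rightarrow> nat set \<Rightarrow> bool" where
  "corrects_erasure n c \<Q> E \<longleftrightarrow>
     (\<exists>\<Phi>. quantum_channel (labels (reg n c)) \<Phi> \<and>
        (\<forall>\<psi>\<in>\<Q>. unit_state (labels (reg n c)) \<psi> \<longrightarrow>
           \<Phi> (erasure (reg n c) (Inl ` E) (proj_op \<psi>)) = proj_op \<psi>))"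

definition eaqecc ::
  "nat \<Rightarrow> nat \<Rightarrow> nat \<Rightarrow> nat \<Rightarrow> (site \<Rightarrow> 'a::{field,finite}) state set \<Rightarrow> bool" where
  "eaqecc n \<kappa> \<delta> c \<Q> \<longleftrightarrow>
     \<kappa> + c \<le> n \<and>
     (\<exists>U. unitary_op (labels (reg_Q n)) U \<and>
        \<Q> = ea_isometry n \<kappa> c U ` states (labels (reg_Q \<kappa>))) \<and>
     (\<forall>E \<subseteq> {..<n}. card E \<le> \<delta> - 1 \<longrightarrow> corrects_erasure n c \<Q> E)"

definition recovery_set ::
  "nat \<Rightarrow> nat \<Rightarrow> (site \<Rightarrow> 'a::{field,finite}) state set \<Rightarrow> nat \<Rightarrow> nat set \<Rightarrow> bool" where
  "recovery_set n c \<Q> i R \<longleftrightarrow>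
     R \<subseteq> {..<n} - {i} \<and>
     (let S = Inl ` insert i R \<union> reg_B c in
      \<exists>\<Phi>. quantum_channel (labels S) \<Phi> \<and>
        (\<forall>\<psi>\<in>\<Q>. unit_state (labels (reg n c)) \<psi> \<longrightarrow>
           on_subregister (reg n c) S \<Phi> (erasure (reg n c) {Inl i} (proj_op \<psi>)) = proj_op \<psi>))"

definition eaqlrc ::
  "nat \<Rightarrow> nat \<Rightarrow> nat \<Rightarrow> nat \<Rightarrow> nat \<Rightarrow> (site \<Rightarrow> 'a::{field,finite}) state set \<Rightarrow> bool" where
  "eaqlrc n \<kappa> \<delta> c r \<Q> \<longleftrightarrow>
     eaqecc n \<kappa> \<delta> c \<Q> \<and> (\<forall>i<n. \<exists>R. recovery_set n c \<Q> i R \<and> card R \<le> r)"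


section \<open>EA-CSS codes\<close>

text \<open>The row vector \<open>u H\<close> is written \<open>transpose_mat H *\<^sub>v u\<close>.\<close>

definition eacss_stabilizer ::
  "nat \<Rightarrow> nat \<Rightarrow> 'a::{field,finite} mat \<Rightarrow> 'a mat \<Rightarrow> 'a mat \<Rightarrow> 'a mat \<Rightarrow>
   'a vec \<Rightarrow> 'a vec \<Rightarrow> (site \<Rightarrow> 'a) oper" where
  "eacss_stabilizer n c HX HZ FX FZ u v =
     (let a = case_sum (($) (transpose_mat HX *\<^sub>v u)) (($) (transpose_mat FX *\<^sub>v u));
          b = case_sum (($) (transpose_mat HZ *\<^sub>v v)) (($) (transpose_mat FZ *\<^sub>v v))
      in op_tensor (reg_Q n) (reg_B c) (pauli_XZ (reg_Q n) a b) (pauli_XZ (reg_B c) a b))"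

text \<open>\<open>eacss_code n CX CZ \<Q>\<close>: the space \<open>\<Q>\<close> is the EA-CSS code of \<open>CX\<close> and \<open>CZ\<close> for some choice of
  parity-check matrices and of the rank factorization.\<close>

definition eacss_code ::
  "nat \<Rightarrow> 'a::{field,finite} vec set \<Rightarrow> 'a vec set \<Rightarrow> (site \<Rightarrow> 'a) state set \<Rightarrow> bool" where
  "eacss_code n CX CZ \<Q> \<longleftrightarrow>
     (\<exists>HX HZ FX FZ c.
        parity_check_matrix n CX HX \<and> parity_check_matrix n CZ HZ \<and>
        c = vec_space.rank (n - code_dim n CX) (HX * transpose_mat HZ) \<and>
        FX \<in> carrier_mat (n - code_dim n CX) c \<and> FZ \<in> carrier_mat (n - code_dim n CZ) c \<and>
        - (HX * transpose_mat HZ) = FX * transpose_mat FZ \<and>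
        \<Q> = {\<psi> \<in> states (labels (reg n c)).
              \<forall>u \<in> carrier_vec (n - code_dim n CX). \<forall>v \<in> carrier_vec (n - code_dim n CZ).
                op_apply (labels (reg n c)) (eacss_stabilizer n c HX HZ FX FZ u v) \<psi> = \<psi>})"

definition eacss_dist :: "nat \<Rightarrow> 'a::{field,finite} vec set \<Rightarrow> 'a vec set \<Rightarrow> nat" where
  "eacss_dist n CX CZ =
     (if CX \<subseteq> dual_code n CZ then min (min_dist CX) (min_dist CZ)
      else min (wt (CX - (CX \<inter> dual_code n CZ))) (wt (CZ - (dual_code n CX \<inter> CZ))))"

definition eacss_pure :: "nat \<Rightarrow> 'a::{field,finite} vec set \<Rightarrow> 'a vec set \<Rightarrow> bool" where
  "eacss_pure n CX CZ \<longleftrightarrow> eacss_dist n CX CZ = min (min_dist CX) (min_dist CZ)"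

abbreviation eacss_impure :: "nat \<Rightarrow> 'a::{field,finite} vec set \<Rightarrow> 'a vec set \<Rightarrow> bool" where
  "eacss_impure n CX CZ \<equiv> \<not> eacss_pure n CX CZ"

end

theory Submission
  imports Defs
    "HOL-Library.Function_Algebras"
    "HOL-Number_Theory.Cong"
    "HOL-Computational_Algebra.Polynomial"
begin

text \<open>
  Identify basis labels with vectors over the field. A state is fixed by the stabilizer group iff it is
  supported on \<open>TZ\<^sup>\<bottom>\<close> and invariant under translation by \<open>TX\<close>, where \<open>TX\<close> and \<open>TZ\<close> collect the exponent
  vectors \<open>(u H, u F)\<close> of the \<open>X\<close>- and the \<open>Z\<close>-type elements. As the rank factors have full column rank,
  both project onto Bob's register, and the elements trivial there are exactly the hull
  \<open>C \<inter> C\<^sup>\<bottom>\<close>, while the vectors on the transmitted register orthogonal to all of \<open>TZ\<close> are exactly \<open>C\<close>.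
  Hence the code has an orthonormal basis of uniform superpositions indexed by \<open>C / (C \<inter> C\<^sup>\<bottom>)\<close>,
  which is the image of the required isometry.

  Erasing a set of qudits is a random Pauli error there. Measuring the stabilizer elements supported
  on a set \<open>S\<close> of accessible sites and undoing a guessed error restores the state as soon as every \<open>X\<close>-
  or \<open>Z\<close>-error on the erased sites which they do not detect is itself a stabilizer element. For the
  distance, \<open>S\<close> is everything, and undetected errors of weight below \<open>\<delta>\<close> are codewords, hence lie in the
  hull. For locality, the word of \<open>C\<^sup>\<bottom>\<close> expressing the local recovery rule detects every error at \<open>i\<close>.
\<close>

section \<open>The additive character of a finite field\<close>

text \<open>Dimensions are handled through cardinalities: over a field with q elements a subspace of
  dimension d has q^d elements. Rank-nullity becomes a count of fibres, and the relation between a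
  linear set and its orthogonal complement becomes a double count of a character sum. This needs
  \<open>add_char\<close> to be a nontrivial character, which rests on the trace not vanishing
  identically.

  The rows of the two parity-check matrices need not be orthogonal to each other. Bob's register
  repairs this: the minus sign in the rank factorization makes the inner products on the two
  registers cancel.

  Syndromes are cosets without canonical representatives. The decoder is therefore indexed by all
  pairs of vectors on \<open>S\<close>, each syndrome occurs many times, and a normalising constant
  absorbs the repetition. The encoder instead chooses: a transversal of \<open>W0\<close> modulo
  \<open>T0\<close> for the messages and a section of the projection of \<open>TX\<close> to Bob's
  register for his labels. These choices fix only the columns of the unitary that belong to
  admissible inputs; the others are arbitrary.\<close>

lemma CHAR_prime: "prime CHAR('a::{field,finite})"
  using prime_CHAR_semidom[where 'a='a] finite_imp_CHAR_pos[where 'a='a] by simp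

text \<open>Multiplication by a nonzero \<open>x\<close> permutes the nonzero elements, so their
  product is unchanged by the factor x^(q-1).\<close>

lemma power_CARD_eq_same:
  fixes x :: "'a :: {field,finite}"
  shows   "x ^ CARD('a) = x"
proof (cases "x = 0")
  case False
  have "x * (\<Prod>y\<in>UNIV-{0}. x * y) = x * x ^ (CARD('a) - 1) * \<Prod>(UNIV-{0})"
    by (simp add: prod.distrib mult_ac)
  also have "x * x ^ (CARD('a) - 1) = x ^ CARD('a)"
    by (metis power_Suc Suc_pred' zero_less_card_finite)
  also have "(\<Prod>y\<in>UNIV-{0}. x * y) = (\<Prod>y\<in>UNIV-{0}. y)"
    by (rule prod.reindex_bij_witness[of _ "\<lambda>y. y / x" "\<lambda>y. x * y"]) (use False in auto)
  finally show ?thesis by simp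
qed auto

text \<open>Adjoining one more element to a proper additive subgroup multiplies its order by the characteristic.\<close>

lemma CARD_eq_CHAR_power: "\<exists>m. CARD('a::{field,finite}) = CHAR('a) ^ m"
proof -
  let ?p = "CHAR('a)"
  have p: "prime ?p" by (rule CHAR_prime)
  \<comment> \<open>Additive subgroups whose order is a power of p; a largest one will turn out to
    be the whole field.\<close>
  define G where "G = (\<lambda>H::'a set. 0 \<in> H \<and> (\<forall>x\<in>H. \<forall>y\<in>H. x - y \<in> H) \<and> (\<exists>m. card H = ?p ^ m))"
  have ext: "\<exists>H'. G H' \<and> H \<subset> H'" if H: "G H" and ne: "H \<noteq> UNIV" for H
  proof -
    obtain x where x: "x \<notin> H" using ne by auto
    obtain m where m: "card H = ?p ^ m" using H by (auto simp: G_def)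
    have sub: "a - b \<in> H" if "a \<in> H" "b \<in> H" for a b using H that by (auto simp: G_def)
    have z: "0 \<in> H" using H by (auto simp: G_def)
    have neg: "- a \<in> H" if "a \<in> H" for a using sub[OF z that] by simp
    have add: "a + b \<in> H" if "a \<in> H" "b \<in> H" for a b using sub[OF that(1) neg[OF that(2)]] by simp
    have mul: "of_nat j * a \<in> H" if "a \<in> H" for a j
      by (induction j) (auto simp: z algebra_simps intro!: add that)
    \<comment> \<open>Otherwise j is invertible modulo p, and multiplying by an inverse would put
      \<open>x\<close> itself into \<open>H\<close>.\<close>
    have key: "?p dvd j" if "of_nat j * x \<in> H" for j
    proof (rule ccontr)
      assume "\<not> ?p dvd j"
      hence "coprime j ?p" using p prime_imp_coprime coprime_commute by blast
      then obtain u where u: "[j * u = 1] (mod ?p)" using cong_solve_coprime_nat by fastforce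
      hence "of_nat (j * u) = (of_nat 1 :: 'a)" using of_nat_eq_iff_cong_CHAR by blast
      hence "x = of_nat u * (of_nat j * x)" by (simp add: mult_ac)
      with mul[OF that, of u] x show False by simp
    qed
    \<comment> \<open>The union of the p cosets of \<open>H\<close> by multiples of
      \<open>x\<close>; \<open>key\<close> makes them disjoint, so the order grows by the factor
      p.\<close>
    let ?f = "\<lambda>(j,h). of_nat j * x + h"
    let ?H' = "?f ` ({..<?p} \<times> H)"
    have inH': "of_nat j * x + h \<in> ?H'" if "h \<in> H" for j h
    proof -
      have "of_nat j = (of_nat (j mod ?p) :: 'a)" by (simp add: of_nat_eq_iff_cong_CHAR Cong.cong_def)
      thus ?thesis using that p by (intro image_eqI[of _ _ "(j mod ?p, h)"]) (auto simp: prime_gt_0_nat)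
    qed
    have wlog: "j = j' \<and> h = h'" if "of_nat j * x + h = of_nat j' * x + h'" "j \<le> j'" "j' < ?p" "h \<in> H" "h' \<in> H" for j j' h h'
    proof -
      have "of_nat (j' - j) * x = h - h'" using that by (simp add: of_nat_diff algebra_simps)
      hence "?p dvd j' - j" using key sub that by metis
      hence "j' - j = 0" using that by (meson dvd_imp_le gr0I le_less_trans diff_le_self not_le)
      hence "j = j'" using that by simp
      thus ?thesis using that by simp
    qed
    have inj: "inj_on ?f ({..<?p} \<times> H)"
    proof (rule inj_onI, clarsimp)
      fix j h j' h' assume a: "j < ?p" "h \<in> H" "j' < ?p" "h' \<in> H" "of_nat j * x + h = of_nat j' * x + h'"
      thus "j = j' \<and> h = h'" using wlog[of j h j' h'] wlog[of j' h' j h] by (cases "j \<le> j'") auto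
    qed
    have "card ?H' = ?p ^ Suc m" by (simp add: card_image[OF inj] m)
    moreover have "0 \<in> ?H'" using inH'[OF z, of 0] by simp
    moreover have "a - b \<in> ?H'" if ab: "a \<in> ?H'" "b \<in> ?H'" for a b
    proof -
      obtain i h j h' where e: "a = of_nat i * x + h" "b = of_nat j * x + h'" "i < ?p" "j < ?p" "h \<in> H" "h' \<in> H"
        using ab by auto
      \<comment> \<open>Since p vanishes in the field, the coefficient p - j stands for -j and stays
        a natural number.\<close>
      have "a - b = of_nat (i + (?p - j)) * x + (h - h')"
        using e by (simp add: of_nat_diff algebra_simps)
      thus ?thesis using inH' sub e by metis
    qed
    ultimately have "G ?H'" unfolding G_def by blast
    moreover have "H \<subseteq> ?H'" using inH'[of _ 0] by auto
    moreover have "x \<in> ?H'" using inH'[OF z, of 1] by simp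
    ultimately show ?thesis using x by blast
  qed
  have G0: "G {0}" by (auto simp: G_def intro: exI[of _ 0])
  have "\<exists>H. G H \<and> (\<forall>H'. G H' \<longrightarrow> card H' \<le> card H)"
    using G0 by (intro ex_has_greatest_nat[where b="Suc CARD('a)"]) (auto simp: less_Suc_eq_le card_mono)
  then obtain H where H: "G H" "\<And>H'. G H' \<Longrightarrow> card H' \<le> card H" by blast
  have "H = UNIV"
    using ext[OF H(1)] H(2) by (metis psubset_card_mono finite not_le)
  thus ?thesis using H(1) by (auto simp: G_def)
qed

lemma CARD_eq_CHAR_power_field_degree: "CARD('a::{field,finite}) = CHAR('a) ^ field_degree TYPE('a)"
proof -
  obtain m where m: "CARD('a) = CHAR('a) ^ m" using CARD_eq_CHAR_power by blast
  have "CHAR('a) > 1" using CHAR_prime[where 'a='a] prime_gt_1_nat by blast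
  hence "\<exists>!m. CARD('a) = CHAR('a) ^ m" using m by (metis power_inject_exp)
  thus ?thesis unfolding field_degree_def by (rule theI')
qed

lemma field_degree_pos: "field_degree TYPE('a::{field,finite}) > 0"
proof (rule ccontr)
  assume "\<not> ?thesis"
  hence "CARD('a) = 1" using CARD_eq_CHAR_power_field_degree[where 'a='a] by simp
  thus False using card_1_singletonE[of "UNIV::'a set"] zero_neq_one[where 'a='a] by (metis singletonD UNIV_I)
qed

lemma field_trace_add: "field_trace (x + y) = field_trace x + field_trace (y::'a::{field,finite})"
  unfolding field_trace_def
  by (simp add: sum.distrib freshmans_dream'[OF CHAR_prime[where 'a='a] refl])

text \<open>The p-th power moves each summand to the next one and the last one back to
  \<open>x\<close>, because x^q = x.\<close>

lemma field_trace_Frobenius: "field_trace x ^ CHAR('a) = field_trace (x::'a::{field,finite})"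
proof -
  let ?p = "CHAR('a)" and ?m = "field_degree TYPE('a)"
  have "field_trace x ^ ?p = (\<Sum>i<?m. (x ^ (?p ^ i)) ^ ?p)"
    unfolding field_trace_def by (rule freshmans_dream_sum[OF CHAR_prime refl])
  also have "\<dots> = (\<Sum>i<?m. x ^ (?p ^ Suc i))" by (simp add: power_mult[symmetric] mult.commute)
  also have "\<dots> = (\<Sum>i<Suc ?m. x ^ (?p ^ i)) - x" by (subst sum.lessThan_Suc_shift) simp
  also have "\<dots> = field_trace x"
    by (simp add: field_trace_def CARD_eq_CHAR_power_field_degree[symmetric] power_CARD_eq_same)
  finally show ?thesis .
qed

text \<open>The polynomial Y^p - Y has at most p roots, and the p elements of the prime field
  already supply them.\<close>

lemma Frobenius_fixed_iff_prime_subfield: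
  fixes y :: "'a::{field,finite}"
  assumes "y ^ CHAR('a) = y"
  shows "\<exists>t. y = of_nat t"
proof -
  let ?p = "CHAR('a)"
  have p1: "?p > 1" using CHAR_prime[where 'a='a] prime_gt_1_nat by blast
  define P :: "'a poly" where "P = Polynomial.monom 1 ?p - Polynomial.monom 1 1"
  have c: "Polynomial.coeff P ?p = 1" using p1 by (simp add: P_def)
  hence P0: "P \<noteq> 0" by auto
  have deg: "Polynomial.degree P \<le> ?p" unfolding P_def
    using p1 by (intro degree_diff_le) (auto simp: degree_monom_eq)
  have root: "poly P z = z ^ ?p - z" for z by (simp add: P_def poly_monom)
  \<comment> \<open>Fermat's little theorem, by induction with additivity of the p-th power.\<close>
  have nat: "(of_nat t :: 'a) ^ ?p = of_nat t" for t
  proof (induction t)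
    case (Suc t)
    thus ?case using freshmans_dream[OF CHAR_prime[where 'a='a] refl, of "of_nat t" 1] by (simp add: add.commute)
  qed (use p1 in simp)
  have inj: "inj_on (of_nat :: nat \<Rightarrow> 'a) {..<?p}"
    by (auto simp: inj_on_def of_nat_eq_iff_cong_CHAR Cong.cong_def)
  have "(of_nat :: nat \<Rightarrow> 'a) ` {..<?p} = {z. poly P z = 0}"
  proof (rule card_seteq)
    show "finite {z. poly P z = 0}" by simp
    show "(of_nat :: nat \<Rightarrow> 'a) ` {..<?p} \<subseteq> {z. poly P z = 0}" by (auto simp: root nat)
    show "card {z. poly P z = 0} \<le> card ((of_nat :: nat \<Rightarrow> 'a) ` {..<?p})"
      using card_poly_roots_bound[OF P0] deg by (simp add: card_image[OF inj])
  qed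
  moreover have "y \<in> {z. poly P z = 0}" using assms by (simp add: root)
  ultimately show ?thesis by blast
qed

text \<open>The trace is given by a nonzero polynomial of degree below q, which cannot vanish at all
  q elements.\<close>

lemma field_trace_nonzero: "\<exists>x::'a::{field,finite}. field_trace x \<noteq> 0"
proof -
  let ?p = "CHAR('a)" and ?m = "field_degree TYPE('a)"
  have p1: "?p > 1" using CHAR_prime[where 'a='a] prime_gt_1_nat by blast
  define P :: "'a poly" where "P = (\<Sum>i<?m. Polynomial.monom 1 (?p ^ i))"
  \<comment> \<open>The exponents p^i are distinct, so the top coefficient comes from the last
    summand alone.\<close>
  have "Polynomial.coeff P (?p ^ (?m - 1)) = (\<Sum>i<?m. if i = ?m - 1 then 1 else 0)"
    unfolding P_def Polynomial.coeff_sum using p1 by (intro sum.cong) (auto simp: power_inject_exp)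
  also have "\<dots> = 1" using field_degree_pos[where 'a='a] by (simp add: sum.delta)
  finally have P0: "P \<noteq> 0" by auto
  have "Polynomial.degree P \<le> ?p ^ (?m - 1)" unfolding P_def
    using p1 field_degree_pos[where 'a='a]
    by (intro degree_sum_le) (auto simp: degree_monom_eq intro!: power_increasing)
  also have "\<dots> < ?p ^ ?m" using p1 field_degree_pos[where 'a='a] by (intro power_strict_increasing) auto
  finally have "card {x. poly P x = 0} < CARD('a)"
    using card_poly_roots_bound[OF P0] CARD_eq_CHAR_power_field_degree[where 'a='a] by linarith
  hence "{x. poly P x = 0} \<noteq> UNIV" by auto
  moreover have "poly P x = field_trace x" for x by (simp add: P_def poly_sum poly_monom field_trace_def)
  ultimately show ?thesis by auto
qed

text \<open>Two representatives of the trace are congruent modulo p, and the base is a p-th root of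
  unity. This frees later arguments from the \<open>LEAST\<close> representative.\<close>

lemma add_char_eq:
  fixes x :: "'a::{field,finite}"
  assumes "of_nat t = field_trace x"
  shows "add_char x = cis (2 * pi / real CHAR('a)) ^ t"
proof -
  let ?p = "CHAR('a)"
  have p: "?p > 0" using CHAR_prime[where 'a='a] prime_gt_0_nat by blast
  define s where "s = (LEAST t::nat. of_nat t = field_trace x)"
  have "of_nat s = field_trace x" unfolding s_def using assms by (rule LeastI)
  hence "s mod ?p = t mod ?p" using assms of_nat_eq_iff_cong_CHAR[of s t, where 'a='a] by (simp add: Cong.cong_def)
  moreover have "cis (2 * pi / real ?p) ^ ?p = 1" using p by (simp add: DeMoivre)
  hence "cis (2 * pi / real ?p) ^ j = cis (2 * pi / real ?p) ^ (j mod ?p)" for j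
    by (metis (no_types) mult_div_mod_eq power_add power_mult power_one mult_1)
  ultimately show ?thesis by (metis add_char_def s_def)
qed

text \<open>The trace is fixed by Frobenius and so lies in the prime field; hence the
  \<open>LEAST\<close> in \<open>add_char\<close> is taken over a nonempty set.\<close>

lemma field_trace_of_nat: "\<exists>t. of_nat t = field_trace (x::'a::{field,finite})"
  using Frobenius_fixed_iff_prime_subfield[OF field_trace_Frobenius] by metis

lemma add_char_add: "add_char (x + y) = add_char x * add_char (y::'a::{field,finite})"
proof -
  obtain s t where st: "of_nat s = field_trace x" "of_nat t = field_trace y" using field_trace_of_nat by metis
  hence "of_nat (s + t) = field_trace (x + y)" by (simp add: field_trace_add)
  from add_char_eq[OF this] show ?thesis using add_char_eq[OF st(1)] add_char_eq[OF st(2)] by (simp add: power_add)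
qed

lemma norm_add_char [simp]: "cmod (add_char x) = 1"
  by (simp add: add_char_def norm_power)

lemma add_char_0 [simp]: "add_char (0::'a::{field,finite}) = 1"
proof -
  have "add_char (0::'a) * add_char (0::'a) = add_char (0::'a) * 1" using add_char_add[of "0::'a" 0] by simp
  moreover have "add_char (0::'a) \<noteq> 0" using norm_add_char[of "0::'a"] by (metis norm_zero zero_neq_one)
  ultimately show ?thesis by (metis mult_cancel_left)
qed

lemma add_char_uminus: "add_char (- x) = cnj (add_char (x::'a::{field,finite}))"
proof -
  have "add_char (- x) * (add_char x * cnj (add_char x)) = cnj (add_char x)"
    using add_char_add[of "- x" x] by (simp add: mult.assoc[symmetric])
  thus ?thesis by (simp add: complex_norm_square[symmetric])
qed

text \<open>Multiples of \<open>y\<close> fill the field, so one of them has nonzero trace. A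
  representative of that trace is not divisible by p, and the corresponding root of unity differs
  from 1.\<close>

lemma add_char_nontrivial:
  fixes y :: "'a::{field,finite}"
  assumes "y \<noteq> 0"
  shows "\<exists>v. add_char (v * y) \<noteq> 1"
proof -
  let ?p = "CHAR('a)"
  have p: "?p > 0" using CHAR_prime[where 'a='a] prime_gt_0_nat by blast
  obtain x :: 'a where x: "field_trace x \<noteq> 0" using field_trace_nonzero by blast
  obtain t where t: "of_nat t = field_trace x" using field_trace_of_nat by metis
  have "add_char x = cis (2 * pi * real t / real ?p)" by (simp add: add_char_eq[OF t] DeMoivre mult_ac)
  moreover have "cis (2 * pi * real t / real ?p) \<noteq> 1"
  proof
    assume "cis (2 * pi * real t / real ?p) = 1"
    hence "cos (2 * pi * real t / real ?p) = 1" by (metis cis.sel(1) one_complex.sel(1))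
    then obtain k :: int where "2 * pi * real t / real ?p = of_int k * 2 * pi" using cos_one_2pi_int by auto
    hence "real t = of_int k * real ?p" using p by (simp add: field_simps)
    hence "int t = k * int ?p" by (metis of_int_eq_iff of_int_mult of_int_of_nat_eq)
    hence "?p dvd t" by (metis dvd_triv_right int_dvd_int_iff)
    hence "(of_nat t :: 'a) = 0" by (simp add: of_nat_eq_0_iff_char_dvd)
    thus False using x t by simp
  qed
  ultimately show ?thesis using assms by (intro exI[of _ "x / y"]) simp
qed

section \<open>Kraus operators and extension of orthonormal families\<close>

text \<open>Cyclicity of the trace in coordinates. The bracket on the right is an entry of the sum
  of all products of the adjoint of \<open>K j\<close> with \<open>K j\<close>, which the
  completeness relation evaluates.\<close>

lemma kraus_trace_sum:
  fixes K :: "'j \<Rightarrow> 'l oper"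
  shows "(\<Sum>x\<in>L. \<Sum>j\<in>J. \<Sum>x'\<in>L. \<Sum>y'\<in>L. K j x x' * \<rho> x' y' * cnj (K j x y')) =
    (\<Sum>x'\<in>L. \<Sum>y'\<in>L. \<rho> x' y' * (\<Sum>j\<in>J. \<Sum>x\<in>L. cnj (K j x y') * K j x x'))"
proof -
  define T where "T = (\<lambda>x j x' y'. K j x x' * \<rho> x' y' * cnj (K j x y'))"
  have "(\<Sum>x\<in>L. \<Sum>j\<in>J. \<Sum>x'\<in>L. \<Sum>y'\<in>L. T x j x' y') = (\<Sum>(x,j,x',y')\<in>L\<times>J\<times>L\<times>L. T x j x' y')"
    by (simp add: sum.cartesian_product)
  also have "\<dots> = (\<Sum>(x',y',j,x)\<in>L\<times>L\<times>J\<times>L. T x j x' y')"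
    by (rule sum.reindex_bij_witness[of _ "\<lambda>(x',y',j,x). (x,j,x',y')" "\<lambda>(x,j,x',y'). (x',y',j,x)"]) auto
  also have "\<dots> = (\<Sum>x'\<in>L. \<Sum>y'\<in>L. \<Sum>j\<in>J. \<Sum>x\<in>L. T x j x' y')"
    by (simp add: sum.cartesian_product)
  finally show ?thesis unfolding T_def by (simp add: sum_distrib_left mult_ac)
qed

text \<open>Conjugation by \<open>K\<close> moves onto the test vector: \<open>w\<close> is the
  adjoint of \<open>K\<close>, tensored with the identity, applied to \<open>v\<close>. Positivity
  is thereby inherited from \<open>M\<close>.\<close>

lemma kraus_quadratic_form:
  fixes K :: "'l oper" and M :: "('l \<times> 'k) oper"
  assumes "w = (\<lambda>(x', i). \<Sum>x\<in>L. cnj (K x x') * v (x, i))"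
  shows "(\<Sum>(x, i)\<in>L \<times> I. \<Sum>(y, j)\<in>L \<times> I. cnj (v (x, i)) *
            (\<Sum>x'\<in>L. \<Sum>y'\<in>L. K x x' * M (x', i) (y', j) * cnj (K y y')) * v (y, j))
       = (\<Sum>p\<in>L \<times> I. \<Sum>q\<in>L \<times> I. cnj (w p) * M p q * w q)"
proof -
  define T where "T = (\<lambda>x i y j x' y'. cnj (v (x, i)) * (K x x' * M (x', i) (y', j) * cnj (K y y')) * v (y, j))"
  have key: "(\<Sum>x\<in>L. \<Sum>y\<in>L. T x i y j x' y') = cnj (w (x', i)) * M (x', i) (y', j) * w (y', j)" for x' i y' j
  proof -
    have "cnj (w (x', i)) * M (x', i) (y', j) * w (y', j) = M (x', i) (y', j) * (cnj (w (x', i)) * w (y', j))"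
      by simp
    thus ?thesis by (simp add: assms T_def sum_product sum_distrib_left mult_ac)
  qed
  have "(\<Sum>(x, i)\<in>L \<times> I. \<Sum>(y, j)\<in>L \<times> I. cnj (v (x, i)) *
            (\<Sum>x'\<in>L. \<Sum>y'\<in>L. K x x' * M (x', i) (y', j) * cnj (K y y')) * v (y, j))
      = (\<Sum>(x, i)\<in>L \<times> I. \<Sum>(y, j)\<in>L \<times> I. \<Sum>x'\<in>L. \<Sum>y'\<in>L. T x i y j x' y')"
    unfolding T_def sum_distrib_left sum_distrib_right by simp
  also have "\<dots> = (\<Sum>((x,i),(y,j),x',y')\<in>(L\<times>I)\<times>(L\<times>I)\<times>L\<times>L. T x i y j x' y')"
    by (simp add: sum.cartesian_product case_prod_beta)
  also have "\<dots> = (\<Sum>((x',i),(y',j),x,y)\<in>(L\<times>I)\<times>(L\<times>I)\<times>L\<times>L. T x i y j x' y')"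
    by (rule sum.reindex_bij_witness[of _ "\<lambda>((x,i),(y,j),x',y'). ((x',i),(y',j),x,y)"
          "\<lambda>((x,i),(y,j),x',y'). ((x',i),(y',j),x,y)"]) auto
  also have "\<dots> = (\<Sum>(x', i)\<in>L \<times> I. \<Sum>(y', j)\<in>L \<times> I. \<Sum>x\<in>L. \<Sum>y\<in>L. T x i y j x' y')"
    by (simp add: sum.cartesian_product case_prod_beta)
  also have "\<dots> = (\<Sum>p\<in>L \<times> I. \<Sum>q\<in>L \<times> I. cnj (w p) * M p q * w q)"
    unfolding key by (simp add: case_prod_beta)
  finally show ?thesis .
qed

text \<open>\<open>sum1\<close> is the completeness relation and yields trace preservation. Complete
  positivity holds for each Kraus operator separately and survives summation.\<close>

lemma kraus_quantum_channel:
  fixes K :: "'j \<Rightarrow> 'l oper"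
  assumes K: "\<And>j. j \<in> J \<Longrightarrow> K j \<in> opers L" and L: "finite L"
    and sum1: "\<And>y z. y \<in> L \<Longrightarrow> z \<in> L \<Longrightarrow> (\<Sum>j\<in>J. \<Sum>x\<in>L. cnj (K j x y) * K j x z) = of_bool (y = z)"
  shows "quantum_channel L (\<lambda>\<rho> x y. \<Sum>j\<in>J. \<Sum>x'\<in>L. \<Sum>y'\<in>L. K j x x' * \<rho> x' y' * cnj (K j y y'))"
    (is "quantum_channel L ?\<Phi>")
proof -
  have K0: "K j x y = 0" if "j \<in> J" "x \<notin> L \<or> y \<notin> L" for j x y
    using K[OF that(1)] that(2) unfolding opers_def by blast
  have tr: "op_trace L (?\<Phi> M) = op_trace L M" for M
  proof -
    have "op_trace L (?\<Phi> M) = (\<Sum>x'\<in>L. \<Sum>y'\<in>L. M x' y' * (\<Sum>j\<in>J. \<Sum>x\<in>L. cnj (K j x y') * K j x x'))"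
      unfolding op_trace_def by (rule kraus_trace_sum)
    also have "\<dots> = (\<Sum>x'\<in>L. \<Sum>y'\<in>L. M x' y' * of_bool (y' = x'))"
      using sum1 by (intro sum.cong refl) auto
    also have "\<dots> = op_trace L M"
      unfolding op_trace_def using L
      by (intro sum.cong refl) (simp add: of_bool_def if_distrib[of "\<lambda>t. _ * t"] sum.delta cong: if_cong)
    finally show ?thesis .
  qed
  have cp: "psd (L \<times> {..<m}) (amplify ?\<Phi> M)" if M: "psd (L \<times> {..<m::nat}) M" for m M
    unfolding psd_def
  proof (intro conjI allI)
    have M0: "M p q = 0" if "p \<notin> L \<times> {..<m} \<or> q \<notin> L \<times> {..<m}" for p q
      using M that unfolding psd_def opers_def by blast
    show "amplify ?\<Phi> M \<in> opers (L \<times> {..<m})"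
    proof -
      have "K j x x' * M (x', i) (y', i') * cnj (K j y y') = 0"
        if "j \<in> J" "(x, i) \<notin> L \<times> {..<m} \<or> (y, i') \<notin> L \<times> {..<m}" for j x x' y y' and i i' :: nat
        using that K0[OF that(1), of x x'] K0[OF that(1), of y y'] M0[of "(x', i)" "(y', i')"] by auto
      thus ?thesis unfolding opers_def amplify_def by (auto intro!: sum.neutral)
    qed
    fix v :: "'l \<times> nat \<Rightarrow> complex"
    define w where "w = (\<lambda>j. \<lambda>(x', i). \<Sum>x\<in>L. cnj (K j x x') * v (x, i))"
    let ?P = "L \<times> {..<m}"
    define T where "T = (\<lambda>j p q. cnj (v p) * (\<Sum>x'\<in>L. \<Sum>y'\<in>L. K j (fst p) x' * M (x', snd p) (y', snd q) * cnj (K j (fst q) y')) * v q)"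
    have "cnj (v p) * amplify ?\<Phi> M p q * v q = (\<Sum>j\<in>J. T j p q)" for p q
      unfolding amplify_def T_def by (simp only: case_prod_beta sum_distrib_left sum_distrib_right)
    hence "(\<Sum>p\<in>?P. \<Sum>q\<in>?P. cnj (v p) * amplify ?\<Phi> M p q * v q) = (\<Sum>p\<in>?P. \<Sum>q\<in>?P. \<Sum>j\<in>J. T j p q)"
      by simp
    also have "\<dots> = (\<Sum>p\<in>?P. \<Sum>j\<in>J. \<Sum>q\<in>?P. T j p q)"
      by (rule sum.cong[OF refl sum.swap])
    also have "\<dots> = (\<Sum>j\<in>J. \<Sum>p\<in>?P. \<Sum>q\<in>?P. T j p q)"
      by (rule sum.swap)
    also have "\<dots> = (\<Sum>j\<in>J. \<Sum>(x, i)\<in>?P. \<Sum>(y, j')\<in>?P. cnj (v (x, i)) *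
            (\<Sum>x'\<in>L. \<Sum>y'\<in>L. K j x x' * M (x', i) (y', j') * cnj (K j y y')) * v (y, j'))"
      unfolding T_def by (simp add: case_prod_beta)
    also have "\<dots> = (\<Sum>j\<in>J. \<Sum>p\<in>?P. \<Sum>q\<in>?P. cnj (w j p) * M p q * w j q)"
      by (intro sum.cong refl kraus_quadratic_form) (simp add: w_def)
    also have "0 \<le> \<dots>"
      using M unfolding psd_def by (intro sum_nonneg[where A=J]) blast
    finally show "0 \<le> (\<Sum>p\<in>?P. \<Sum>q\<in>?P. cnj (v p) * amplify ?\<Phi> M p q * v q)" .
  qed
  show ?thesis
    unfolding quantum_channel_def completely_positive_def
  proof (intro conjI ballI allI impI)
    show "?\<Phi> \<in> opers L \<rightarrow> opers L" using K0 by (auto simp: opers_def intro!: sum.neutral)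
  qed (use tr cp in \<open>auto simp: sum.distrib algebra_simps sum_distrib_left\<close>)
qed

section \<open>Completing an orthonormal family to a unitary operator\<close>

lemma complex_cnj_of_bool [simp]: "cnj (of_bool b) = of_bool b"
  by (cases b) auto

lemma cnj_mult_self_sum: "(\<Sum>y\<in>L. cnj (f y) * f y) = complex_of_real (\<Sum>y\<in>L. (cmod (f y))\<^sup>2)"
  by (simp add: mult.commute complex_norm_square del: of_real_power)

text \<open>\<open>f\<close> is the part of the basis vector at \<open>x\<close> orthogonal to the
  span of the family; its squared norm follows from Pythagoras.\<close>

lemma orthonormal_residual:
  fixes e :: "'s \<Rightarrow> 'l state"
  assumes L: "finite L" and S: "finite S" and x: "x \<in> L"
    and on: "\<And>s t. s \<in> S \<Longrightarrow> t \<in> S \<Longrightarrow> (\<Sum>y\<in>L. cnj (e s y) * e t y) = of_bool (s = t)"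
    and f: "f = (\<lambda>y. of_bool (y = x) - (\<Sum>s\<in>S. cnj (e s x) * e s y))"
  shows "\<And>t. t \<in> S \<Longrightarrow> (\<Sum>y\<in>L. cnj (e t y) * f y) = 0"
    and "(\<Sum>y\<in>L. cnj (f y) * f y) = complex_of_real (1 - (\<Sum>s\<in>S. (cmod (e s x))\<^sup>2))"
proof -
  have delta: "(\<Sum>y\<in>L. g y * of_bool (y = x)) = g x" for g :: "'l \<Rightarrow> complex"
    using L x by (simp add: of_bool_def if_distrib[of "\<lambda>t. _ * t"] sum.delta cong: if_cong)
  show orth: "(\<Sum>y\<in>L. cnj (e t y) * f y) = 0" if t: "t \<in> S" for t
  proof -
    have "(\<Sum>y\<in>L. cnj (e t y) * (\<Sum>s\<in>S. cnj (e s x) * e s y)) = (\<Sum>s\<in>S. cnj (e s x) * (\<Sum>y\<in>L. cnj (e t y) * e s y))"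
      unfolding sum_distrib_left by (subst sum.swap) (simp add: mult_ac)
    also have "\<dots> = (\<Sum>s\<in>S. if s = t then cnj (e s x) else 0)"
      using on[OF t] by (intro sum.cong refl) auto
    also have "\<dots> = cnj (e t x)" using S t by simp
    finally show ?thesis unfolding f by (simp add: right_diff_distrib sum_subtractf delta)
  qed
  have "(\<Sum>y\<in>L. cnj (f y) * f y) = (\<Sum>y\<in>L. f y * of_bool (y = x)) - (\<Sum>y\<in>L. (\<Sum>s\<in>S. e s x * cnj (e s y)) * f y)"
    by (subst (1) f) (simp add: left_diff_distrib sum_subtractf mult.commute complex_cnj_of_bool right_diff_distrib)
  also have "(\<Sum>y\<in>L. (\<Sum>s\<in>S. e s x * cnj (e s y)) * f y) = (\<Sum>s\<in>S. e s x * (\<Sum>y\<in>L. cnj (e s y) * f y))"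
    unfolding sum_distrib_left sum_distrib_right by (subst sum.swap) (simp add: mult_ac)
  also have "\<dots> = 0" using orth by simp
  finally show "(\<Sum>y\<in>L. cnj (f y) * f y) = complex_of_real (1 - (\<Sum>s\<in>S. (cmod (e s x))\<^sup>2))"
    using cnj_mult_self_sum[of "\<lambda>s. e s x" S] by (simp add: delta f)
qed

text \<open>The residual of the basis vector has nonnegative squared norm.\<close>

lemma Bessel_basis_vector:
  fixes e :: "'s \<Rightarrow> 'l state"
  assumes L: "finite L" and S: "finite S" and x: "x \<in> L"
    and on: "\<And>s t. s \<in> S \<Longrightarrow> t \<in> S \<Longrightarrow> (\<Sum>y\<in>L. cnj (e s y) * e t y) = of_bool (s = t)"
  shows "(\<Sum>s\<in>S. (cmod (e s x))\<^sup>2) \<le> 1"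
proof -
  define f where "f = (\<lambda>y. of_bool (y = x) - (\<Sum>s\<in>S. cnj (e s x) * e s y))"
  have "complex_of_real (\<Sum>y\<in>L. (cmod (f y))\<^sup>2) = complex_of_real (1 - (\<Sum>s\<in>S. (cmod (e s x))\<^sup>2))"
    using orthonormal_residual(2)[OF L S x on f_def] cnj_mult_self_sum[of f L] by simp
  hence "(\<Sum>y\<in>L. (cmod (f y))\<^sup>2) = 1 - (\<Sum>s\<in>S. (cmod (e s x))\<^sup>2)" by (simp only: of_real_eq_iff)
  moreover have "0 \<le> (\<Sum>y\<in>L. (cmod (f y))\<^sup>2)" by (intro sum_nonneg) simp
  ultimately show ?thesis by linarith
qed

text \<open>The trace of the projector onto the span, read once along the basis labels and once
  along the family.\<close>

lemma orthonormal_total_weight: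
  fixes e :: "'s \<Rightarrow> 'l state"
  assumes on: "\<And>s t. s \<in> S \<Longrightarrow> t \<in> S \<Longrightarrow> (\<Sum>y\<in>L. cnj (e s y) * e t y) = of_bool (s = t)"
  shows "(\<Sum>x\<in>L. \<Sum>s\<in>S. (cmod (e s x))\<^sup>2) = card S"
proof -
  have "(\<Sum>x\<in>L. (cmod (e s x))\<^sup>2) = 1" if "s \<in> S" for s
    using on[OF that that] cnj_mult_self_sum[of "e s" L] by (metis of_bool_eq(2) of_real_eq_1_iff)
  thus ?thesis by (subst sum.swap) simp
qed

text \<open>The projector onto the span of the family has trace \<open>card S < card L\<close>, so one of its diagonal
  entries is below 1 and the corresponding basis vector has a nonzero residual.\<close>

lemma orthonormal_extend_one:
  fixes e :: "'l \<Rightarrow> 'l state"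
  assumes L: "finite L" and S: "S \<subset> L"
    and on: "\<And>s t. s \<in> S \<Longrightarrow> t \<in> S \<Longrightarrow> (\<Sum>y\<in>L. cnj (e s y) * e t y) = of_bool (s = t)"
  shows "\<exists>g. (\<Sum>y\<in>L. cnj (g y) * g y) = 1 \<and> (\<forall>t\<in>S. (\<Sum>y\<in>L. cnj (e t y) * g y) = 0)"
proof -
  have fS: "finite S" using L S finite_subset by blast
  have "\<exists>x\<in>L. (\<Sum>s\<in>S. (cmod (e s x))\<^sup>2) < 1"
  proof (rule ccontr)
    assume "\<not> ?thesis"
    hence "(\<Sum>x\<in>L. 1) \<le> (\<Sum>x\<in>L. \<Sum>s\<in>S. (cmod (e s x))\<^sup>2)" by (intro sum_mono) (auto simp: not_less)
    hence "real (card L) \<le> real (card S)" using orthonormal_total_weight[OF on] by simp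
    thus False using psubset_card_mono[OF L S] by simp
  qed
  then obtain x where x: "x \<in> L" "(\<Sum>s\<in>S. (cmod (e s x))\<^sup>2) < 1" by blast
  define f where "f = (\<lambda>y. of_bool (y = x) - (\<Sum>s\<in>S. cnj (e s x) * e s y))"
  define N where "N = 1 - (\<Sum>s\<in>S. (cmod (e s x))\<^sup>2)"
  have N: "N > 0" using x by (simp add: N_def)
  have res: "t \<in> S \<Longrightarrow> (\<Sum>y\<in>L. cnj (e t y) * f y) = 0"
    "(\<Sum>y\<in>L. cnj (f y) * f y) = complex_of_real N" for t
    using orthonormal_residual[OF L fS x(1) _ f_def] on unfolding N_def by blast+
  define g where "g = (\<lambda>y. f y / complex_of_real (sqrt N))"
  have "(\<Sum>y\<in>L. cnj (g y) * g y) = (\<Sum>y\<in>L. cnj (f y) * f y) / complex_of_real (sqrt N * sqrt N)"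
    unfolding g_def by (simp add: sum_divide_distrib del: real_sqrt_mult_self)
  also have "\<dots> = complex_of_real N / complex_of_real N"
    using N res(2) by simp
  also have "\<dots> = 1" using N by simp
  finally have "(\<Sum>y\<in>L. cnj (g y) * g y) = 1" .
  moreover have "(\<Sum>y\<in>L. cnj (e t y) * g y) = 0" if "t \<in> S" for t
    using res(1)[OF that] unfolding g_def by (simp add: sum_divide_distrib[symmetric])
  ultimately show ?thesis by blast
qed

lemma orthonormal_extend:
  fixes e :: "'l \<Rightarrow> 'l state"
  assumes L: "finite L" and S: "S \<subseteq> L"
    and on: "\<And>s t. s \<in> S \<Longrightarrow> t \<in> S \<Longrightarrow> (\<Sum>y\<in>L. cnj (e s y) * e t y) = of_bool (s = t)"
  shows "\<exists>e'. (\<forall>s\<in>S. e' s = e s) \<and>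
           (\<forall>s\<in>L. \<forall>t\<in>L. (\<Sum>y\<in>L. cnj (e' s y) * e' t y) = of_bool (s = t))"
  using S on
proof (induction "card (L - S)" arbitrary: S e)
  case 0
  hence "S = L" using L by auto
  thus ?case using 0 by auto
next
  case (Suc m)
  hence SL: "S \<subset> L" by (metis Diff_eq_empty_iff card.empty nat.distinct(1) psubsetI)
  then obtain a where a: "a \<in> L" "a \<notin> S" by blast
  obtain g where g: "(\<Sum>y\<in>L. cnj (g y) * g y) = 1" "\<forall>t\<in>S. (\<Sum>y\<in>L. cnj (e t y) * g y) = 0"
    using orthonormal_extend_one[OF L SL Suc.prems(2)] by blast
  have g': "(\<Sum>y\<in>L. cnj (g y) * e t y) = 0" if "t \<in> S" for t
  proof -
    have "(\<Sum>y\<in>L. cnj (g y) * e t y) = cnj (\<Sum>y\<in>L. cnj (e t y) * g y)" by (simp add: mult.commute)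
    thus ?thesis using g(2) that by simp
  qed
  let ?e = "e(a := g)"
  have "m = card (L - insert a S)" using Suc.hyps(2) a L by (simp add: Diff_insert[of L a S] card_Diff_singleton)
  moreover have "insert a S \<subseteq> L" using a Suc.prems by auto
  moreover have "(\<Sum>y\<in>L. cnj (?e s y) * ?e t y) = of_bool (s = t)" if "s \<in> insert a S" "t \<in> insert a S" for s t
    using that g g' a(2) Suc.prems(2) by auto
  ultimately obtain e' where e': "\<forall>s\<in>insert a S. e' s = ?e s"
    "\<forall>s\<in>L. \<forall>t\<in>L. (\<Sum>y\<in>L. cnj (e' s y) * e' t y) = of_bool (s = t)"
    using Suc.hyps(1)[of "insert a S" ?e] by blast
  moreover have "\<forall>s\<in>S. e' s = e s" using e'(1) a(2) by auto
  ultimately show ?case by blast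
qed

text \<open>The extended family forms the columns of \<open>U\<close>. For the rows, every Bessel
  sum is at most 1 while their total is \<open>card L\<close>; hence all equal 1, every residual
  vanishes, and this is the completeness of the family.\<close>

lemma orthonormal_extend_unitary:
  fixes e :: "'l \<Rightarrow> 'l state"
  assumes L: "finite L" and S: "S \<subseteq> L"
    and on: "\<And>s t. s \<in> S \<Longrightarrow> t \<in> S \<Longrightarrow> (\<Sum>y\<in>L. cnj (e s y) * e t y) = of_bool (s = t)"
  shows "\<exists>U. unitary_op L U \<and> (\<forall>s\<in>S. \<forall>x\<in>L. U x s = e s x)"
proof -
  obtain e' where ee: "\<forall>s\<in>S. e' s = e s"
    and on': "\<And>s t. s \<in> L \<Longrightarrow> t \<in> L \<Longrightarrow> (\<Sum>y\<in>L. cnj (e' s y) * e' t y) = of_bool (s = t)"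
    using orthonormal_extend[OF L S on] by blast
  define U where "U = (\<lambda>x s. if x \<in> L \<and> s \<in> L then e' s x else 0)"
  have wt: "(\<Sum>s\<in>L. (cmod (e' s x))\<^sup>2) = 1" if x: "x \<in> L" for x
  proof (rule ccontr)
    assume "\<not> ?thesis"
    hence "(\<Sum>s\<in>L. (cmod (e' s x))\<^sup>2) < 1" using Bessel_basis_vector[OF L L x on'] by linarith
    hence "(\<Sum>x\<in>L. \<Sum>s\<in>L. (cmod (e' s x))\<^sup>2) < (\<Sum>x\<in>L. 1)"
      using x L Bessel_basis_vector[OF L L _ on'] by (intro sum_strict_mono_ex1) auto
    thus False using orthonormal_total_weight[OF on'] by simp
  qed
  have compl: "(\<Sum>s\<in>L. cnj (e' s x) * e' s y) = of_bool (y = x)" if x: "x \<in> L" and y: "y \<in> L" for x y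
  proof -
    define f where "f = (\<lambda>y. of_bool (y = x) - (\<Sum>s\<in>L. cnj (e' s x) * e' s y))"
    have "complex_of_real (\<Sum>y\<in>L. (cmod (f y))\<^sup>2) = 0"
      using orthonormal_residual(2)[OF L L x on' f_def] cnj_mult_self_sum[of f L] wt[OF x] by simp
    hence "(\<Sum>y\<in>L. (cmod (f y))\<^sup>2) = 0" by (simp only: of_real_eq_0_iff)
    hence "f y = 0" using y L by (simp add: sum_nonneg_eq_0_iff)
    thus ?thesis by (simp add: f_def)
  qed
  have "unitary_op L U"
    unfolding unitary_op_def
  proof (intro conjI)
    show "U \<in> opers L" by (simp add: U_def opers_def)
    show "op_mult L U (op_adjoint U) = op_id L"
    proof (intro ext)
      fix x y show "op_mult L U (op_adjoint U) x y = op_id L x y"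
        using compl[of y x]
        by (cases "x \<in> L"; cases "y \<in> L") (auto simp: op_mult_def op_adjoint_def op_id_def U_def mult.commute)
    qed
    show "op_mult L (op_adjoint U) U = op_id L"
    proof (intro ext)
      fix x y show "op_mult L (op_adjoint U) U x y = op_id L x y"
        using on'[of x y]
        by (cases "x \<in> L"; cases "y \<in> L") (auto simp: op_mult_def op_adjoint_def op_id_def U_def)
    qed
  qed
  moreover have "\<forall>s\<in>S. \<forall>x\<in>L. U x s = e s x" using ee S by (auto simp: U_def)
  ultimately show ?thesis by blast
qed

section \<open>Vectors on a register and character sums\<close>

text \<open>Extension by zero makes the pointwise operations on functions stay inside the set. The
  extensional functions in \<open>labels\<close> take the value \<open>undefined\<close> off the
  register and do not have this property; \<open>cut\<close> and \<open>restrict\<close> translate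
  between the two.\<close>

definition vecs :: "'s set \<Rightarrow> ('s \<Rightarrow> 'a::zero) set" where
  "vecs A = {a. \<forall>s. s \<notin> A \<longrightarrow> a s = 0}"

definition cut :: "'s set \<Rightarrow> ('s \<Rightarrow> 'a::zero) \<Rightarrow> 's \<Rightarrow> 'a" where
  "cut A x = (\<lambda>s. if s \<in> A then x s else 0)"

definition fdot :: "'s set \<Rightarrow> ('s \<Rightarrow> 'a::comm_ring_1) \<Rightarrow> ('s \<Rightarrow> 'a) \<Rightarrow> 'a" where
  "fdot A a b = (\<Sum>s\<in>A. a s * b s)"

definition linear_set :: "('s \<Rightarrow> 'a::comm_ring_1) set \<Rightarrow> bool" where
  "linear_set M \<longleftrightarrow> 0 \<in> M \<and> (\<forall>x\<in>M. \<forall>y\<in>M. x - y \<in> M) \<and> (\<forall>c. \<forall>x\<in>M. (\<lambda>s. c * x s) \<in> M)"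

definition perp :: "'s set \<Rightarrow> ('s \<Rightarrow> 'a::comm_ring_1) set \<Rightarrow> ('s \<Rightarrow> 'a) set" where
  "perp A M = {b \<in> vecs A. \<forall>t\<in>M. fdot A t b = 0}"

lemma linear_setD:
  assumes "linear_set M"
  shows "0 \<in> M" and "x \<in> M \<Longrightarrow> y \<in> M \<Longrightarrow> x - y \<in> M" and "x \<in> M \<Longrightarrow> (\<lambda>s. c * x s) \<in> M"
    and "x \<in> M \<Longrightarrow> - x \<in> M" and "x \<in> M \<Longrightarrow> y \<in> M \<Longrightarrow> x + y \<in> M"
proof -
  show 0: "0 \<in> M" and d: "x \<in> M \<Longrightarrow> y \<in> M \<Longrightarrow> x - y \<in> M" and "x \<in> M \<Longrightarrow> (\<lambda>s. c * x s) \<in> M" for x y c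
    using assms by (auto simp: linear_set_def)
  show n: "x \<in> M \<Longrightarrow> - x \<in> M" for x using d[OF 0, of x] by simp
  show "x \<in> M \<Longrightarrow> y \<in> M \<Longrightarrow> x + y \<in> M" using d[OF _ n, of x y] by simp
qed

lemma linear_set_diff_commute: "linear_set M \<Longrightarrow> x - y \<in> M \<longleftrightarrow> y - x \<in> M"
  using linear_setD(4)[of M "x - y"] linear_setD(4)[of M "y - x"] by auto

lemma linear_set_coset_iff:
  assumes "linear_set M" "x - y \<in> M"
  shows "x - z \<in> M \<longleftrightarrow> y - z \<in> M" and "z - x \<in> M \<longleftrightarrow> z - y \<in> M"
proof -
  have e: "x - z = (x - y) + (y - z)" "y - z = (x - z) - (x - y)" by auto
  show 1: "x - z \<in> M \<longleftrightarrow> y - z \<in> M" using assms linear_setD(2,5)[OF assms(1)] e by metis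
  show "z - x \<in> M \<longleftrightarrow> z - y \<in> M" using 1 linear_set_diff_commute[OF assms(1)] by metis
qed

lemma linear_set_vecs: "linear_set (vecs A)" by (auto simp: linear_set_def vecs_def)

lemma fdot_diff_right: "fdot A a (b - c) = fdot A a b - fdot A a c"
  by (simp add: fdot_def algebra_simps sum_subtractf)
lemma fdot_diff_left: "fdot A (b - c) a = fdot A b a - fdot A c a"
  by (simp add: fdot_def algebra_simps sum_subtractf)
lemma fdot_add_right: "fdot A a (b + c) = fdot A a b + fdot A a c"
  by (simp add: fdot_def algebra_simps sum.distrib)
lemma fdot_smult_right: "fdot A a (\<lambda>s. c * b s) = c * fdot A a b"
  by (simp add: fdot_def sum_distrib_left mult_ac)
lemma fdot_commute: "fdot A a b = fdot A b a" by (simp add: fdot_def mult.commute)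
lemma fdot_0 [simp]: "fdot A a 0 = 0" "fdot A 0 a = 0" by (simp_all add: fdot_def)

lemma linear_set_perp: "linear_set (perp A M)"
  using linear_set_vecs[of A]
  by (auto simp: perp_def fdot_diff_right fdot_smult_right linear_set_def)

lemma linear_set_Int: "linear_set M \<Longrightarrow> linear_set N \<Longrightarrow> linear_set (M \<inter> N)"
  by (auto simp: linear_set_def)

lemma fdot_mono_left:
  assumes "finite A" "S \<subseteq> A" "a \<in> vecs S"
  shows "fdot A a b = fdot S a b"
  unfolding fdot_def using assms by (intro sum.mono_neutral_right) (auto simp: vecs_def)

lemma cut_in_vecs [simp]: "cut A x \<in> vecs A" by (simp add: cut_def vecs_def)
lemma fdot_cut [simp]: "fdot A a (cut A x) = fdot A a x" by (simp add: fdot_def cut_def)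
lemma vecs_mono: "S \<subseteq> A \<Longrightarrow> vecs S \<subseteq> vecs A" by (auto simp: vecs_def)

lemma bij_betw_cut: "bij_betw (cut A) (labels A) (vecs A)"
  by (rule bij_betwI[where g = "\<lambda>a. restrict a A"])
    (auto simp: labels_def cut_def vecs_def PiE_def extensional_def fun_eq_iff)

lemma cut_restrict [simp]: "cut A (restrict v A) = cut A v"
  by (auto simp: cut_def)
lemma restrict_cut: "x \<in> labels A \<Longrightarrow> restrict (cut A x) A = x"
  by (auto simp: labels_def cut_def PiE_def extensional_def fun_eq_iff)
lemma restrict_in_labels [simp]: "restrict v A \<in> labels A" by (simp add: labels_def)

lemma finite_labels [simp]: "finite A \<Longrightarrow> finite (labels A :: ('s \<Rightarrow> 'a::finite) set)"
  unfolding labels_def by (intro finite_PiE) auto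
lemma card_labels: "finite A \<Longrightarrow> card (labels A :: ('s \<Rightarrow> 'a::finite) set) = CARD('a) ^ card A"
  unfolding labels_def by (simp add: card_PiE)
lemma finite_vecs [simp]: "finite A \<Longrightarrow> finite (vecs A :: ('s \<Rightarrow> 'a::{finite,zero}) set)"
  using bij_betw_finite[OF bij_betw_cut] finite_labels by blast
lemma card_vecs: "finite A \<Longrightarrow> card (vecs A :: ('s \<Rightarrow> 'a::{finite,zero}) set) = CARD('a) ^ card A"
  using bij_betw_same_card[OF bij_betw_cut] card_labels by metis

lemma sum_labels_eq_sum_vecs: "(\<Sum>x\<in>labels A. F (cut A x)) = (\<Sum>v\<in>vecs A. F v)"
  by (rule sum.reindex_bij_betw[OF bij_betw_cut])

section \<open>Orthogonality of additive characters and orthogonal complements\<close>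

lemma add_char_diff: "add_char (x - y) = add_char x * cnj (add_char (y::'a::{field,finite}))"
  using add_char_add[of x "- y"] by (simp add: add_char_uminus)
lemma add_char_cnj_mult [simp]: "add_char x * cnj (add_char x) = 1"
  by (simp add: complex_norm_square[symmetric])

text \<open>If \<open>b\<close> is not orthogonal to \<open>M\<close>, some translation of
  \<open>M\<close> into itself multiplies the sum by a value other than 1, so the sum is
  zero.\<close>

lemma char_sum:
  fixes b :: "'s \<Rightarrow> 'a::{field,finite}"
  assumes "linear_set M"
  shows "(\<Sum>t\<in>M. add_char (fdot A b t)) = of_nat (card M) * of_bool (\<forall>t\<in>M. fdot A b t = 0)"
proof (cases "\<forall>t\<in>M. fdot A b t = 0")
  case False
  then obtain t0 where t0: "t0 \<in> M" "fdot A b t0 \<noteq> 0" by auto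
  obtain v where v: "add_char (v * fdot A b t0) \<noteq> 1" using add_char_nontrivial[OF t0(2)] by auto
  \<comment> \<open>A nonzero inner product may still have character value 1; scaling within
    \<open>M\<close> cures this.\<close>
  define t1 where "t1 = (\<lambda>s. v * t0 s)"
  have t1: "t1 \<in> M" using t0 linear_setD(3)[OF assms] by (simp add: t1_def)
  have f1: "add_char (fdot A b t1) \<noteq> 1" using v by (simp add: t1_def fdot_smult_right)
  have "(\<Sum>t\<in>M. add_char (fdot A b t)) = (\<Sum>t\<in>M. add_char (fdot A b (t + t1)))"
    by (rule sum.reindex_bij_witness[of _ "\<lambda>t. t + t1" "\<lambda>t. t - t1"])
      (use t1 linear_setD[OF assms] in auto)
  also have "\<dots> = (\<Sum>t\<in>M. add_char (fdot A b t)) * add_char (fdot A b t1)"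
    by (simp add: fdot_add_right add_char_add sum_distrib_right)
  finally have "(\<Sum>t\<in>M. add_char (fdot A b t)) = 0" using f1 by (metis mult_cancel_left1 mult.commute)
  thus ?thesis using False by simp
qed simp

lemma fdot_vecs_eq_0_iff:
  fixes t :: "'s \<Rightarrow> 'a::comm_ring_1"
  assumes "finite A" "t \<in> vecs A"
  shows "(\<forall>b\<in>vecs A. fdot A t b = 0) \<longleftrightarrow> t = 0"
proof
  assume *: "\<forall>b\<in>vecs A. fdot A t b = 0"
  show "t = 0"
  proof
    fix s show "t s = 0 s"
    proof (cases "s \<in> A")
      case True
      have "fdot A t (\<lambda>r. of_bool (r = s)) = t s"
        using assms True by (simp add: fdot_def of_bool_def if_distrib[of "\<lambda>x. _ * x"] cong: if_cong)
      moreover have "(\<lambda>r. of_bool (r = s)) \<in> vecs A" using True by (auto simp: vecs_def)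
      ultimately have "t s = 0" using * by metis
      thus ?thesis by simp
    qed (use assms in \<open>simp add: vecs_def\<close>)
  qed
qed simp

lemma char_sum_vecs:
  fixes t :: "'s \<Rightarrow> 'a::{field,finite}"
  assumes "finite A" "t \<in> vecs A"
  shows "(\<Sum>b\<in>vecs A. add_char (fdot A b t)) = of_nat (CARD('a) ^ card A) * of_bool (t = 0)"
  using char_sum[OF linear_set_vecs, of A t A] fdot_vecs_eq_0_iff[OF assms] card_vecs[OF assms(1), where 'a='a]
  by (simp add: fdot_commute)

text \<open>Double count of the characters over \<open>vecs A\<close> and \<open>M\<close>: the
  inner sum over \<open>M\<close> leaves \<open>card M\<close> for each \<open>b\<close> in the
  complement, the inner sum over \<open>vecs A\<close> leaves only t = 0.\<close>

lemma card_perp: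
  fixes M :: "('s \<Rightarrow> 'a::{field,finite}) set"
  assumes "finite A" "linear_set M" "M \<subseteq> vecs A"
  shows "card M * card (perp A M) = CARD('a) ^ card A"
proof -
  have fM: "finite M" using assms finite_vecs finite_subset by blast
  have "(\<Sum>b\<in>vecs A. \<Sum>t\<in>M. add_char (fdot A b t)) = (\<Sum>b\<in>vecs A. if b \<in> perp A M then of_nat (card M) else 0)"
    by (intro sum.cong refl) (auto simp: char_sum[OF assms(2)] perp_def fdot_commute)
  also have "\<dots> = of_nat (card M * card (perp A M))"
    using assms(1) by (simp add: sum.If_cases perp_def Int_def mult.commute)
  finally have 1: "(\<Sum>b\<in>vecs A. \<Sum>t\<in>M. add_char (fdot A b t)) = of_nat (card M * card (perp A M))" .
  have "(\<Sum>b\<in>vecs A. \<Sum>t\<in>M. add_char (fdot A b t)) = (\<Sum>t\<in>M. \<Sum>b\<in>vecs A. add_char (fdot A b t))"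
    by (rule sum.swap)
  also have "\<dots> = (\<Sum>t\<in>M. of_nat (CARD('a) ^ card A) * of_bool (t = 0))"
    using assms by (intro sum.cong refl char_sum_vecs) auto
  also have "\<dots> = of_nat (CARD('a) ^ card A)"
    using fM linear_setD(1)[OF assms(2)] by (simp add: of_bool_def if_distrib[of "\<lambda>x. _ * x"] cong: if_cong)
  finally show ?thesis using 1 by (metis of_nat_eq_iff)
qed

text \<open>The guess lies in the erased region whenever some error there explains the syndrome.\<close>

lemma coset_representatives_near:
  assumes "linear_set P" "E \<subseteq> S"
  shows "\<exists>f. (\<forall>\<alpha>\<in>vecs S. f \<alpha> \<in> vecs S \<and> f \<alpha> - \<alpha> \<in> P) \<and>
             (\<forall>\<alpha>\<in>vecs S. \<forall>e\<in>vecs E. e - \<alpha> \<in> P \<longrightarrow> f \<alpha> \<in> vecs E)"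
proof -
  \<comment> \<open>The guess need not be constant on cosets of \<open>P\<close>. Later arguments
    only use that it lies in the coset of \<alpha>, and in \<open>vecs E\<close> when that coset
    meets \<open>vecs E\<close>.\<close>
  let ?f = "\<lambda>\<alpha>. if \<exists>e\<in>vecs E. e - \<alpha> \<in> P then SOME e. e \<in> vecs E \<and> e - \<alpha> \<in> P else \<alpha>"
  have "?f \<alpha> \<in> vecs S \<and> ?f \<alpha> - \<alpha> \<in> P \<and> (\<forall>e\<in>vecs E. e - \<alpha> \<in> P \<longrightarrow> ?f \<alpha> \<in> vecs E)" if "\<alpha> \<in> vecs S" for \<alpha>
  proof (cases "\<exists>e\<in>vecs E. e - \<alpha> \<in> P")
    case True
    hence "\<exists>e. e \<in> vecs E \<and> e - \<alpha> \<in> P" by blast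
    from someI_ex[OF this] show ?thesis using True vecs_mono[OF assms(2)] by auto
  next
    case False
    thus ?thesis using that linear_setD(1)[OF assms(1)] by auto
  qed
  thus ?thesis by (intro exI[of _ ?f]) blast
qed

section \<open>Recovery from erasures by stabilizer measurements\<close>

text \<open>A sandwich by Kraus operators acts on a mixture of rank-one terms term by term, which
  allows every Pauli error to be decoded on its own.\<close>

lemma sum_sandwich:
  fixes k k' :: "'v \<Rightarrow> complex"
  shows "(\<Sum>v\<in>V. \<Sum>w\<in>V. k v * (c * (\<Sum>i\<in>I. G i v * cnj (H i w))) * cnj (k' w))
       = c * (\<Sum>i\<in>I. (\<Sum>v\<in>V. k v * G i v) * cnj (\<Sum>w\<in>V. k' w * H i w))"
proof -
  define T where "T = (\<lambda>v w i. c * (k v * G i v) * cnj (k' w * H i w))"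
  have "(\<Sum>v\<in>V. \<Sum>w\<in>V. k v * (c * (\<Sum>i\<in>I. G i v * cnj (H i w))) * cnj (k' w)) = (\<Sum>v\<in>V. \<Sum>w\<in>V. \<Sum>i\<in>I. T v w i)"
    unfolding T_def by (simp add: sum_distrib_left sum_distrib_right mult_ac)
  also have "\<dots> = (\<Sum>(v,w,i)\<in>V \<times> V \<times> I. T v w i)" by (simp add: sum.cartesian_product)
  also have "\<dots> = (\<Sum>(i,v,w)\<in>I \<times> V \<times> V. T v w i)"
    by (rule sum.reindex_bij_witness[of _ "\<lambda>(i,v,w). (v,w,i)" "\<lambda>(v,w,i). (i,v,w)"]) auto
  also have "\<dots> = (\<Sum>i\<in>I. \<Sum>v\<in>V. \<Sum>w\<in>V. T v w i)" by (simp add: sum.cartesian_product)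
  also have "\<dots> = (\<Sum>i\<in>I. c * ((\<Sum>v\<in>V. k v * G i v) * cnj (\<Sum>w\<in>V. k' w * H i w)))"
    unfolding cnj_sum sum_product by (simp add: T_def sum_distrib_left mult_ac)
  finally show ?thesis by (simp add: sum_distrib_left)
qed

text \<open>Erasing the qudits in \<open>E\<close> amounts to applying a uniformly random Pauli operator on \<open>E\<close>.\<close>

lemma erasure_twirl:
  fixes \<psi> :: "('s \<Rightarrow> 'a::{field,finite}) state"
  assumes A: "finite A" and EA: "E \<subseteq> A" and x: "x \<in> labels A" and y: "y \<in> labels A"
  shows "erasure A E (proj_op \<psi>) x y = 1 / of_nat (CARD('a) ^ card E) ^ 2 *
    (\<Sum>(a, b)\<in>vecs E \<times> vecs E. (add_char (fdot A b (cut A x)) * \<psi> (restrict (cut A x - a) A)) *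
       cnj (add_char (fdot A b (cut A y)) * \<psi> (restrict (cut A y - a) A)))"
proof -
  let ?q = "of_nat (CARD('a) ^ card E) :: complex"
  have E: "finite E" using assms finite_subset by blast
  have q: "?q \<noteq> 0" by simp
  let ?d = "cut E x - cut E y"
  have dE: "?d \<in> vecs E" using linear_setD(2)[OF linear_set_vecs] cut_in_vecs by blast
  have b: "add_char (fdot A b (cut A x)) * cnj (add_char (fdot A b (cut A y))) = add_char (fdot E b ?d)"
    if "b \<in> vecs E" for b
    by (simp add: add_char_diff[symmetric] fdot_diff_right fdot_mono_left[OF A EA that])
  have d0: "?d = 0 \<longleftrightarrow> restrict x E = restrict y E"
  proof
    assume "?d = 0"
    hence "cut E x s = cut E y s" for s by (metis diff_eq_diff_eq diff_self eq_iff_diff_eq_0)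
    thus "restrict x E = restrict y E" unfolding cut_def restrict_def by (metis)
  qed (metis cut_restrict right_minus_eq)
  let ?F = "\<lambda>a. \<psi> (restrict (cut A x - a) A) * cnj (\<psi> (restrict (cut A y - a) A))"
  have "(\<Sum>(a, b)\<in>vecs E \<times> vecs E. (add_char (fdot A b (cut A x)) * \<psi> (restrict (cut A x - a) A)) *
       cnj (add_char (fdot A b (cut A y)) * \<psi> (restrict (cut A y - a) A)))
      = (\<Sum>a\<in>vecs E. \<Sum>b\<in>vecs E. ?F a * (add_char (fdot A b (cut A x)) * cnj (add_char (fdot A b (cut A y)))))"
    by (simp add: sum.cartesian_product case_prod_beta mult_ac)
  also have "\<dots> = (\<Sum>a\<in>vecs E. \<Sum>b\<in>vecs E. ?F a * add_char (fdot E b ?d))"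
    using b by (intro sum.cong refl) simp
  \<comment> \<open>The random phases kill every entry whose two labels differ on \<open>E\<close>,
    as the maximally mixed state there demands.\<close>
  also have "\<dots> = (\<Sum>a\<in>vecs E. ?F a) * (?q * of_bool (?d = 0))"
    by (simp only: sum_distrib_left[symmetric] sum_distrib_right[symmetric] char_sum_vecs[OF E dE])
  finally have twirl: "(\<Sum>(a, b)\<in>vecs E \<times> vecs E. (add_char (fdot A b (cut A x)) * \<psi> (restrict (cut A x - a) A)) *
       cnj (add_char (fdot A b (cut A y)) * \<psi> (restrict (cut A y - a) A))) = (\<Sum>a\<in>vecs E. ?F a) * (?q * of_bool (?d = 0))" .
  have EA': "E \<union> (A - E) = A" using EA by auto
  have er: "erasure A E (proj_op \<psi>) x y = of_bool (restrict x E = restrict y E) / ?q *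
      (\<Sum>e\<in>labels E. \<psi> (override_on (restrict x (A - E)) e E) * cnj (\<psi> (override_on (restrict y (A - E)) e E)))"
    using x y by (simp add: erasure_def op_tensor_def EA'[simplified] op_id_def partial_trace_def proj_op_def)
  show ?thesis
  proof (cases "restrict x E = restrict y E")
    case False
    thus ?thesis unfolding twirl er using d0 by simp
  next
    case True
    hence cxy: "cut E x = cut E y" using d0 by simp
    \<comment> \<open>Overwriting the erased sites with \<open>e\<close> is a shift by the
      difference to the old entries. As \<open>x\<close> and \<open>y\<close> agree on
      \<open>E\<close>, the same shift serves both, so the partial trace is the sum over
      shifts.\<close>
    have ov: "override_on (restrict z (A - E)) e E = restrict (cut A z - (cut E z - cut E e)) A"
      if "e \<in> labels E" for z e :: "'s \<Rightarrow> 'a" using EA that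
      by (auto simp: override_on_def cut_def restrict_def fun_eq_iff)
    have "(\<Sum>e\<in>labels E. \<psi> (override_on (restrict x (A - E)) e E) * cnj (\<psi> (override_on (restrict y (A - E)) e E)))
        = (\<Sum>e\<in>labels E. ?F (cut E x - cut E e))"
      using ov cxy by (intro sum.cong refl) simp
    also have "\<dots> = (\<Sum>v\<in>vecs E. ?F (cut E x - v))" by (rule sum_labels_eq_sum_vecs)
    also have "\<dots> = (\<Sum>a\<in>vecs E. ?F a)"
      by (rule sum.reindex_bij_witness[of _ "\<lambda>a. cut E x - a" "\<lambda>a. cut E x - a"])
        (use linear_setD(2)[OF linear_set_vecs cut_in_vecs] in auto)
    finally show ?thesis unfolding twirl er using True d0 q by (simp add: power2_eq_square)
  qed
qed

text \<open>Stabilizer elements reaching outside \<open>S\<close> cannot be measured by the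
  recovering party, so \<open>detect_X\<close> and \<open>detect_Z\<close> rely only on those
  supported on \<open>S\<close>. An error escaping them is harmless once it belongs to the
  stabilizer, since code states do not feel it.\<close>

locale css_recovery =
  fixes A S E :: "'s set" and TX TZ :: "('s \<Rightarrow> 'a::{field,finite}) set"
  assumes finite_A: "finite A" and SA: "S \<subseteq> A" and ES: "E \<subseteq> S"
    and linear_TX: "linear_set TX" and linear_TZ: "linear_set TZ"
    and TX_vecs: "TX \<subseteq> vecs A" and TZ_vecs: "TZ \<subseteq> vecs A"
    and orth: "\<And>t z. t \<in> TX \<Longrightarrow> z \<in> TZ \<Longrightarrow> fdot A z t = 0"
    and detect_X: "\<And>a. a \<in> vecs E \<Longrightarrow> (\<And>z. z \<in> TZ \<Longrightarrow> z \<in> vecs S \<Longrightarrow> fdot A z a = 0) \<Longrightarrow> a \<in> TX"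
    and detect_Z: "\<And>b. b \<in> vecs E \<Longrightarrow> (\<And>t. t \<in> TX \<Longrightarrow> t \<in> vecs S \<Longrightarrow> fdot A t b = 0) \<Longrightarrow> b \<in> TZ"
begin

text \<open>The letters refer to the elements that measure: \<open>PX\<close> holds the phase errors
  on \<open>S\<close> unseen by the shifts in \<open>MX\<close>, and \<open>PZ\<close> the shift
  errors unseen by the phases in \<open>MZ\<close>. Syndromes are cosets of \<open>PX\<close> and
  \<open>PZ\<close>.\<close>

definition "MX = TX \<inter> vecs S"
definition "MZ = TZ \<inter> vecs S"
definition "PX = perp S MX"
definition "PZ = perp S MZ"

lemma finite_S [simp]: "finite S" using finite_A SA finite_subset by blast
lemma finite_E [simp]: "finite E" using finite_S ES finite_subset by blast

lemma linear_MX: "linear_set MX"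
  using linear_TX linear_set_vecs by (auto simp: MX_def intro: linear_set_Int)
lemma linear_PX: "linear_set PX" and linear_PZ: "linear_set PZ"
  by (simp_all add: PX_def PZ_def linear_set_perp)
lemma PX_vecs: "PX \<subseteq> vecs S" and PZ_vecs: "PZ \<subseteq> vecs S" by (auto simp: PX_def PZ_def perp_def)
lemma MX_vecs: "MX \<subseteq> vecs S" by (auto simp: MX_def)

lemma fdot_S: "a \<in> vecs S \<Longrightarrow> fdot A a b = fdot S a b"
  by (rule fdot_mono_left[OF finite_A SA])

lemma MX_PZ: "MX \<subseteq> PZ"
  using orth by (auto simp: PZ_def perp_def MX_def MZ_def fdot_S[symmetric])

lemma card_MX_PX: "card MX * card PX = CARD('a) ^ card S"
  unfolding PX_def by (rule card_perp[OF finite_S linear_MX MX_vecs])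

lemma finite_MX [simp]: "finite MX" and finite_PZ [simp]: "finite PZ" and finite_PX [simp]: "finite PX"
  using MX_vecs PZ_vecs PX_vecs finite_vecs[OF finite_S] finite_subset by blast+

lemma card_MX_pos: "card MX > 0" and card_PZ_pos: "card PZ > 0" and card_PX_pos: "card PX > 0"
  using linear_setD(1) linear_MX linear_PZ linear_PX card_gt_0_iff finite_MX finite_PZ finite_PX by blast+

lemma E_PZ_TX: "a \<in> vecs E \<Longrightarrow> a \<in> PZ \<Longrightarrow> a \<in> TX"
  using detect_X by (auto simp: PZ_def perp_def MZ_def fdot_S)
lemma E_PX_TZ: "b \<in> vecs E \<Longrightarrow> b \<in> PX \<Longrightarrow> b \<in> TZ"
  using detect_Z by (auto simp: PX_def perp_def MX_def fdot_S)

text \<open>For a fixed input label there are \<open>card MX * card PZ\<close> pairs of a shift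
  index and an output label with nonzero entry, and q^(card S) phase indices; the square of the
  scale is the inverse of this number.\<close>

definition decoder_scale :: complex where
  "decoder_scale = complex_of_real (1 / sqrt (real (CARD('a) ^ card S * (card MX * card PZ))))"

lemma decoder_scale_sq: "cnj decoder_scale * decoder_scale * of_nat (CARD('a) ^ card S * (card MX * card PZ)) = 1"
proof -
  let ?N = "CARD('a) ^ card S * (card MX * card PZ)"
  have pos: "real ?N > 0" using card_MX_pos card_PZ_pos by simp
  have "cnj decoder_scale * decoder_scale = complex_of_real ((1 / sqrt (real ?N)) * (1 / sqrt (real ?N)))"
    unfolding decoder_scale_def by (simp only: complex_cnj_complex_of_real of_real_mult)
  also have "(1 / sqrt (real ?N)) * (1 / sqrt (real ?N)) = 1 / real ?N"
    using pos by (simp add: divide_simps flip: real_sqrt_mult)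
  finally have e: "cnj decoder_scale * decoder_scale = complex_of_real (1 / real ?N)" .
  show ?thesis unfolding e using pos
    by (metis less_irrefl nonzero_eq_divide_eq of_real_1 of_real_mult of_real_of_nat_eq)
qed

text \<open>The form needed for decoding: every Pauli error is accepted by
  \<open>card PZ * card PX\<close> index pairs, each with amplitude
  \<open>decoder_scale * card MX\<close> up to a phase.\<close>

lemma decoder_scale_normalised: "cnj decoder_scale * decoder_scale * (of_nat (card MX))\<^sup>2 * of_nat (card PZ * card PX) = 1"
proof -
  have "(of_nat (card MX))\<^sup>2 * of_nat (card PZ * card PX)
      = (of_nat (CARD('a) ^ card S * (card MX * card PZ)) :: complex)"
    unfolding card_MX_PX[symmetric] by (simp add: power2_eq_square mult_ac)
  thus ?thesis using decoder_scale_sq by (simp only: mult.assoc)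
qed

text \<open>Decoding with guesses \<open>f \<alpha>\<close>, \<open>g \<beta>\<close> for the shift and the phase error: undo them and project
  onto the code of the stabilizer elements supported on \<open>S\<close>.\<close>

definition decoder where
  "decoder f g = (\<lambda>(\<alpha>, \<beta>) v w. decoder_scale * of_bool (v \<in> PZ) * of_bool (v - w + f \<alpha> \<in> MX) * cnj (add_char (fdot S (g \<beta>) w)))"

text \<open>For fixed \<alpha> the outputs \<open>v\<close> form the coset of \<open>MX\<close>
  through \<open>w - f \<alpha>\<close>. As \<open>MX\<close> lies in \<open>PZ\<close>, this coset
  is inside \<open>PZ\<close> or disjoint from it, according to whether \<open>w - \<alpha>\<close>
  is in \<open>PZ\<close>; the latter happens for \<open>card PZ\<close> values of \<alpha>.\<close>

lemma count_decoders:
  assumes w: "w \<in> vecs S" and f: "\<And>\<alpha>. \<alpha> \<in> vecs S \<Longrightarrow> f \<alpha> \<in> vecs S \<and> f \<alpha> - \<alpha> \<in> PZ"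
  shows "(\<Sum>\<alpha>\<in>vecs S. \<Sum>v\<in>vecs S. of_bool (v \<in> PZ \<and> v - w + f \<alpha> \<in> MX)) = (of_nat (card MX * card PZ) :: complex)"
proof -
  have inner: "(\<Sum>v\<in>vecs S. of_bool (v \<in> PZ \<and> v - w + f \<alpha> \<in> MX)) = (of_nat (card MX) * of_bool (w - \<alpha> \<in> PZ) :: complex)"
    if \<alpha>: "\<alpha> \<in> vecs S" for \<alpha>
  proof -
    have iff: "w - f \<alpha> \<in> PZ \<longleftrightarrow> w - \<alpha> \<in> PZ"
      using linear_set_coset_iff(2)[OF linear_PZ, of "f \<alpha>" \<alpha> w] f[OF \<alpha>] by blast
    have set: "vecs S \<inter> {v. v \<in> PZ \<and> v - w + f \<alpha> \<in> MX} = (if w - \<alpha> \<in> PZ then (\<lambda>t. w - f \<alpha> + t) ` MX else {})"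
    proof (cases "w - \<alpha> \<in> PZ")
      case True
      have "v \<in> (\<lambda>t. w - f \<alpha> + t) ` MX" if "v - w + f \<alpha> \<in> MX" for v
        using that by (intro image_eqI[of _ _ "v - w + f \<alpha>"]) auto
      moreover have "w - f \<alpha> + t \<in> PZ" if "t \<in> MX" for t
        using that True iff MX_PZ linear_setD(5)[OF linear_PZ] by blast
      ultimately show ?thesis using True PZ_vecs by fastforce
    next
      case False
      have "False" if "v \<in> PZ" "v - w + f \<alpha> \<in> MX" for v
      proof -
        have "w - f \<alpha> = v - (v - w + f \<alpha>)" by simp
        thus False using False iff that MX_PZ linear_setD(2)[OF linear_PZ] by (metis subsetD)
      qed
      thus ?thesis using False by auto
    qed
    have "card ((\<lambda>t. w - f \<alpha> + t) ` MX) = card MX" by (intro card_image) (auto simp: inj_on_def)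
    thus ?thesis by (subst sum_of_bool_eq) (simp_all add: set)
  qed
  have "vecs S \<inter> {\<alpha>. w - \<alpha> \<in> PZ} = (\<lambda>p. w - p) ` PZ"
  proof safe
    fix \<alpha> assume "w - \<alpha> \<in> PZ" thus "\<alpha> \<in> (\<lambda>p. w - p) ` PZ" by (intro image_eqI[of _ _ "w - \<alpha>"]) auto
  next
    fix p assume "p \<in> PZ" thus "w - p \<in> vecs S" using w PZ_vecs linear_setD(2)[OF linear_set_vecs] by blast
  qed auto
  moreover have "card ((\<lambda>p. w - p) ` PZ) = card PZ" by (intro card_image) (auto simp: inj_on_def)
  ultimately have outer: "(\<Sum>\<alpha>\<in>vecs S. of_bool (w - \<alpha> \<in> PZ)) = (of_nat (card PZ) :: complex)"
    by (subst sum_of_bool_eq) simp_all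
  have "(\<Sum>\<alpha>\<in>vecs S. \<Sum>v\<in>vecs S. of_bool (v \<in> PZ \<and> v - w + f \<alpha> \<in> MX)) = (\<Sum>\<alpha>\<in>vecs S. of_nat (card MX) * of_bool (w - \<alpha> \<in> PZ) :: complex)"
    by (intro sum.cong refl inner)
  also have "\<dots> = of_nat (card MX * card PZ)" by (simp only: sum_distrib_left[symmetric] outer of_nat_mult)
  finally show ?thesis .
qed

text \<open>Both factors are nonzero only if \<open>w - w'\<close> lies in \<open>MX\<close>. On
  \<open>MX\<close> the guess \<open>g \<beta>\<close> has the same phases as \<beta>, because their
  difference is in \<open>PX\<close>. The sum over \<beta> is then a full character sum and forces
  \<open>w = w'\<close>.\<close>

lemma decoder_complete:
  assumes w: "w \<in> vecs S" and w': "w' \<in> vecs S"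
    and f: "\<And>\<alpha>. \<alpha> \<in> vecs S \<Longrightarrow> f \<alpha> \<in> vecs S \<and> f \<alpha> - \<alpha> \<in> PZ"
    and g: "\<And>\<beta>. \<beta> \<in> vecs S \<Longrightarrow> g \<beta> \<in> vecs S \<and> g \<beta> - \<beta> \<in> PX"
  shows "(\<Sum>j\<in>vecs S \<times> vecs S. \<Sum>v\<in>vecs S. cnj (decoder f g j v w) * decoder f g j v w') = of_bool (w = w')"
proof -
  let ?V = "vecs S" and ?m = "w - w'"
  have trm: "cnj (decoder f g (\<alpha>, \<beta>) v w) * decoder f g (\<alpha>, \<beta>) v w' =
      cnj decoder_scale * decoder_scale * of_bool (?m \<in> MX) * (of_bool (v \<in> PZ \<and> v - w + f \<alpha> \<in> MX) * add_char (fdot S \<beta> ?m))"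
    if "\<beta> \<in> ?V" for \<alpha> \<beta> v
  proof (cases "v - w + f \<alpha> \<in> MX \<and> v \<in> PZ")
    case True
    have "v - w' + f \<alpha> = (v - w + f \<alpha>) - (w' - w)" "?m = (v - w' + f \<alpha>) - (v - w + f \<alpha>)" by auto
    hence iff: "v - w' + f \<alpha> \<in> MX \<longleftrightarrow> ?m \<in> MX"
      using True linear_setD(2)[OF linear_MX] linear_set_diff_commute[OF linear_MX, of w w'] by metis
    show ?thesis
    proof (cases "?m \<in> MX")
      case m: True
      have "fdot S ?m (g \<beta> - \<beta>) = 0" using g[OF that] m by (auto simp: PX_def perp_def)
      hence "fdot S (g \<beta>) ?m = fdot S \<beta> ?m" by (simp add: fdot_diff_right fdot_commute)
      hence "add_char (fdot S (g \<beta>) w) * cnj (add_char (fdot S (g \<beta>) w')) = add_char (fdot S \<beta> ?m)"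
        by (simp add: add_char_diff[symmetric] fdot_diff_right)
      thus ?thesis using True iff m by (simp add: decoder_def)
    qed (use True iff in \<open>simp add: decoder_def\<close>)
  qed (auto simp: decoder_def)
  define G where "G = (\<lambda>j. \<Sum>v\<in>?V. cnj (decoder f g j v w) * decoder f g j v w')"
  have "(\<Sum>j\<in>?V \<times> ?V. G j) = (\<Sum>\<alpha>\<in>?V. \<Sum>\<beta>\<in>?V. G (\<alpha>, \<beta>))"
    by (simp add: sum.cartesian_product)
  hence "(\<Sum>j\<in>?V \<times> ?V. \<Sum>v\<in>?V. cnj (decoder f g j v w) * decoder f g j v w')
      = (\<Sum>\<alpha>\<in>?V. \<Sum>\<beta>\<in>?V. \<Sum>v\<in>?V. cnj (decoder f g (\<alpha>, \<beta>) v w) * decoder f g (\<alpha>, \<beta>) v w')"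
    by (simp only: G_def)
  also have "\<dots> = (\<Sum>\<alpha>\<in>?V. \<Sum>\<beta>\<in>?V. \<Sum>v\<in>?V. cnj decoder_scale * decoder_scale * of_bool (?m \<in> MX) *
      (of_bool (v \<in> PZ \<and> v - w + f \<alpha> \<in> MX) * add_char (fdot S \<beta> ?m)))"
    by (intro sum.cong refl trm)
  also have "\<dots> = cnj decoder_scale * decoder_scale * of_bool (?m \<in> MX) *
      ((\<Sum>\<alpha>\<in>?V. \<Sum>v\<in>?V. of_bool (v \<in> PZ \<and> v - w + f \<alpha> \<in> MX)) * (\<Sum>\<beta>\<in>?V. add_char (fdot S \<beta> ?m)))"
    by (simp only: sum_distrib_left[symmetric] sum_distrib_right[symmetric])
  also have "\<dots> = cnj decoder_scale * decoder_scale * of_bool (?m \<in> MX) *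
      (of_nat (card MX * card PZ) * (of_nat (CARD('a) ^ card S) * of_bool (?m = 0)))"
    using char_sum_vecs[OF finite_S linear_setD(2)[OF linear_set_vecs w w']] count_decoders[OF w f] by (simp only:)
  also have "\<dots> = (cnj decoder_scale * decoder_scale * of_nat (CARD('a) ^ card S * (card MX * card PZ))) * of_bool (?m = 0)"
    using linear_setD(1)[OF linear_MX] by (cases "?m = 0") auto
  also have "\<dots> = of_bool (w = w')" unfolding decoder_scale_sq by (simp only: right_minus_eq mult_1)
  finally show ?thesis .
qed

text \<open>Only index pairs with the syndromes of the error contribute. For these,
  \<open>f \<alpha> - a\<close> is an undetected shift on \<open>E\<close>, hence in
  \<open>TX\<close>, and leaves \<open>p\<close> invariant; \<open>g \<beta> - b\<close> is an
  undetected phase on \<open>E\<close>, hence in \<open>TZ\<close>, and is trivial on the support of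
  \<open>p\<close>. So \<open>p\<close> returns with a scalar that does not depend on
  \<open>v\<close>.\<close>

lemma decoder_on_error:
  fixes p :: "('s \<Rightarrow> 'a) \<Rightarrow> complex"
  assumes inv: "\<And>v t. v \<in> vecs A \<Longrightarrow> t \<in> TX \<Longrightarrow> p (v - t) = p v"
    and supp: "\<And>v z. v \<in> vecs A \<Longrightarrow> p v \<noteq> 0 \<Longrightarrow> z \<in> TZ \<Longrightarrow> fdot A z v = 0"
    and f: "\<And>\<alpha>. \<alpha> \<in> vecs S \<Longrightarrow> f \<alpha> \<in> vecs S \<and> f \<alpha> - \<alpha> \<in> PZ"
    and f_near: "\<And>\<alpha> e. \<alpha> \<in> vecs S \<Longrightarrow> e \<in> vecs E \<Longrightarrow> e - \<alpha> \<in> PZ \<Longrightarrow> f \<alpha> \<in> vecs E"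
    and g: "\<And>\<beta>. \<beta> \<in> vecs S \<Longrightarrow> g \<beta> \<in> vecs S \<and> g \<beta> - \<beta> \<in> PX"
    and g_near: "\<And>\<beta> e. \<beta> \<in> vecs S \<Longrightarrow> e \<in> vecs E \<Longrightarrow> e - \<beta> \<in> PX \<Longrightarrow> g \<beta> \<in> vecs E"
    and v: "v \<in> vecs A" and a: "a \<in> vecs E" and b: "b \<in> vecs E" and \<alpha>: "\<alpha> \<in> vecs S" and \<beta>: "\<beta> \<in> vecs S"
  shows "(\<Sum>v'\<in>vecs S. decoder f g (\<alpha>, \<beta>) (cut S v) v' * (add_char (fdot S b v') * p (v - cut S v + v' - a)))
       = of_bool (\<alpha> - a \<in> PZ \<and> \<beta> - b \<in> PX) * (decoder_scale * of_nat (card MX) * add_char (fdot S (b - g \<beta>) (f \<alpha>)) * p v)"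
    (is "?lhs = ?rhs")
proof -
  have aS: "a \<in> vecs S" and bS: "b \<in> vecs S" using a b vecs_mono[OF ES] by auto
  have SAv: "x \<in> vecs A" if "x \<in> vecs S" for x using that vecs_mono[OF SA] by auto
  have cut_PZ: "cut S v \<in> PZ" if "p v \<noteq> 0"
  proof -
    have "fdot S z (cut S v) = 0" if "z \<in> MZ" for z
      using supp[OF v \<open>p v \<noteq> 0\<close>, of z] that fdot_S[of z v] by (simp add: MZ_def)
    thus ?thesis by (simp add: PZ_def perp_def)
  qed
  show ?thesis
  proof (cases "cut S v \<in> PZ")
    case False
    hence "p v = 0" using cut_PZ by blast
    thus ?thesis using False by (simp add: decoder_def)
  next
    case cPZ: True
    \<comment> \<open>The place where \<open>p\<close> is evaluated once the guessed shift is
      undone, up to elements of \<open>MX\<close>.\<close>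
    let ?u = "v + f \<alpha> - a"
    have uA: "?u \<in> vecs A"
      using v SAv f[OF \<alpha>] aS linear_setD(2,5)[OF linear_set_vecs] by blast
    let ?D = "{v' \<in> vecs S. cut S v - v' + f \<alpha> \<in> MX}"
    have "?lhs = (\<Sum>v'\<in>?D. decoder f g (\<alpha>, \<beta>) (cut S v) v' * (add_char (fdot S b v') * p (v - cut S v + v' - a)))"
      by (intro sum.mono_neutral_right) (auto simp: decoder_def)
    also have "\<dots> = (\<Sum>t\<in>MX. decoder f g (\<alpha>, \<beta>) (cut S v) (cut S v + f \<alpha> - t) *
        (add_char (fdot S b (cut S v + f \<alpha> - t)) * p (v - cut S v + (cut S v + f \<alpha> - t) - a)))"
    proof (rule sum.reindex_bij_witness[of _ "\<lambda>t. cut S v + f \<alpha> - t" "\<lambda>v'. cut S v - v' + f \<alpha>"])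
      fix t assume t: "t \<in> MX"
      have e: "cut S v - (cut S v + f \<alpha> - t) + f \<alpha> = t" by simp
      thus "cut S v - (cut S v + f \<alpha> - t) + f \<alpha> = t" .
      have "cut S v + f \<alpha> - t \<in> vecs S"
        using f[OF \<alpha>] t MX_vecs linear_setD(2,5)[OF linear_set_vecs] cut_in_vecs by blast
      thus "cut S v + f \<alpha> - t \<in> ?D" using e t by simp
    next
      fix v' assume "v' \<in> ?D"
      show e: "cut S v + f \<alpha> - (cut S v - v' + f \<alpha>) = v'" by simp
      show "decoder f g (\<alpha>, \<beta>) (cut S v) (cut S v + f \<alpha> - (cut S v - v' + f \<alpha>)) *
          (add_char (fdot S b (cut S v + f \<alpha> - (cut S v - v' + f \<alpha>))) *
           p (v - cut S v + (cut S v + f \<alpha> - (cut S v - v' + f \<alpha>)) - a)) =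
          decoder f g (\<alpha>, \<beta>) (cut S v) v' * (add_char (fdot S b v') * p (v - cut S v + v' - a))"
        unfolding e ..
    qed auto
    \<comment> \<open>Invariance under \<open>TX\<close> takes \<open>p\<close> out of the sum; the
      remaining character sum over \<open>MX\<close> tests whether the phase syndromes
      agree.\<close>
    also have "\<dots> = (\<Sum>t\<in>MX. (decoder_scale * add_char (fdot S (b - g \<beta>) (cut S v + f \<alpha>)) * p ?u) * add_char (fdot S (g \<beta> - b) t))"
    proof (intro sum.cong refl)
      fix t assume t: "t \<in> MX"
      have e1: "cut S v - (cut S v + f \<alpha> - t) + f \<alpha> = t" by simp
      have "v - cut S v + (cut S v + f \<alpha> - t) - a = ?u - t" by simp
      moreover have "p (?u - t) = p ?u" using inv[OF uA] t by (simp add: MX_def)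
      ultimately have e2: "p (v - cut S v + (cut S v + f \<alpha> - t) - a) = p ?u" by metis
      have "fdot S b (cut S v + f \<alpha> - t) - fdot S (g \<beta>) (cut S v + f \<alpha> - t)
          = fdot S (b - g \<beta>) (cut S v + f \<alpha>) + fdot S (g \<beta> - b) t"
        by (simp add: fdot_diff_left fdot_diff_right fdot_add_right)
      hence e3: "cnj (add_char (fdot S (g \<beta>) (cut S v + f \<alpha> - t))) * add_char (fdot S b (cut S v + f \<alpha> - t))
          = add_char (fdot S (b - g \<beta>) (cut S v + f \<alpha>)) * add_char (fdot S (g \<beta> - b) t)"
        by (metis add_char_add add_char_diff mult.commute)
      have "decoder f g (\<alpha>, \<beta>) (cut S v) (cut S v + f \<alpha> - t) * (add_char (fdot S b (cut S v + f \<alpha> - t)) * p ?u)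
          = decoder_scale * (cnj (add_char (fdot S (g \<beta>) (cut S v + f \<alpha> - t))) * add_char (fdot S b (cut S v + f \<alpha> - t))) * p ?u"
        unfolding decoder_def using cPZ t by (simp only: e1 prod.case) simp
      thus "decoder f g (\<alpha>, \<beta>) (cut S v) (cut S v + f \<alpha> - t) *
        (add_char (fdot S b (cut S v + f \<alpha> - t)) * p (v - cut S v + (cut S v + f \<alpha> - t) - a)) =
        (decoder_scale * add_char (fdot S (b - g \<beta>) (cut S v + f \<alpha>)) * p ?u) * add_char (fdot S (g \<beta> - b) t)"
        unfolding e2 e3 by (simp only: mult_ac)
    qed
    also have "\<dots> = (decoder_scale * add_char (fdot S (b - g \<beta>) (cut S v + f \<alpha>)) * p ?u) * (of_nat (card MX) * of_bool (\<beta> - b \<in> PX))"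
    proof -
      have "g \<beta> - b \<in> vecs S" using g[OF \<beta>] bS linear_setD(2)[OF linear_set_vecs] by blast
      hence "(\<forall>t\<in>MX. fdot S (g \<beta> - b) t = 0) \<longleftrightarrow> g \<beta> - b \<in> PX" by (simp add: PX_def perp_def fdot_commute)
      also have "\<dots> \<longleftrightarrow> \<beta> - b \<in> PX" using linear_set_coset_iff(1)[OF linear_PX] g[OF \<beta>] by blast
      finally show ?thesis unfolding sum_distrib_left[symmetric] char_sum[OF linear_MX] by simp
    qed
    also have "\<dots> = ?rhs"
    proof (cases "\<beta> - b \<in> PX")
      case bP: True
      show ?thesis
      proof (cases "\<alpha> - a \<in> PZ")
        case aP: True
        have "f \<alpha> \<in> vecs E" using f_near[OF \<alpha> a] aP linear_set_diff_commute[OF linear_PZ] by blast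
        hence "f \<alpha> - a \<in> vecs E" using a linear_setD(2)[OF linear_set_vecs] by blast
        moreover have "f \<alpha> - a \<in> PZ" using linear_set_coset_iff(1)[OF linear_PZ] f[OF \<alpha>] aP by blast
        ultimately have "f \<alpha> - a \<in> TX" by (rule E_PZ_TX)
        hence "- (f \<alpha> - a) \<in> TX" using linear_setD(4)[OF linear_TX] by blast
        moreover have "v - (- (f \<alpha> - a)) = ?u" by simp
        ultimately have pu: "p ?u = p v" using inv[OF v] by metis
        have "g \<beta> \<in> vecs E" using g_near[OF \<beta> b] bP linear_set_diff_commute[OF linear_PX] by blast
        hence gE: "g \<beta> - b \<in> vecs E" using b linear_setD(2)[OF linear_set_vecs] by blast
        moreover have "g \<beta> - b \<in> PX" using linear_set_coset_iff(1)[OF linear_PX] g[OF \<beta>] bP by blast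
        ultimately have "g \<beta> - b \<in> TZ" by (rule E_PX_TZ)
        moreover have "g \<beta> - b \<in> vecs S" using gE vecs_mono[OF ES] by blast
        ultimately have "fdot S (g \<beta> - b) v = 0" if "p v \<noteq> 0"
          using supp[OF v that] fdot_S by metis
        hence "fdot S (b - g \<beta>) (cut S v) = 0" if "p v \<noteq> 0" using that by (simp add: fdot_diff_left)
        thus ?thesis unfolding pu using aP bP by (cases "p v = 0") (simp_all add: fdot_add_right)
      next
        case aP: False
        \<comment> \<open>The \<open>S\<close>-part of \<open>v\<close> passes all checks in
          \<open>MZ\<close>. If \<open>p\<close> were nonzero at the shifted place, the shift would
          pass them too and the syndromes would agree.\<close>
        have "p ?u = 0"
        proof (rule ccontr)
          assume nz: "p ?u \<noteq> 0"
          have "fdot S z (f \<alpha> - a) = 0" if z: "z \<in> MZ" for z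
          proof -
            have "fdot S z ?u = 0" using supp[OF uA nz] z fdot_S by (metis IntD1 IntD2 MZ_def)
            moreover have "fdot S z v = 0" using cPZ z by (auto simp: PZ_def perp_def)
            ultimately show ?thesis by (simp add: fdot_diff_right fdot_add_right)
          qed
          moreover have "f \<alpha> - a \<in> vecs S" using f[OF \<alpha>] aS linear_setD(2)[OF linear_set_vecs] by blast
          ultimately have "f \<alpha> - a \<in> PZ" by (simp add: PZ_def perp_def)
          thus False using aP linear_set_coset_iff(1)[OF linear_PZ] f[OF \<alpha>] by blast
        qed
        thus ?thesis using aP by simp
      qed
    qed simp
    finally show ?thesis .
  qed
qed

text \<open>By the twirl the erased state is a uniform mixture of Pauli errors on \<open>E\<close>.
  Each error is accepted by equally many index pairs, each returning the same multiple of the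
  original projector, so the weights add up to 1.\<close>

theorem recovery_channel_exists:
  "\<exists>\<Phi>. quantum_channel (labels S) \<Phi> \<and>
     (\<forall>\<psi>\<in>states (labels A).
        (\<forall>v\<in>vecs A. \<forall>t\<in>TX. \<psi> (restrict (v - t) A) = \<psi> (restrict v A)) \<longrightarrow>
        (\<forall>v\<in>vecs A. \<forall>z\<in>TZ. \<psi> (restrict v A) \<noteq> 0 \<longrightarrow> fdot A z v = 0) \<longrightarrow>
        on_subregister A S \<Phi> (erasure A E (proj_op \<psi>)) = proj_op \<psi>)"
proof -
  let ?V = "vecs S :: ('s \<Rightarrow> 'a) set"
  obtain f where f: "\<And>\<alpha>. \<alpha> \<in> ?V \<Longrightarrow> f \<alpha> \<in> ?V \<and> f \<alpha> - \<alpha> \<in> PZ"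
    and f_near: "\<And>\<alpha> e. \<alpha> \<in> ?V \<Longrightarrow> e \<in> vecs E \<Longrightarrow> e - \<alpha> \<in> PZ \<Longrightarrow> f \<alpha> \<in> vecs E"
    using coset_representatives_near[OF linear_PZ ES] by metis
  obtain g where g: "\<And>\<beta>. \<beta> \<in> ?V \<Longrightarrow> g \<beta> \<in> ?V \<and> g \<beta> - \<beta> \<in> PX"
    and g_near: "\<And>\<beta> e. \<beta> \<in> ?V \<Longrightarrow> e \<in> vecs E \<Longrightarrow> e - \<beta> \<in> PX \<Longrightarrow> g \<beta> \<in> vecs E"
    using coset_representatives_near[OF linear_PX ES] by metis
  define K where "K = (\<lambda>j x y. if x \<in> labels S \<and> y \<in> labels S then decoder f g j (cut S x) (cut S y) else 0)"
  let ?J = "?V \<times> ?V"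
  let ?\<Phi> = "\<lambda>\<rho> x y. \<Sum>j\<in>?J. \<Sum>x'\<in>labels S. \<Sum>y'\<in>labels S. K j x x' * \<rho> x' y' * cnj (K j y y')"
  have inj: "cut S y = cut S z \<longleftrightarrow> y = z" if "y \<in> labels S" "z \<in> labels S" for y z :: "'s \<Rightarrow> 'a"
    using that restrict_cut by metis
  have "quantum_channel (labels S) ?\<Phi>"
  proof (rule kraus_quantum_channel)
    show "K j \<in> opers (labels S)" for j by (simp add: K_def opers_def)
    show "finite (labels S :: ('s \<Rightarrow> 'a) set)" by simp
    fix y z :: "'s \<Rightarrow> 'a" assume yz: "y \<in> labels S" "z \<in> labels S"
    have "(\<Sum>j\<in>?J. \<Sum>x\<in>labels S. cnj (K j x y) * K j x z)
        = (\<Sum>j\<in>?J. \<Sum>x\<in>labels S. cnj (decoder f g j (cut S x) (cut S y)) * decoder f g j (cut S x) (cut S z))"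
      using yz by (intro sum.cong refl) (simp add: K_def)
    also have "\<dots> = (\<Sum>j\<in>?J. \<Sum>v\<in>?V. cnj (decoder f g j v (cut S y)) * decoder f g j v (cut S z))"
      by (intro sum.cong refl sum_labels_eq_sum_vecs)
    also have "\<dots> = of_bool (y = z)" using decoder_complete[OF cut_in_vecs cut_in_vecs f g] inj[OF yz] by simp
    finally show "(\<Sum>j\<in>?J. \<Sum>x\<in>labels S. cnj (K j x y) * K j x z) = of_bool (y = z)" .
  qed
  moreover have "on_subregister A S ?\<Phi> (erasure A E (proj_op \<psi>)) x y = proj_op \<psi> x y"
    if \<psi>: "\<psi> \<in> states (labels A)"
      and inv: "\<forall>v\<in>vecs A. \<forall>t\<in>TX. \<psi> (restrict (v - t) A) = \<psi> (restrict v A)"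
      and supp: "\<forall>v\<in>vecs A. \<forall>z\<in>TZ. \<psi> (restrict v A) \<noteq> 0 \<longrightarrow> fdot A z v = 0" for \<psi> x y
  proof (cases "x \<in> labels A \<and> y \<in> labels A")
    case False
    thus ?thesis using \<psi> by (auto simp: on_subregister_def proj_op_def states_def)
  next
    case True
    hence x: "x \<in> labels A" and y: "y \<in> labels A" by auto
    define p where "p = (\<lambda>v. \<psi> (restrict v A))"
    define c where "c = 1 / (of_nat (CARD('a) ^ card E) ^ 2 :: complex)"
    \<comment> \<open>The amplitude of the state hit by the error with shift \<open>a\<close> and
      phase \<open>b\<close>, as a function of the entries on \<open>S\<close> with the entries off
      \<open>S\<close> frozen at those of \<open>x\<close>.\<close>
    define G where "G = (\<lambda>x (a, b) v'. add_char (fdot S b v') * p (cut A x - cut S x + v' - a))"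
    define \<rho> where "\<rho> = erasure A E (proj_op \<psi>)"
    have ovl: "override_on z z' S \<in> labels A" if "z \<in> labels A" "z' \<in> labels S" for z z' :: "'s \<Rightarrow> 'a"
      using that SA by (auto simp: labels_def override_on_def PiE_def extensional_def)
    have ovc: "cut A (override_on z z' S) = cut A z - cut S z + cut S z'" for z z' :: "'s \<Rightarrow> 'a"
      using SA by (auto simp: override_on_def cut_def fun_eq_iff)
    have blk: "\<rho> (override_on x x' S) (override_on y y' S) = c * (\<Sum>i\<in>vecs E \<times> vecs E. G x i (cut S x') * cnj (G y i (cut S y')))"
      if "x' \<in> labels S" "y' \<in> labels S" for x' y'
    proof -
      have phase: "add_char (fdot A b (cut A x - cut S x + cut S x')) * cnj (add_char (fdot A b (cut A y - cut S y + cut S y')))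
          = add_char (fdot S b (cut S x')) * cnj (add_char (fdot S b (cut S y')))" if "b \<in> vecs E" for b
      proof -
        have bS: "b \<in> vecs S" using that vecs_mono[OF ES] by auto
        have "fdot A b (cut A z - cut S z + cut S z') = fdot S b (cut S z')" for z z' :: "'s \<Rightarrow> 'a"
          using fdot_S[OF bS] by (simp add: fdot_add_right fdot_diff_right) 
        thus ?thesis by metis
      qed
      have EA: "E \<subseteq> A" using ES SA by auto
      have "\<rho> (override_on x x' S) (override_on y y' S) = c *
         (\<Sum>(a, b)\<in>vecs E \<times> vecs E. (add_char (fdot A b (cut A (override_on x x' S))) * p (cut A (override_on x x' S) - a)) *
         cnj (add_char (fdot A b (cut A (override_on y y' S))) * p (cut A (override_on y y' S) - a)))"
        unfolding \<rho>_def c_def p_def by (rule erasure_twirl[OF finite_A EA ovl[OF x that(1)] ovl[OF y that(2)]])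
      also have "\<dots> = c * (\<Sum>(a, b)\<in>vecs E \<times> vecs E. (add_char (fdot A b (cut A x - cut S x + cut S x')) * cnj (add_char (fdot A b (cut A y - cut S y + cut S y')))) *
          (p (cut A x - cut S x + cut S x' - a) * cnj (p (cut A y - cut S y + cut S y' - a))))"
        unfolding ovc by (simp only: complex_cnj_mult mult_ac)
      also have "\<dots> = c * (\<Sum>i\<in>vecs E \<times> vecs E. G x i (cut S x') * cnj (G y i (cut S y')))"
        unfolding G_def using phase by (intro arg_cong[of _ _ "\<lambda>t. c * t"] sum.cong refl) (clarsimp simp: mult_ac)
      finally show ?thesis .
    qed
    have Gv: "(\<Sum>v\<in>?V. decoder f g (\<alpha>, \<beta>) (cut S z) v * G z (a, b) v)
        = of_bool (\<alpha> - a \<in> PZ \<and> \<beta> - b \<in> PX) * (decoder_scale * of_nat (card MX) * add_char (fdot S (b - g \<beta>) (f \<alpha>)) * p (cut A z))"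
      if "\<alpha> \<in> ?V" "\<beta> \<in> ?V" "a \<in> vecs E" "b \<in> vecs E" for \<alpha> \<beta> a b z
    proof -
      have cc: "cut S (cut A z) = cut S z" using SA by (auto simp: cut_def fun_eq_iff)
      show ?thesis unfolding G_def prod.case
        using decoder_on_error[of p f g "cut A z" a b \<alpha> \<beta>, unfolded cc] inv supp f f_near g g_near that
        unfolding p_def by simp
    qed
    have "on_subregister A S ?\<Phi> \<rho> x y
        = (\<Sum>j\<in>?J. \<Sum>x'\<in>labels S. \<Sum>y'\<in>labels S. decoder f g j (cut S x) (cut S x') *
            \<rho> (override_on x x' S) (override_on y y' S) * cnj (decoder f g j (cut S y) (cut S y')))"
      unfolding on_subregister_def using x y
      by (simp only: if_True simp_thms) (intro sum.cong refl, simp add: K_def)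
    also have "\<dots> = (\<Sum>j\<in>?J. \<Sum>x'\<in>labels S. \<Sum>y'\<in>labels S. decoder f g j (cut S x) (cut S x') *
            (c * (\<Sum>i\<in>vecs E \<times> vecs E. G x i (cut S x') * cnj (G y i (cut S y')))) * cnj (decoder f g j (cut S y) (cut S y')))"
      by (intro sum.cong refl) (simp only: blk)
    also have "\<dots> = (\<Sum>j\<in>?J. \<Sum>v\<in>?V. \<Sum>w\<in>?V. decoder f g j (cut S x) v *
            (c * (\<Sum>i\<in>vecs E \<times> vecs E. G x i v * cnj (G y i w))) * cnj (decoder f g j (cut S y) w))"
      by (simp only: sum_labels_eq_sum_vecs[where F = "\<lambda>w. decoder f g _ (cut S x) _ *
            (c * (\<Sum>i\<in>vecs E \<times> vecs E. G x i _ * cnj (G y i w))) * cnj (decoder f g _ (cut S y) w)"]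
          sum_labels_eq_sum_vecs[where F = "\<lambda>v. \<Sum>w\<in>?V. decoder f g _ (cut S x) v *
            (c * (\<Sum>i\<in>vecs E \<times> vecs E. G x i v * cnj (G y i w))) * cnj (decoder f g _ (cut S y) w)"])
    also have "\<dots> = (\<Sum>j\<in>?J. c * (\<Sum>i\<in>vecs E \<times> vecs E. (\<Sum>v\<in>?V. decoder f g j (cut S x) v * G x i v) *
            cnj (\<Sum>w\<in>?V. decoder f g j (cut S y) w * G y i w)))"
      by (simp only: sum_sandwich)
    also have "\<dots> = (\<Sum>(\<alpha>, \<beta>)\<in>?J. c * (\<Sum>(a, b)\<in>vecs E \<times> vecs E.
          of_bool (\<alpha> - a \<in> PZ \<and> \<beta> - b \<in> PX) * (cnj decoder_scale * decoder_scale * (of_nat (card MX))\<^sup>2 * proj_op \<psi> x y)))"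
    proof (intro sum.cong refl, clarify, intro arg_cong[of _ _ "\<lambda>t. c * t"] sum.cong refl, clarify)
      fix \<alpha> \<beta> a b :: "'s \<Rightarrow> 'a" assume that: "\<alpha> \<in> ?V" "\<beta> \<in> ?V" "a \<in> vecs E" "b \<in> vecs E"
      have pz: "p (cut A z) = \<psi> z" if "z \<in> labels A" for z using that by (simp add: p_def restrict_cut)
      let ?\<chi> = "add_char (fdot S (b - g \<beta>) (f \<alpha>))"
      \<comment> \<open>The scalar left by the decoder carries the same phase in row and column, so
        the phase cancels in the projector.\<close>
      have e: "(decoder_scale * N * ?\<chi> * s) * cnj (decoder_scale * N * ?\<chi> * t) = cnj decoder_scale * decoder_scale * (N * cnj N) * (s * cnj t)" for N s t
      proof -
        have "(decoder_scale * N * ?\<chi> * s) * cnj (decoder_scale * N * ?\<chi> * t) = cnj decoder_scale * decoder_scale * (N * cnj N) * (s * cnj t) * (?\<chi> * cnj ?\<chi>)"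
          by (simp only: complex_cnj_mult mult_ac)
        thus ?thesis by simp
      qed
      show "(\<Sum>v\<in>?V. decoder f g (\<alpha>, \<beta>) (cut S x) v * G x (a, b) v) * cnj (\<Sum>w\<in>?V. decoder f g (\<alpha>, \<beta>) (cut S y) w * G y (a, b) w)
          = of_bool (\<alpha> - a \<in> PZ \<and> \<beta> - b \<in> PX) * (cnj decoder_scale * decoder_scale * (of_nat (card MX))\<^sup>2 * proj_op \<psi> x y)"
        unfolding Gv[OF that] pz[OF x] pz[OF y]
        using e[of "of_nat (card MX)" "\<psi> x" "\<psi> y"]
        by (auto simp: proj_op_def power2_eq_square simp del: complex_cnj_mult)
    qed
    also have "\<dots> = (\<Sum>(a, b)\<in>vecs E \<times> vecs E. \<Sum>(\<alpha>, \<beta>)\<in>?J. of_bool (\<alpha> - a \<in> PZ \<and> \<beta> - b \<in> PX) *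
          (c * (cnj decoder_scale * decoder_scale * (of_nat (card MX))\<^sup>2 * proj_op \<psi> x y)))"
      by (simp only: case_prod_unfold sum_distrib_left) (subst sum.swap, simp only: mult_ac)
    also have "\<dots> = (\<Sum>(a, b)\<in>(vecs E :: ('s \<Rightarrow> 'a) set) \<times> (vecs E :: ('s \<Rightarrow> 'a) set). of_nat (card PZ * card PX) *
          (c * (cnj decoder_scale * decoder_scale * (of_nat (card MX))\<^sup>2 * proj_op \<psi> x y)))"
    proof (intro sum.cong refl, clarify)
      fix a b :: "'s \<Rightarrow> 'a" assume ab: "a \<in> vecs E" "b \<in> vecs E"
      hence abS: "a \<in> ?V" "b \<in> ?V" using vecs_mono[OF ES] by auto
      \<comment> \<open>The index pairs accepting the error form the translate of
        \<open>PZ \<times> PX\<close> by \<open>(a, b)\<close>.\<close>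
      have "?J \<inter> {(\<alpha>, \<beta>). \<alpha> - a \<in> PZ \<and> \<beta> - b \<in> PX} = (\<lambda>(s, t). (s + a, t + b)) ` (PZ \<times> PX)"
      proof safe
        fix \<alpha> \<beta> assume "\<alpha> - a \<in> PZ" "\<beta> - b \<in> PX"
        thus "(\<alpha>, \<beta>) \<in> (\<lambda>(s, t). (s + a, t + b)) ` (PZ \<times> PX)"
          by (intro image_eqI[of _ _ "(\<alpha> - a, \<beta> - b)"]) auto
      next
        fix s t assume "s \<in> PZ" "t \<in> PX"
        thus "s + a \<in> ?V" "t + b \<in> ?V" using abS PZ_vecs PX_vecs linear_setD(5)[OF linear_set_vecs] by blast+
      qed auto
      moreover have "card ((\<lambda>(s, t). (s + a, t + b)) ` (PZ \<times> PX)) = card PZ * card PX"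
        by (subst card_image) (auto simp: inj_on_def card_cartesian_product)
      ultimately have "(\<Sum>j\<in>?J. of_bool (fst j - a \<in> PZ \<and> snd j - b \<in> PX)) = (of_nat (card PZ * card PX) :: complex)"
        by (subst sum_of_bool_eq) (auto simp: case_prod_unfold)
      thus "(\<Sum>(\<alpha>, \<beta>)\<in>?J. of_bool (\<alpha> - a \<in> PZ \<and> \<beta> - b \<in> PX) *
          (c * (cnj decoder_scale * decoder_scale * (of_nat (card MX))\<^sup>2 * proj_op \<psi> x y))) = of_nat (card PZ * card PX) *
          (c * (cnj decoder_scale * decoder_scale * (of_nat (card MX))\<^sup>2 * proj_op \<psi> x y))"
        by (simp only: case_prod_unfold sum_distrib_right[symmetric])
    qed
    also have "\<dots> = (of_nat (CARD('a) ^ card E) ^ 2 * c) *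
        (cnj decoder_scale * decoder_scale * (of_nat (card MX))\<^sup>2 * of_nat (card PZ * card PX)) * proj_op \<psi> x y"
      by (simp add: card_cartesian_product card_vecs power2_eq_square mult_ac case_prod_unfold)
    also have "\<dots> = proj_op \<psi> x y" unfolding decoder_scale_normalised c_def by simp
    finally show ?thesis unfolding \<rho>_def .
  qed
  ultimately show ?thesis by blast
qed
end

section \<open>Counting linear algebra over a finite field\<close>

text \<open>Coordinates in a basis identify the space with the functions from the basis to the
  field. A finite carrier spans itself, which gives finite dimension.\<close>

lemma (in vectorspace) card_carrier_eq_power_dim:
  assumes "finite (carrier V)"
  shows "card (carrier V) = card (carrier K) ^ dim"
proof -
  have "gen_set (carrier V)"
    using in_own_span[of "carrier V"] span_is_subset2[of "carrier V"] by auto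
  hence "fin_dim" using assms unfolding fin_dim_def by blast
  then obtain A where A: "finite A" "basis A" using finite_basis_exists by blast
  have AV: "A \<subseteq> carrier V" using A(2) by (simp add: basis_def)
  note crit = basis_criterion[OF A(1) AV, THEN iffD1, OF A(2), rule_format]
  have "bij_betw (\<lambda>a. lincomb a A) (A \<rightarrow>\<^sub>E carrier K) (carrier V)"
    unfolding bij_betw_def
  proof
    have cl: "lincomb a A \<in> carrier V" if "a \<in> A \<rightarrow>\<^sub>E carrier K" for a
      using that AV by (intro lincomb_closed) auto
    show "inj_on (\<lambda>a. lincomb a A) (A \<rightarrow>\<^sub>E carrier K)"
      using crit[OF cl] by (intro inj_onI) blast
    show "(\<lambda>a. lincomb a A) ` (A \<rightarrow>\<^sub>E carrier K) = carrier V"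
      using crit cl by blast
  qed
  hence "card (carrier V) = card (A \<rightarrow>\<^sub>E carrier K)" using bij_betw_same_card by fastforce
  also have "\<dots> = card (carrier K) ^ card A" using A(1) by (simp add: card_PiE)
  finally show ?thesis using dim_basis[OF A] by simp
qed

section \<open>Cardinalities of words, subspaces, images and kernels\<close>

lemma bij_betw_vec: "bij_betw (vec n) ({..<n} \<rightarrow>\<^sub>E UNIV) (carrier_vec n :: 'a vec set)"
  by (rule bij_betwI[where g = "\<lambda>v. restrict (($) v) {..<n}"])
    (auto simp: fun_eq_iff PiE_def extensional_def)

lemma finite_carrier_vec [simp]: "finite (carrier_vec n :: 'a::finite vec set)"
  using bij_betw_finite[OF bij_betw_vec[where 'a='a and n=n]] by (simp add: finite_PiE)

lemma card_carrier_vec: "card (carrier_vec n :: 'a::finite vec set) = CARD('a) ^ n"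
  using bij_betw_same_card[OF bij_betw_vec[where 'a='a and n=n]] by (simp add: card_PiE)

lemma card_eq_power_code_dim:
  fixes W :: "'a::{field,finite} vec set"
  assumes "VectorSpace.subspace class_ring W (module_vec TYPE('a) n)"
  shows "card W = CARD('a) ^ code_dim n W"
proof -
  interpret vec_space "TYPE('a)" n .
  have sub: "W \<subseteq> carrier_vec n"
    using assms unfolding VectorSpace.subspace_def submodule_def by (auto simp: module_vec_simps)
  interpret W: vectorspace "class_ring :: 'a ring" "V\<lparr>carrier := W\<rparr>"
    using assms by (rule subspace_is_vs)
  have "finite W" using sub finite_carrier_vec finite_subset by blast
  thus ?thesis using W.card_carrier_eq_power_dim by (simp add: code_dim_def class_ring_simps)
qed

lemma subspaceI:
  fixes W :: "'a::field vec set"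
  assumes "W \<subseteq> carrier_vec n" "0\<^sub>v n \<in> W" "\<And>x y. x \<in> W \<Longrightarrow> y \<in> W \<Longrightarrow> x + y \<in> W"
    "\<And>a x. x \<in> W \<Longrightarrow> a \<cdot>\<^sub>v x \<in> W"
  shows "VectorSpace.subspace class_ring W (module_vec TYPE('a) n)"
  unfolding VectorSpace.subspace_def submodule_def
  using assms vec_vs[where 'a='a and n=n] vec_module[where 'a='a and n=n]
  by (auto simp: module_vec_simps class_ring_simps)

lemma subspaceD:
  fixes W :: "'a::field vec set"
  assumes "VectorSpace.subspace class_ring W (module_vec TYPE('a) n)"
  shows "W \<subseteq> carrier_vec n" and "0\<^sub>v n \<in> W" and "x \<in> W \<Longrightarrow> y \<in> W \<Longrightarrow> x + y \<in> W"
    and "x \<in> W \<Longrightarrow> a \<cdot>\<^sub>v x \<in> W"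
  using assms unfolding VectorSpace.subspace_def submodule_def
  by (auto simp: module_vec_simps class_ring_simps)

text \<open>Rank-nullity in counting form: every nonempty fibre is a translate of the
  kernel.\<close>

lemma card_image_mult_card_kernel:
  fixes M :: "'a::{field,finite} mat"
  assumes M: "M \<in> carrier_mat nr nc"
  shows "card ((*\<^sub>v) M ` carrier_vec nc) * card (mat_kernel M) = CARD('a) ^ nc"
proof -
  have fibre: "card {x \<in> carrier_vec nc. M *\<^sub>v x = M *\<^sub>v y} = card (mat_kernel M)" if y: "y \<in> carrier_vec nc" for y
  proof (rule bij_betw_same_card[of "\<lambda>x. x - y"], rule bij_betwI[where g = "\<lambda>x. x + y"])
    show "(\<lambda>x. x - y) \<in> {x \<in> carrier_vec nc. M *\<^sub>v x = M *\<^sub>v y} \<rightarrow> mat_kernel M"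
      using M y by (auto simp: mat_kernel[OF M] mult_minus_distrib_mat_vec)
    show "(\<lambda>x. x + y) \<in> mat_kernel M \<rightarrow> {x \<in> carrier_vec nc. M *\<^sub>v x = M *\<^sub>v y}"
      using M y by (auto simp: mat_kernel[OF M] mult_add_distrib_mat_vec)
  qed (use y in \<open>auto simp: mat_kernel[OF M]\<close>)
  have "CARD('a) ^ nc = (\<Sum>x\<in>(carrier_vec nc :: 'a vec set). 1)" by (simp add: card_carrier_vec)
  also have "\<dots> = (\<Sum>y\<in>(*\<^sub>v) M ` carrier_vec nc. \<Sum>x | x \<in> carrier_vec nc \<and> M *\<^sub>v x = y. 1)"
    by (rule sum.image_gen) simp
  also have "\<dots> = (\<Sum>y\<in>(*\<^sub>v) M ` carrier_vec nc. card (mat_kernel M))"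
    using fibre by (intro sum.cong refl) auto
  finally show ?thesis by simp
qed

text \<open>A vector killed by the transpose is orthogonal to the image of \<open>M\<close>, here
  the whole space.\<close>

lemma transpose_inj_of_surj:
  fixes M :: "'a::field mat"
  assumes M: "M \<in> carrier_mat nr nc" and surj: "(*\<^sub>v) M ` carrier_vec nc = carrier_vec nr"
    and u: "u \<in> carrier_vec nr" and z: "transpose_mat M *\<^sub>v u = 0\<^sub>v nc"
  shows "u = 0\<^sub>v nr"
proof -
  have "u \<bullet> y = 0" if y: "y \<in> carrier_vec nr" for y
  proof -
    obtain x where x: "x \<in> carrier_vec nc" "y = M *\<^sub>v x"
      using y unfolding surj[symmetric] by auto
    have "u \<bullet> y = (transpose_mat M *\<^sub>v u) \<bullet> x"
      unfolding x(2) by (rule transpose_vec_mult_scalar[OF M x(1) u, symmetric])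
    also have "\<dots> = 0" unfolding z using x(1) by simp
    finally show ?thesis .
  qed
  hence "u \<bullet> unit_vec nr j = 0" if "j < nr" for j by simp
  hence "u $ j = 0" if "j < nr" for j using scalar_prod_right_unit[OF that, of u] that by metis
  thus ?thesis using u by (intro eq_vecI) auto
qed

lemma mult_mat_vec_inj:
  fixes M :: "'a::field mat"
  assumes M: "M \<in> carrier_mat nr nc" and ker: "\<And>u. u \<in> carrier_vec nc \<Longrightarrow> M *\<^sub>v u = 0\<^sub>v nr \<Longrightarrow> u = 0\<^sub>v nc"
  shows "inj_on ((*\<^sub>v) M) (carrier_vec nc)"
proof (rule inj_onI)
  fix x y assume xy: "x \<in> carrier_vec nc" "y \<in> carrier_vec nc" "M *\<^sub>v x = M *\<^sub>v y"
  have "M *\<^sub>v (x - y) = M *\<^sub>v y - M *\<^sub>v y"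
    using mult_minus_distrib_mat_vec[OF M xy(1,2)] unfolding xy(3) .
  also have "\<dots> = 0\<^sub>v nr" using M by (intro eq_vecI) auto
  finally have d: "x - y = 0\<^sub>v nc" using ker[of "x - y"] xy(1,2) by simp
  show "x = y"
  proof (rule eq_vecI)
    fix j assume "j < dim_vec y"
    hence "(x - y) $ j = 0" using d xy(2) by simp
    thus "x $ j = y $ j" using \<open>j < dim_vec y\<close> by simp
  qed (use xy(1,2) in auto)
qed

lemma card_image_eq_power_rank:
  fixes M :: "'a::{field,finite} mat"
  assumes M: "M \<in> carrier_mat nr nc"
  shows "card ((*\<^sub>v) M ` carrier_vec nc) = CARD('a) ^ vec_space.rank nr M"
proof -
  interpret vec_space "TYPE('a)" nr .
  have "set (cols M) \<subseteq> carrier_vec nr" using M cols_dim by blast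
  hence "VectorSpace.subspace class_ring (span (set (cols M))) V" by (intro span_is_subspace) simp
  from card_eq_power_code_dim[OF this] have "card (col_space M) = CARD('a) ^ rank M"
    by (simp add: rank_def col_space_def code_dim_def)
  moreover have "col_space M = (*\<^sub>v) M ` carrier_vec nc"
    unfolding col_space_eq[OF M] using M by auto
  ultimately show ?thesis by simp
qed

text \<open>The product factors through words of length \<open>c\<close> and still has q^c values,
  so nothing may be missed by the first map nor identified by the second.\<close>

lemma rank_factor_full_rank:
  fixes F G :: "'a::{field,finite} mat"
  assumes F: "F \<in> carrier_mat m c" and G: "G \<in> carrier_mat m' c"
    and card: "card ((*\<^sub>v) (F * transpose_mat G) ` carrier_vec m') = CARD('a) ^ c"
  shows "inj_on ((*\<^sub>v) F) (carrier_vec c)" and "(*\<^sub>v) (transpose_mat G) ` carrier_vec m' = carrier_vec c"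
proof -
  let ?I = "(*\<^sub>v) (transpose_mat G) ` carrier_vec m'"
  have Gt: "transpose_mat G \<in> carrier_mat c m'" using G by simp
  have sub: "?I \<subseteq> carrier_vec c" using Gt by auto
  have "(*\<^sub>v) (F * transpose_mat G) ` carrier_vec m' = (*\<^sub>v) F ` ?I"
    using assoc_mult_mat_vec[OF F Gt] by (auto simp: image_image)
  hence eq: "card ((*\<^sub>v) F ` ?I) = CARD('a) ^ c" using card by simp
  have "card ((*\<^sub>v) F ` ?I) \<le> card ?I" by (intro card_image_le) simp
  hence "card (carrier_vec c :: 'a vec set) \<le> card ?I" using eq by (simp add: card_carrier_vec)
  thus I: "?I = carrier_vec c" by (intro card_seteq sub) simp_all
  show "inj_on ((*\<^sub>v) F) (carrier_vec c)"
    using eq unfolding I by (intro eq_card_imp_inj_on) (simp_all add: card_carrier_vec)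
qed

section \<open>The encoding isometry\<close>

definition css_space :: "'s set \<Rightarrow> ('s \<Rightarrow> 'a::{field,finite}) set \<Rightarrow> ('s \<Rightarrow> 'a) set \<Rightarrow> ('s \<Rightarrow> 'a) state set" where
  "css_space A TX TZ = {\<psi> \<in> states (labels A).
     (\<forall>v\<in>vecs A. \<forall>t\<in>TX. \<psi> (restrict (v - t) A) = \<psi> (restrict v A)) \<and>
     (\<forall>v\<in>vecs A. \<forall>z\<in>TZ. \<psi> (restrict v A) \<noteq> 0 \<longrightarrow> fdot A z v = 0)}"

text \<open>The cardinality hypothesis says that \<open>T\<close> has \<open>card L\<close> cosets
  in \<open>W\<close>. Hence \<open>L\<close> can be matched with the cosets, and \<open>g\<close>
  picks an element of each.\<close>

lemma coset_transversal:
  fixes T W :: "('s \<Rightarrow> 'a::comm_ring_1) set"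
  assumes T: "linear_set T" and W: "linear_set W" and TW: "T \<subseteq> W" and fW: "finite W"
    and L: "finite L" and card: "card W = card L * card T"
  shows "\<exists>g. (\<forall>y\<in>L. g y \<in> W) \<and> (\<forall>x\<in>W. \<exists>!y. y \<in> L \<and> x - g y \<in> T)"
proof -
  define cl where "cl = (\<lambda>x. {y \<in> W. x - y \<in> T})"
  have fT: "finite T" using TW fW finite_subset by blast
  have cT: "card T > 0" using fT linear_setD(1)[OF T] card_gt_0_iff by blast
  have self: "x \<in> cl x" if "x \<in> W" for x using that linear_setD(1)[OF T] by (simp add: cl_def)
  have card_cl: "card (cl x) = card T" if x: "x \<in> W" for x
  proof -
    have "cl x = (\<lambda>t. x - t) ` T"
    proof safe
      fix y assume "y \<in> cl x" thus "y \<in> (\<lambda>t. x - t) ` T"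
        by (intro image_eqI[of _ _ "x - y"]) (auto simp: cl_def)
    next
      fix t assume "t \<in> T" thus "x - t \<in> cl x" using x TW linear_setD(2)[OF W] by (auto simp: cl_def)
    qed
    thus ?thesis by (simp add: card_image inj_on_def)
  qed
  have same: "cl x = cl y" if "x - y \<in> T" for x y
    using linear_set_coset_iff(1)[OF T that] by (auto simp: cl_def)
  have "card T * card (cl ` W) = card (\<Union> (cl ` W))"
  proof (rule card_partition)
    show "finite (\<Union> (cl ` W))" using fW by (auto simp: cl_def)
    fix c1 c2 assume "c1 \<in> cl ` W" "c2 \<in> cl ` W" "c1 \<noteq> c2"
    then obtain x y where xy: "c1 = cl x" "c2 = cl y" by auto
    show "c1 \<inter> c2 = {}"
    proof (rule ccontr)
      assume "c1 \<inter> c2 \<noteq> {}"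
      then obtain z where "x - z \<in> T" "y - z \<in> T" using xy by (auto simp: cl_def)
      hence "cl x = cl y" using same by metis
      thus False using xy \<open>c1 \<noteq> c2\<close> by simp
    qed
  qed (use fW card_cl in auto)
  also have "\<Union> (cl ` W) = W" using self by (auto simp: cl_def)
  finally have "card (cl ` W) = card L" using card cT by (simp add: mult.commute)
  then obtain h where h: "bij_betw h L (cl ` W)"
    using finite_same_card_bij[OF L, of "cl ` W"] fW by auto
  define g where "g = (\<lambda>y. SOME x. x \<in> h y)"
  have gh: "g y \<in> h y" if "y \<in> L" for y
  proof -
    have "h y \<in> cl ` W" using h that by (auto simp: bij_betw_def)
    then obtain x where "x \<in> h y" using self by blast
    thus ?thesis unfolding g_def by (rule someI[of "\<lambda>x. x \<in> h y"])
  qed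
  have h_image: "h ` L = cl ` W" using h by (rule bij_betw_imp_surj_on)
  have h_cl: "\<exists>x0\<in>W. h y = cl x0" if "y \<in> L" for y
    using imageI[OF that, of h] unfolding h_image by (rule imageE) (rule bexI)
  have iff: "x - g y \<in> T \<longleftrightarrow> h y = cl x" if "y \<in> L" "x \<in> W" for x y
  proof -
    note h_y = h_cl[OF that(1)]
    obtain x0 where x0: "x0 \<in> W" "h y = cl x0" using h_y by blast
    have gT: "x0 - g y \<in> T" "g y \<in> W" using gh[OF that(1)] x0 by (auto simp: cl_def)
    show ?thesis
    proof
      assume "x - g y \<in> T"
      hence "cl x = cl (g y)" by (rule same)
      moreover have "cl x0 = cl (g y)" using gT(1) by (rule same)
      ultimately show "h y = cl x" using x0(2) by simp
    next
      assume "h y = cl x"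
      thus "x - g y \<in> T" using gh[OF that(1)] by (simp add: cl_def)
    qed
  qed
  have "g y \<in> W" if "y \<in> L" for y
  proof -
    note h_y = h_cl[OF that]
    obtain x0 where "h y = cl x0" using h_y by blast
    thus ?thesis using gh[OF that] by (simp add: cl_def)
  qed
  moreover have "\<exists>!y. y \<in> L \<and> x - g y \<in> T" if x: "x \<in> W" for x
  proof -
    have "cl x \<in> h ` L" unfolding h_image using x by (rule imageI)
    then obtain y where y: "y \<in> L" "h y = cl x" by (metis imageE)
    show ?thesis
    proof (intro ex1I conjI)
      show "y \<in> L" by (rule y(1))
      show "x - g y \<in> T" using iff[OF y(1) x] y(2) by simp
      fix y' assume y': "y' \<in> L \<and> x - g y' \<in> T"
      hence "h y' = h y" using iff[of y' x] x y(2) by simp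
      thus "y' = y" using y' y(1) bij_betw_imp_inj_on[OF h] by (simp add: inj_on_eq_iff)
    qed
  qed
  ultimately show ?thesis by (intro exI[of _ g] conjI ballI)
qed

lemma finite_reg [simp]: "finite (reg n c)" "finite (reg_Q n)" "finite (reg_B c)"
  by (simp_all add: reg_def reg_Q_def reg_B_def)
lemma card_reg_Q [simp]: "card (reg_Q n) = n"
  by (simp add: reg_Q_def card_image)
lemma in_reg [simp]: "Inl i \<in> reg_Q n \<longleftrightarrow> i < n" "Inr j \<notin> reg_Q n" "Inl i \<notin> reg_B c" "Inr j \<in> reg_B c \<longleftrightarrow> j < c"
  "Inl i \<in> reg n c \<longleftrightarrow> i < n" "Inr j \<in> reg n c \<longleftrightarrow> j < c"
  by (auto simp: reg_def reg_Q_def reg_B_def)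
lemma reg_sub: "reg_Q n \<subseteq> reg n c" "reg_B c \<subseteq> reg n c" by (auto simp: reg_def)

text \<open>\<open>TX\<close> and \<open>TZ\<close> are the exponent vectors of the stabilizer. Below, \<open>W0\<close> plays the role of the code
  and \<open>T0\<close> that of its hull, both on the transmitted register.\<close>

locale ea_css =
  fixes n \<kappa> c l :: nat and TX TZ :: "(site \<Rightarrow> 'a::{field,finite}) set"
  assumes linear_TX: "linear_set TX" and linear_TZ: "linear_set TZ"
    and TX_vecs: "TX \<subseteq> vecs (reg n c)" and TZ_vecs: "TZ \<subseteq> vecs (reg n c)"
    and orth: "\<And>t z. t \<in> TX \<Longrightarrow> z \<in> TZ \<Longrightarrow> fdot (reg n c) z t = 0"
    and TX_onto_B: "\<And>w. w \<in> vecs (reg_B c) \<Longrightarrow> \<exists>t\<in>TX. cut (reg_B c) t = w"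
    and TZ_onto_B: "\<And>w. w \<in> vecs (reg_B c) \<Longrightarrow> \<exists>z\<in>TZ. cut (reg_B c) z = w"
    and card_W: "card {v \<in> vecs (reg_Q n). \<forall>z\<in>TZ. fdot (reg n c) z v = 0} = CARD('a) ^ (\<kappa> + l)"
    and card_T: "card (TX \<inter> vecs (reg_Q n)) = CARD('a) ^ l"
    and size: "\<kappa> + c \<le> n"
begin

abbreviation "R \<equiv> reg n c"
abbreviation "Q \<equiv> reg_Q n"
abbreviation "B \<equiv> reg_B c"
abbreviation "dt \<equiv> fdot (reg n c)"
definition "T0 = TX \<inter> vecs Q"
definition "W0 = {v \<in> vecs Q. \<forall>z\<in>TZ. dt z v = 0}"

lemma linear_T0: "linear_set T0" unfolding T0_def by (intro linear_set_Int linear_TX linear_set_vecs)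
lemma linear_W0: "linear_set W0"
  using linear_set_vecs[of Q] by (auto simp: W0_def linear_set_def fdot_diff_right fdot_smult_right)
lemma T0_W0: "T0 \<subseteq> W0" using orth by (auto simp: T0_def W0_def)

lemma cut_add_cut: "v \<in> vecs R \<Longrightarrow> cut Q v + cut B v = (v :: site \<Rightarrow> 'a)"
  by (auto simp: fun_eq_iff cut_def vecs_def reg_def reg_Q_def reg_B_def)

lemma cut_diff: "cut D (v - w) = cut D v - cut D (w :: site \<Rightarrow> 'a)"
  by (auto simp: fun_eq_iff cut_def)

text \<open>If the transmitted part of \<open>t\<close> is already orthogonal to \<open>TZ\<close>,
  then so is its part on Bob's side. \<open>TZ\<close> projects onto all of Bob's register, so that
  part is orthogonal to everything there.\<close>

lemma cut_B_eq_0: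
  assumes t: "t \<in> TX" and tW: "cut Q t \<in> W0"
  shows "cut B t = 0"
proof -
  have tR: "t \<in> vecs R" using t TX_vecs by blast
  have "fdot B (cut B t) w = 0" if w: "w \<in> vecs B" for w
  proof -
    obtain z where z: "z \<in> TZ" "cut B z = w" using TZ_onto_B[OF w] by blast
    have "dt z (cut Q t) = 0" using tW z by (simp add: W0_def)
    moreover have "dt z t = 0" using orth t z by simp
    moreover have "dt z t = dt z (cut Q t) + dt z (cut B t)"
      using cut_add_cut[OF tR] by (metis fdot_add_right)
    ultimately have "dt (cut B t) z = 0" by (simp add: fdot_commute)
    hence "fdot B (cut B t) z = 0" using fdot_mono_left[of R B "cut B t" z] reg_sub by simp
    thus ?thesis using z(2) by (metis fdot_cut)
  qed
  thus ?thesis using fdot_vecs_eq_0_iff[of B "cut B t"] by simp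
qed

definition transversal where
  "transversal g \<longleftrightarrow> (\<forall>y\<in>labels (reg_Q \<kappa>). g y \<in> W0) \<and>
     (\<forall>x\<in>W0. \<exists>!y. y \<in> labels (reg_Q \<kappa>) \<and> x - g y \<in> T0)"

definition section_B where
  "section_B s \<longleftrightarrow> (\<forall>w\<in>vecs B. s w \<in> TX \<and> cut B (s w) = w)"

lemma transversal_exists: "\<exists>g :: (site \<Rightarrow> 'a) \<Rightarrow> site \<Rightarrow> 'a. transversal g"
  unfolding transversal_def
proof (rule coset_transversal[OF linear_T0 linear_W0 T0_W0])
  show "finite W0" by (rule finite_subset[of _ "vecs Q"]) (auto simp: W0_def)
  show "finite (labels (reg_Q \<kappa>) :: (site \<Rightarrow> 'a) set)" by simp
  show "card W0 = card (labels (reg_Q \<kappa>) :: (site \<Rightarrow> 'a) set) * card T0"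
    using card_W card_T by (simp add: W0_def T0_def card_labels power_add)
qed

lemma section_exists: "\<exists>s. section_B s"
  unfolding section_B_def using TX_onto_B by metis

text \<open>Modulo \<open>W0\<close> only the section values remain, and \<open>cut_B_eq_0\<close>
  forces them to agree on Bob's side; the uniqueness of the transversal then identifies the
  messages. Different inputs thus receive disjoint cosets.\<close>

lemma same_coset:
  assumes g: "transversal g" and s: "section_B s"
    and y: "y \<in> labels (reg_Q \<kappa>)" "y' \<in> labels (reg_Q \<kappa>)" and w: "w \<in> vecs B" "w' \<in> vecs B"
    and d: "(g y + cut Q (s w)) - (g y' + cut Q (s w')) \<in> T0"
  shows "y = y' \<and> w = w'"
proof -
  have gW: "g y \<in> W0" "g y' \<in> W0" using g y by (auto simp: transversal_def)
  have t: "s w - s w' \<in> TX" using s w linear_setD(2)[OF linear_TX] by (auto simp: section_B_def)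
  have "cut Q (s w - s w') = ((g y + cut Q (s w)) - (g y' + cut Q (s w'))) - (g y - g y')"
    by (simp add: cut_diff)
  also have "\<dots> \<in> W0" using d gW T0_W0 linear_setD(2)[OF linear_W0] by blast
  finally have "cut B (s w - s w') = 0" using cut_B_eq_0[OF t] by simp
  hence ww: "w = w'" using s w by (simp add: section_B_def cut_diff)
  hence "g y - g y' \<in> T0" using d by simp
  moreover have "g y - g y \<in> T0" using linear_setD(1)[OF linear_T0] by simp
  ultimately have "y = y'" using g gW(1) y unfolding transversal_def by blast
  thus ?thesis using ww by simp
qed

definition in_part :: "(site \<Rightarrow> 'a) \<Rightarrow> site \<Rightarrow> 'a" where
  "in_part z = restrict z (reg_Q \<kappa>)"
text \<open>The last \<open>c\<close> entries of an encoder input are read off at transmitted sites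
  but placed on Bob's sites, so that they can be compared with Bob's half of the entangled
  pairs.\<close>

definition B_part :: "(site \<Rightarrow> 'a) \<Rightarrow> site \<Rightarrow> 'a" where
  "B_part z = (\<lambda>s. case s of Inl _ \<Rightarrow> 0 | Inr j \<Rightarrow> if j < c then z (Inl (n - c + j)) else 0)"
definition "inputs = {z \<in> labels Q. \<forall>j\<in>{\<kappa>..<n - c}. z (Inl j) = (0::'a)}"
definition pack :: "(site \<Rightarrow> 'a) \<Rightarrow> (site \<Rightarrow> 'a) \<Rightarrow> site \<Rightarrow> 'a" where
  "pack y w = restrict (\<lambda>s. case s of Inl i \<Rightarrow> if i < \<kappa> then y (Inl i) else if i < n - c then 0 else w (Inr (i - (n - c))) | Inr _ \<Rightarrow> 0) Q"

lemma B_part_vecs: "B_part z \<in> vecs B"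
  by (auto simp: B_part_def vecs_def split: sum.splits)
lemma in_part_labels: "in_part z \<in> labels (reg_Q \<kappa>)" by (simp add: in_part_def)

lemma pack_inputs: "pack y w \<in> inputs"
  unfolding inputs_def pack_def using size by auto
lemma in_part_pack: "y \<in> labels (reg_Q \<kappa>) \<Longrightarrow> in_part (pack y w) = y"
  using size by (auto simp: in_part_def pack_def fun_eq_iff labels_def PiE_def extensional_def restrict_def reg_Q_def)
lemma B_part_pack: "w \<in> vecs B \<Longrightarrow> B_part (pack y w) = w"
  using size by (auto simp: B_part_def pack_def fun_eq_iff vecs_def restrict_def split: sum.splits)
lemma pack_parts:
  assumes "z \<in> inputs" shows "pack (in_part z) (B_part z) = z"
proof
  fix s show "pack (in_part z) (B_part z) s = z s"
    using assms size
    by (cases s) (auto simp: inputs_def labels_def PiE_def extensional_def pack_def in_part_def B_part_def restrict_def)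
qed

text \<open>Normalises the uniform superposition over a coset of \<open>T0\<close>, which has q^l
  elements.\<close>

definition column_scale :: complex where "column_scale = complex_of_real (1 / sqrt (real (CARD('a) ^ l)))"

lemma column_scale_sq: "cnj column_scale * column_scale * of_nat (CARD('a) ^ l) = 1"
proof -
  have "cnj column_scale * column_scale = complex_of_real ((1 / sqrt (real (CARD('a) ^ l))) * (1 / sqrt (real (CARD('a) ^ l))))"
    unfolding column_scale_def by (simp only: complex_cnj_complex_of_real of_real_mult)
  also have "(1 / sqrt (real (CARD('a) ^ l))) * (1 / sqrt (real (CARD('a) ^ l))) = 1 / real (CARD('a) ^ l)"
    by (simp add: divide_simps flip: real_sqrt_mult)
  finally have e: "cnj column_scale * column_scale = complex_of_real (1 / real (CARD('a) ^ l))" .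
  have "real (CARD('a) ^ l) \<noteq> 0" by simp
  thus ?thesis unfolding e
    by (metis nonzero_eq_divide_eq of_real_1 of_real_mult of_real_of_nat_eq)
qed

lemma column_scale_nz: "column_scale \<noteq> 0" using column_scale_sq by auto

text \<open>The image under \<open>U\<close> of a basis state with message \<open>y\<close> and last entries \<open>w\<close> is the uniform
  superposition over a coset of the hull, namely that of \<open>g y\<close> plus the transmitted part of \<open>s w\<close>.\<close>

definition encoder_column where
  "encoder_column g s z x = column_scale * of_bool (cut Q x - (g (in_part z) + cut Q (s (B_part z))) \<in> T0)"

text \<open>For equal inputs the sum counts one coset; for different inputs a common vector would
  put the two representatives into the same coset, against \<open>same_coset\<close>.\<close>

lemma encoder_column_orthonormal:
  assumes g: "transversal g" and s: "section_B s" and z: "z \<in> inputs" "z' \<in> inputs"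
  shows "(\<Sum>x\<in>labels Q. cnj (encoder_column g s z x) * encoder_column g s z' x) = of_bool (z = z')"
proof -
  define r where "r = (\<lambda>z. g (in_part z) + cut Q (s (B_part z)))"
  have gQ: "g (in_part z) \<in> vecs Q" for z
    using g in_part_labels by (auto simp: transversal_def W0_def)
  have rQ: "r z \<in> vecs Q" for z
    unfolding r_def using gQ linear_setD(5)[OF linear_set_vecs] cut_in_vecs by blast
  have "(\<Sum>x\<in>labels Q. cnj (encoder_column g s z x) * encoder_column g s z' x)
      = (\<Sum>x\<in>labels Q. (\<lambda>v. cnj column_scale * column_scale * of_bool (v - r z \<in> T0 \<and> v - r z' \<in> T0)) (cut Q x))"
    unfolding encoder_column_def r_def by (intro sum.cong refl) simp
  also have "\<dots> = (\<Sum>v\<in>vecs Q. cnj column_scale * column_scale * of_bool (v - r z \<in> T0 \<and> v - r z' \<in> T0))"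
    by (rule sum_labels_eq_sum_vecs)
  also have "\<dots> = of_bool (z = z')"
  proof (cases "z = z'")
    case True
    have "vecs Q \<inter> {v. v - r z \<in> T0} = (\<lambda>t. t + r z) ` T0"
    proof safe
      fix v assume "v - r z \<in> T0" thus "v \<in> (\<lambda>t. t + r z) ` T0" by (intro image_eqI[of _ _ "v - r z"]) auto
    next
      fix t assume "t \<in> T0" thus "t + r z \<in> vecs Q"
        using rQ linear_setD(5)[OF linear_set_vecs] by (auto simp: T0_def)
    qed auto
    moreover have "card ((\<lambda>t. t + r z) ` T0) = CARD('a) ^ l"
      using card_T by (simp add: card_image inj_on_def T0_def)
    ultimately have "(\<Sum>v\<in>vecs Q. of_bool (v - r z \<in> T0)) = (of_nat (CARD('a) ^ l) :: complex)"
      by (subst sum_of_bool_eq) simp_all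
    thus ?thesis using True column_scale_sq by (simp add: sum_distrib_left[symmetric])
  next
    case False
    have "\<not> (v - r z \<in> T0 \<and> v - r z' \<in> T0)" for v
    proof
      assume "v - r z \<in> T0 \<and> v - r z' \<in> T0"
      hence "(v - r z') - (v - r z) \<in> T0" using linear_setD(2)[OF linear_T0] by blast
      hence "r z - r z' \<in> T0" by simp
      hence "in_part z = in_part z' \<and> B_part z = B_part z'"
        unfolding r_def by (rule same_coset[OF g s in_part_labels in_part_labels B_part_vecs B_part_vecs])
      thus False using False pack_parts z by metis
    qed
    hence "of_bool (v - r z \<in> T0 \<and> v - r z' \<in> T0) = (0 :: complex)" for v by simp
    thus ?thesis using False by (simp only: mult_zero_right sum.neutral_const of_bool_eq)
  qed
  finally show ?thesis .
qed

lemma encoder_input_eq: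
  assumes z: "z \<in> labels R"
  shows "encoder_input n \<kappa> c \<phi> (vec c (\<lambda>j. z (Inr j))) z' =
    (if z' \<in> inputs \<and> B_part z' = cut B z then \<phi> (in_part z') else 0)"
proof -
  have "B_part z' = cut B z \<longleftrightarrow> (\<forall>j<c. z' (Inl (n - c + j)) = z (Inr j))"
    by (auto simp: B_part_def cut_def fun_eq_iff split: sum.splits)
  thus ?thesis by (auto simp: encoder_input_def inputs_def in_part_def)
qed

definition isometry_scale :: complex where
  "isometry_scale = complex_of_real (real CARD('a) powr (- real c / 2)) * column_scale"

lemma isometry_scale_nz: "isometry_scale \<noteq> 0"
  using column_scale_nz by (simp add: isometry_scale_def)

text \<open>Bob's label singles out one string \<open>w\<close> of the entangled state, and then an
  encoder input is determined by its message; only the sum over messages remains.\<close>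

lemma ea_isometry_eq:
  assumes g: "transversal g" and s: "section_B s"
    and U: "\<And>z x. z \<in> inputs \<Longrightarrow> x \<in> labels Q \<Longrightarrow> U x z = encoder_column g s z x"
    and z: "z \<in> labels R"
  shows "ea_isometry n \<kappa> c U \<phi> z =
    isometry_scale * (\<Sum>y\<in>labels (reg_Q \<kappa>). of_bool (cut Q z - (g y + cut Q (s (cut B z))) \<in> T0) * \<phi> y)"
proof -
  let ?w = "vec c (\<lambda>j. z (Inr j))"
  let ?f = "\<lambda>w. op_apply (labels Q) U (encoder_input n \<kappa> c \<phi> w) (restrict z Q)"
  have "(\<Sum>w\<in>carrier_vec c. ?f w * of_bool (\<forall>j<c. z (Inr j) = w $ j)) = (\<Sum>w\<in>carrier_vec c. if w = ?w then ?f w else 0)"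
  proof (intro sum.cong refl)
    fix w :: "'a vec" assume "w \<in> carrier_vec c"
    hence "(\<forall>j<c. z (Inr j) = w $ j) \<longleftrightarrow> w = ?w" by auto
    thus "?f w * of_bool (\<forall>j<c. z (Inr j) = w $ j) = (if w = ?w then ?f w else 0)" by simp
  qed
  also have "\<dots> = ?f ?w" by simp
  finally have 1: "(\<Sum>w\<in>carrier_vec c. ?f w * of_bool (\<forall>j<c. z (Inr j) = w $ j)) = ?f ?w" .
  let ?D = "{z' \<in> inputs. B_part z' = cut B z}"
  have "?f ?w = (\<Sum>z'\<in>labels Q. U (restrict z Q) z' * (if z' \<in> ?D then \<phi> (in_part z') else 0))"
    unfolding op_apply_def encoder_input_eq[OF z] by simp
  also have "\<dots> = (\<Sum>z'\<in>?D. encoder_column g s z' (restrict z Q) * \<phi> (in_part z'))"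
    using U by (intro sum.mono_neutral_cong_right) (auto simp: inputs_def)
  also have "\<dots> = (\<Sum>y\<in>labels (reg_Q \<kappa>). column_scale * of_bool (cut Q z - (g y + cut Q (s (cut B z))) \<in> T0) * \<phi> y)"
    by (rule sum.reindex_bij_witness[of _ "\<lambda>y. pack y (cut B z)" in_part])
      (auto simp: pack_inputs in_part_pack B_part_pack in_part_labels encoder_column_def, metis pack_parts)
  also have "\<dots> = column_scale * (\<Sum>y\<in>labels (reg_Q \<kappa>). of_bool (cut Q z - (g y + cut Q (s (cut B z))) \<in> T0) * \<phi> y)"
    by (simp only: sum_distrib_left mult.assoc)
  finally have 2: "?f ?w = \<dots>" .
  show ?thesis
    unfolding ea_isometry_def isometry_scale_def 1 2 using z by (simp only: if_True mult.assoc)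
qed

text \<open>Modulo \<open>TX\<close> every vector has a representative on the transmitted register.
  A code state is therefore determined by its values on \<open>W0\<close>, which are constant on
  cosets of \<open>T0\<close>: one free amplitude for each message label.\<close>

theorem ea_isometry_image:
  "\<exists>U. unitary_op (labels Q) U \<and> css_space R TX TZ = ea_isometry n \<kappa> c U ` states (labels (reg_Q \<kappa>))"
proof -
  obtain g where g: "transversal (g :: (site \<Rightarrow> 'a) \<Rightarrow> site \<Rightarrow> 'a)" using transversal_exists by blast
  obtain s where s: "section_B s" using section_exists by blast
  have "\<exists>U. unitary_op (labels Q) U \<and> (\<forall>z\<in>inputs. \<forall>x\<in>labels Q. U x z = encoder_column g s z x)"
  proof (rule orthonormal_extend_unitary)
    show "inputs \<subseteq> labels Q" by (auto simp: inputs_def)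
  qed (simp_all add: encoder_column_orthonormal[OF g s])
  then obtain U where U: "unitary_op (labels Q) U" "\<And>z x. z \<in> inputs \<Longrightarrow> x \<in> labels Q \<Longrightarrow> U x z = encoder_column g s z x"
    by blast
  let ?V = "ea_isometry n \<kappa> c U"
  \<comment> \<open>Subtracting the chosen element of \<open>TX\<close> with the same entries on
    Bob's side clears his register; only its transmitted part needs to be written.\<close>
  define red where "red = (\<lambda>v. cut Q v - cut Q (s (cut B v)))"
  have Vv: "?V \<phi> (restrict v R) = isometry_scale * (\<Sum>y\<in>labels (reg_Q \<kappa>). of_bool (red v - g y \<in> T0) * \<phi> y)" if "v \<in> vecs R" for v \<phi>
  proof -
    have c: "cut Q (restrict v R) = cut Q v" "cut B (restrict v R) = cut B v"
      by (auto simp: cut_def fun_eq_iff reg_def)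
    have e: "cut Q v - (g y + cut Q (s (cut B v))) = red v - g y" for y by (simp add: red_def algebra_simps)
    show ?thesis using ea_isometry_eq[OF g s U(2), of "restrict v R" \<phi>] unfolding c e by simp
  qed
  have red_eq: "v - red v \<in> TX" if v: "v \<in> vecs R" for v
  proof -
    have sw: "s (cut B v) \<in> TX" "cut B (s (cut B v)) = cut B v"
      using s cut_in_vecs[of B v] unfolding section_B_def by blast+
    have sR: "s (cut B v) \<in> vecs R" using sw(1) TX_vecs by blast
    have "(cut Q v + cut B v) - red v = cut Q (s (cut B v)) + cut B (s (cut B v))"
      unfolding red_def sw(2) by (rule ext) simp
    hence "v - red v = s (cut B v)" by (simp only: cut_add_cut[OF v] cut_add_cut[OF sR])
    thus ?thesis using sw by simp
  qed
  have red_Q: "red v \<in> vecs Q" for v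
    unfolding red_def by (rule linear_setD(2)[OF linear_set_vecs cut_in_vecs cut_in_vecs])
  \<comment> \<open>The two reductions are congruent modulo \<open>TX\<close>, and both live on the
    transmitted register.\<close>
  have red_TX: "red (v - t) - red v \<in> T0" if v: "v \<in> vecs R" and t: "t \<in> TX" for v t
  proof -
    have vt: "v - t \<in> vecs R" by (rule linear_setD(2)[OF linear_set_vecs v subsetD[OF TX_vecs t]])
    have e: "red (v - t) - red v = (v - red v) - ((v - t) - red (v - t)) - t"
      by (simp add: fun_eq_iff)
    have "red (v - t) - red v \<in> TX"
      unfolding e by (rule linear_setD(2)[OF linear_TX linear_setD(2)[OF linear_TX red_eq[OF v] red_eq[OF vt]] t])
    moreover have "red (v - t) - red v \<in> vecs Q" by (rule linear_setD(2)[OF linear_set_vecs red_Q red_Q])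
    ultimately show ?thesis unfolding T0_def by (rule IntI)
  qed
  have gW: "g y \<in> W0" if "y \<in> labels (reg_Q \<kappa>)" for y
    using g[unfolded transversal_def, THEN conjunct1] that by (rule bspec)
  have sound: "?V \<phi> \<in> css_space R TX TZ" for \<phi>
    unfolding css_space_def
  proof (intro CollectI conjI ballI impI)
    show "?V \<phi> \<in> states (labels R)" by (simp add: states_def ea_isometry_def)
  next
    fix v t :: "site \<Rightarrow> 'a" assume v: "v \<in> vecs R" and t: "t \<in> TX"
    have vt: "v - t \<in> vecs R" by (rule linear_setD(2)[OF linear_set_vecs v subsetD[OF TX_vecs t]])
    have "red (v - t) - g y \<in> T0 \<longleftrightarrow> red v - g y \<in> T0" for y
      by (rule linear_set_coset_iff(1)[OF linear_T0 red_TX[OF v t]])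
    thus "?V \<phi> (restrict (v - t) R) = ?V \<phi> (restrict v R)" by (simp only: Vv[OF v] Vv[OF vt])
  next
    fix v z :: "site \<Rightarrow> 'a" assume v: "v \<in> vecs R" and z: "z \<in> TZ" and nz: "?V \<phi> (restrict v R) \<noteq> 0"
    have "\<exists>y\<in>labels (reg_Q \<kappa>). red v - g y \<in> T0"
    proof (rule ccontr)
      assume "\<not> ?thesis"
      hence "(\<Sum>y\<in>labels (reg_Q \<kappa>). of_bool (red v - g y \<in> T0) * \<phi> y) = 0" by (intro sum.neutral) auto
      thus False using nz Vv[OF v] by simp
    qed
    then obtain y where y: "y \<in> labels (reg_Q \<kappa>)" "red v - g y \<in> T0" by blast
    have "dt z (v - red v) = 0" by (rule orth[OF red_eq[OF v] z])
    moreover have "dt z (red v - g y) = 0" using orth y(2) z by (auto simp: T0_def)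
    moreover have "dt z (g y) = 0" using gW[OF y(1)] z by (simp add: W0_def)
    ultimately show "dt z v = 0" by (simp add: fdot_diff_right)
  qed
  have complete: "\<psi> \<in> ?V ` states (labels (reg_Q \<kappa>))" if \<psi>: "\<psi> \<in> css_space R TX TZ" for \<psi>
  proof -
    note \<psi>D = \<psi>[unfolded css_space_def mem_Collect_eq]
    have \<psi>_states: "\<psi> \<in> states (labels R)" by (rule \<psi>D[THEN conjunct1])
    have inv: "\<psi> (restrict (v - t) R) = \<psi> (restrict v R)" if "v \<in> vecs R" "t \<in> TX" for v t
      by (rule \<psi>D[THEN conjunct2, THEN conjunct1, rule_format, OF that])
    have supp: "dt z v = 0" if "v \<in> vecs R" "z \<in> TZ" "\<psi> (restrict v R) \<noteq> 0" for v z
      by (rule \<psi>D[THEN conjunct2, THEN conjunct2, rule_format, OF that])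
    have QR: "v \<in> vecs R" if "v \<in> vecs Q" for v :: "site \<Rightarrow> 'a" using that vecs_mono[OF reg_sub(1)] by blast
    \<comment> \<open>The amplitude of a message is the value of the state at its coset
      representative, freed from the normalisation.\<close>
    define \<phi> where "\<phi> = (\<lambda>y. if y \<in> labels (reg_Q \<kappa>) then \<psi> (restrict (g y) R) / isometry_scale else 0)"
    have main: "?V \<phi> (restrict v R) = \<psi> (restrict v R)" if v: "v \<in> vecs R" for v
    proof -
      have pv: "\<psi> (restrict v R) = \<psi> (restrict (red v) R)"
      proof -
        have "v - (v - red v) = red v" by simp
        thus ?thesis using inv[OF v red_eq[OF v]] by (simp only:)
      qed
      show ?thesis
      proof (cases "red v \<in> W0")
        case True
        have "\<exists>!y. y \<in> labels (reg_Q \<kappa>) \<and> red v - g y \<in> T0"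
          using g[unfolded transversal_def, THEN conjunct2] True by (rule bspec)
        then obtain y0 where y0_both: "y0 \<in> labels (reg_Q \<kappa>) \<and> red v - g y0 \<in> T0"
          and uniq_all: "\<forall>y. y \<in> labels (reg_Q \<kappa>) \<and> red v - g y \<in> T0 \<longrightarrow> y = y0"
          by (rule ex1E)
        have y0: "y0 \<in> labels (reg_Q \<kappa>)" "red v - g y0 \<in> T0"
          using y0_both by (rule conjunct1, rule conjunct2)
        have uniq: "y = y0" if "y \<in> labels (reg_Q \<kappa>)" "red v - g y \<in> T0" for y
          using uniq_all that by (simp only: simp_thms)
        have "(\<Sum>y\<in>labels (reg_Q \<kappa>). of_bool (red v - g y \<in> T0) * \<phi> y) = (\<Sum>y\<in>labels (reg_Q \<kappa>). if y = y0 then \<phi> y0 else 0)"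
        proof (intro sum.cong refl)
          fix y :: "site \<Rightarrow> 'a" assume y: "y \<in> labels (reg_Q \<kappa>)"
          show "of_bool (red v - g y \<in> T0) * \<phi> y = (if y = y0 then \<phi> y0 else 0)"
          proof (cases "y = y0")
            case True
            thus ?thesis using y0(2) by simp
          next
            case False
            hence "red v - g y \<notin> T0" using uniq[OF y] by blast
            thus ?thesis using False by simp
          qed
        qed
        also have "\<dots> = \<psi> (restrict (g y0) R) / isometry_scale" using y0(1) by (simp add: \<phi>_def)
        finally have sum_eq: "(\<Sum>y\<in>labels (reg_Q \<kappa>). of_bool (red v - g y \<in> T0) * \<phi> y) = \<psi> (restrict (g y0) R) / isometry_scale" .
        have "red v - g y0 \<in> TX" using y0(2) by (simp add: T0_def)
        hence "\<psi> (restrict (red v - (red v - g y0)) R) = \<psi> (restrict (red v) R)" by (rule inv[OF QR[OF red_Q]])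
        moreover have "red v - (red v - g y0) = g y0" by simp
        ultimately have "\<psi> (restrict (g y0) R) = \<psi> (restrict v R)" using pv by (simp only:)
        thus ?thesis unfolding Vv[OF v] sum_eq using isometry_scale_nz by simp
      next
        case False
        have "red v - g y \<notin> T0" if "y \<in> labels (reg_Q \<kappa>)" for y
        proof
          assume "red v - g y \<in> T0"
          hence "red v - g y \<in> W0" by (rule subsetD[OF T0_W0])
          from linear_setD(5)[OF linear_W0 this gW[OF that]] have "red v \<in> W0" by (simp only: diff_add_cancel)
          with False show False by (rule notE)
        qed
        hence "(\<Sum>y\<in>labels (reg_Q \<kappa>). of_bool (red v - g y \<in> T0) * \<phi> y) = 0" by (intro sum.neutral) simp
        hence "?V \<phi> (restrict v R) = 0" unfolding Vv[OF v] by simp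
        moreover have "\<psi> (restrict (red v) R) = 0"
        proof (rule ccontr)
          assume nz: "\<psi> (restrict (red v) R) \<noteq> 0"
          have "red v \<in> W0"
            unfolding W0_def mem_Collect_eq by (intro conjI ballI red_Q supp[OF QR[OF red_Q] _ nz])
          with False show False by (rule notE)
        qed
        ultimately show ?thesis using pv by (simp only:)
      qed
    qed
    have "?V \<phi> = \<psi>"
    proof
      fix x show "?V \<phi> x = \<psi> x"
      proof (cases "x \<in> labels R")
        case True
        show ?thesis using main[OF cut_in_vecs, of x] unfolding restrict_cut[OF True] .
      next
        case False
        thus ?thesis using \<psi>_states by (simp add: ea_isometry_def states_def)
      qed
    qed
    moreover have "\<phi> \<in> states (labels (reg_Q \<kappa>))" by (simp add: \<phi>_def states_def)
    ultimately show ?thesis by (rule image_eqI[of _ _ \<phi>, OF sym])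
  qed
  have "css_space R TX TZ = ?V ` states (labels (reg_Q \<kappa>))"
  proof
    show "css_space R TX TZ \<subseteq> ?V ` states (labels (reg_Q \<kappa>))" using complete by (rule subsetI)
    show "?V ` states (labels (reg_Q \<kappa>)) \<subseteq> css_space R TX TZ" using sound by (rule image_subsetI)
  qed
  with U(1) show ?thesis by (intro exI[of _ U] conjI)
qed
end

section \<open>From stabilizers to translation-invariant states\<close>

definition join :: "nat \<Rightarrow> nat \<Rightarrow> 'a::zero vec \<Rightarrow> 'a vec \<Rightarrow> site \<Rightarrow> 'a" where
  "join n c x w = cut (reg n c) (case_sum (($) x) (($) w))"

definition row_vecs :: "nat \<Rightarrow> nat \<Rightarrow> nat \<Rightarrow> 'a::comm_ring_1 mat \<Rightarrow> 'a mat \<Rightarrow> (site \<Rightarrow> 'a) set" where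
  "row_vecs n c m H F = (\<lambda>u. join n c (transpose_mat H *\<^sub>v u) (transpose_mat F *\<^sub>v u)) ` carrier_vec m"

lemma join_simps [simp]:
  "join n c x w (Inl i) = (if i < n then x $ i else 0)" "join n c x w (Inr j) = (if j < c then w $ j else 0)"
  by (simp_all add: join_def cut_def)

lemma join_vecs [simp]: "join n c x w \<in> vecs (reg n c)" by (simp add: join_def)

lemma sum_reg: "(\<Sum>s\<in>reg n c. f s) = (\<Sum>i<n. f (Inl i)) + (\<Sum>j<c. f (Inr j))"
proof -
  have "(\<Sum>s\<in>reg n c. f s) = (\<Sum>s\<in>reg_Q n. f s) + (\<Sum>s\<in>reg_B c. f s)"
    unfolding reg_def by (rule sum.union_disjoint) (auto simp: reg_Q_def reg_B_def)
  thus ?thesis by (simp add: reg_Q_def reg_B_def sum.reindex)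
qed

lemma fdot_join:
  assumes "y \<in> carrier_vec n" "z \<in> carrier_vec c"
  shows "fdot (reg n c) (join n c x w) (join n c y z) = x \<bullet> y + w \<bullet> z"
  using assms by (simp add: fdot_def sum_reg scalar_prod_def atLeast0LessThan)

lemma join_inj:
  assumes "join n c x w = join n c y z" "x \<in> carrier_vec n" "y \<in> carrier_vec n" "w \<in> carrier_vec c" "z \<in> carrier_vec c"
  shows "x = y" and "w = z"
proof -
  have "x $ i = y $ i" if "i < n" for i using fun_cong[OF assms(1), of "Inl i"] that by simp
  thus "x = y" using assms by (intro eq_vecI) auto
  have "w $ i = z $ i" if "i < c" for i using fun_cong[OF assms(1), of "Inr i"] that by simp
  thus "w = z" using assms by (intro eq_vecI) auto
qed

lemma join_diff:
  fixes x y w z :: "'a::comm_ring_1 vec"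
  assumes "y \<in> carrier_vec n" "z \<in> carrier_vec c"
  shows "join n c x w - join n c y z = join n c (x - y) (w - z)"
proof
  fix s show "(join n c x w - join n c y z) s = join n c (x - y) (w - z) s"
    using assms by (cases s) auto
qed

lemma join_smult:
  fixes y z :: "'a::comm_ring_1 vec"
  assumes "y \<in> carrier_vec n" "z \<in> carrier_vec c"
  shows "(\<lambda>s. a * join n c y z s) = join n c (a \<cdot>\<^sub>v y) (a \<cdot>\<^sub>v z)"
proof
  fix s show "a * join n c y z s = join n c (a \<cdot>\<^sub>v y) (a \<cdot>\<^sub>v z) s"
    using assms by (cases s) auto
qed

lemma join_zero: "join n c (0\<^sub>v n) (0\<^sub>v c) = 0"
proof
  fix s show "join n c (0\<^sub>v n) (0\<^sub>v c) s = 0 s" by (cases s) auto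
qed

lemma join_vecs_Q_iff:
  assumes "w \<in> carrier_vec c"
  shows "join n c x w \<in> vecs (reg_Q n) \<longleftrightarrow> w = 0\<^sub>v c"
proof
  assume "join n c x w \<in> vecs (reg_Q n)"
  hence "w $ j = 0" if "j < c" for j using that by (auto simp: vecs_def dest!: spec[of _ "Inr j"])
  thus "w = 0\<^sub>v c" using assms by (intro eq_vecI) auto
next
  assume "w = 0\<^sub>v c"
  thus "join n c x w \<in> vecs (reg_Q n)"
    unfolding vecs_def
    by (intro CollectI allI impI, rename_tac s, case_tac s) auto
qed

lemma row_vecs_vecs: "row_vecs n c m H F \<subseteq> vecs (reg n c)"
  by (auto simp: row_vecs_def)

lemma linear_row_vecs:
  fixes H F :: "'a::field mat"
  assumes H: "H \<in> carrier_mat m n" and F: "F \<in> carrier_mat m c"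
  shows "linear_set (row_vecs n c m H F)"
  unfolding linear_set_def
proof (intro conjI ballI allI)
  have Ht: "transpose_mat H \<in> carrier_mat n m" and Ft: "transpose_mat F \<in> carrier_mat c m" using H F by auto
  have in_rv: "join n c (transpose_mat H *\<^sub>v u) (transpose_mat F *\<^sub>v u) \<in> row_vecs n c m H F"
    if "u \<in> carrier_vec m" for u using that by (simp add: row_vecs_def)
  have "transpose_mat H *\<^sub>v 0\<^sub>v m = 0\<^sub>v n" "transpose_mat F *\<^sub>v 0\<^sub>v m = 0\<^sub>v c"
    using Ht Ft by (auto intro!: eq_vecI)
  thus "0 \<in> row_vecs n c m H F" using in_rv[of "0\<^sub>v m"] by (simp add: join_zero)
  fix x assume "x \<in> row_vecs n c m H F"
  then obtain u where u: "u \<in> carrier_vec m" "x = join n c (transpose_mat H *\<^sub>v u) (transpose_mat F *\<^sub>v u)"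
    by (auto simp: row_vecs_def)
  have uc: "transpose_mat H *\<^sub>v u \<in> carrier_vec n" "transpose_mat F *\<^sub>v u \<in> carrier_vec c" using Ht Ft u by auto
  show "(\<lambda>s. a * x s) \<in> row_vecs n c m H F" for a
    unfolding u(2) join_smult[OF uc] using in_rv[of "a \<cdot>\<^sub>v u"] u(1)
    by (simp add: mult_mat_vec[OF Ht u(1)] mult_mat_vec[OF Ft u(1)])
  fix y assume "y \<in> row_vecs n c m H F"
  then obtain u' where u': "u' \<in> carrier_vec m" "y = join n c (transpose_mat H *\<^sub>v u') (transpose_mat F *\<^sub>v u')"
    by (auto simp: row_vecs_def)
  have uc': "transpose_mat H *\<^sub>v u' \<in> carrier_vec n" "transpose_mat F *\<^sub>v u' \<in> carrier_vec c" using Ht Ft u' by auto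
  show "x - y \<in> row_vecs n c m H F"
    unfolding u(2) u'(2) join_diff[OF uc'] using in_rv[of "u - u'"] u(1) u'(1)
    by (simp add: mult_minus_distrib_mat_vec[OF Ht u(1) u'(1)] mult_minus_distrib_mat_vec[OF Ft u(1) u'(1)])
qed

section \<open>Matrix entries of Pauli operators and their action on states\<close>

lemma prod_of_bool: "finite A \<Longrightarrow> (\<Prod>s\<in>A. of_bool (P s)) = (of_bool (\<forall>s\<in>A. P s) :: complex)"
  by (induction A rule: finite_induct) auto

lemma add_char_sum: "add_char (sum f A) = (\<Prod>s\<in>A. add_char (f s :: 'a::{field,finite}))"
  by (induction A rule: infinite_finite_induct) (auto simp: add_char_add)

lemma labels_eqI: "x \<in> labels A \<Longrightarrow> y \<in> labels A \<Longrightarrow> (\<And>s. s \<in> A \<Longrightarrow> x s = y s) \<Longrightarrow> x = y"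
  unfolding labels_def by (rule PiE_ext)

lemma pauli_XZ_entry:
  fixes x y :: "'s \<Rightarrow> 'a::{field,finite}"
  assumes A: "finite A" and x: "x \<in> labels A" and y: "y \<in> labels A"
  shows "pauli_XZ A a b x y = of_bool (\<forall>s\<in>A. x s = y s + a s) * add_char (fdot A b y)"
proof -
  have Z: "pauli_Z A b z y = (if z = y then add_char (fdot A b y) else 0)" if "z \<in> labels A" for z
  proof -
    have "(\<forall>s\<in>A. z s = y s) \<longleftrightarrow> z = y" using labels_eqI[OF that y] by auto
    thus ?thesis using that y A
      by (simp add: pauli_Z_def site_tensor_def qudit_Z_def prod.distrib prod_of_bool fdot_def add_char_sum)
  qed
  have "pauli_XZ A a b x y = (\<Sum>z\<in>labels A. if z = y then pauli_X A a x y * add_char (fdot A b y) else 0)"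
    unfolding pauli_XZ_def op_mult_def by (intro sum.cong refl) (simp add: Z)
  also have "\<dots> = pauli_X A a x y * add_char (fdot A b y)" using A y by simp
  also have "pauli_X A a x y = of_bool (\<forall>s\<in>A. x s = y s + a s)"
    using A x y by (simp add: pauli_X_def site_tensor_def qudit_X_def prod_of_bool)
  finally show ?thesis .
qed

lemma pauli_XZ_tensor_entry:
  fixes x y :: "site \<Rightarrow> 'a::{field,finite}"
  assumes x: "x \<in> labels (reg n c)" and y: "y \<in> labels (reg n c)"
  shows "op_tensor (reg_Q n) (reg_B c) (pauli_XZ (reg_Q n) a b) (pauli_XZ (reg_B c) a b) x y
       = of_bool (\<forall>s\<in>reg n c. x s = y s + a s) * add_char (fdot (reg n c) b y)"
proof -
  have f: "fdot D b (restrict y D) = fdot D b y" for D by (simp add: fdot_def)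
  have "fdot (reg n c) b y = fdot (reg_Q n) b y + fdot (reg_B c) b y"
    unfolding fdot_def reg_def by (rule sum.union_disjoint) (auto simp: reg_Q_def reg_B_def)
  hence "add_char (fdot (reg n c) b y) = add_char (fdot (reg_Q n) b y) * add_char (fdot (reg_B c) b y)"
    by (simp add: add_char_add)
  moreover have "(\<forall>s\<in>reg n c. x s = y s + a s) \<longleftrightarrow> (\<forall>s\<in>reg_Q n. x s = y s + a s) \<and> (\<forall>s\<in>reg_B c. x s = y s + a s)"
    by (auto simp: reg_def)
  ultimately show ?thesis
    using x y by (simp add: op_tensor_def reg_def[symmetric] pauli_XZ_entry f)
qed

text \<open>In each row a single entry is nonzero. The phase factor acts before the shift, so it is
  evaluated at the shifted-back vector.\<close>

lemma stabilizer_apply: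
  fixes \<psi> :: "(site \<Rightarrow> 'a::{field,finite}) state"
  assumes v: "v \<in> vecs (reg n c)"
  shows "op_apply (labels (reg n c)) (eacss_stabilizer n c HX HZ FX FZ u w) \<psi> (restrict v (reg n c))
       = add_char (fdot (reg n c) (join n c (transpose_mat HZ *\<^sub>v w) (transpose_mat FZ *\<^sub>v w))
             (v - join n c (transpose_mat HX *\<^sub>v u) (transpose_mat FX *\<^sub>v u))) *
         \<psi> (restrict (v - join n c (transpose_mat HX *\<^sub>v u) (transpose_mat FX *\<^sub>v u)) (reg n c))"
proof -
  let ?A = "reg n c"
  define a where "a = case_sum (($) (transpose_mat HX *\<^sub>v u)) (($) (transpose_mat FX *\<^sub>v u))"
  define b where "b = case_sum (($) (transpose_mat HZ *\<^sub>v w)) (($) (transpose_mat FZ *\<^sub>v w))"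
  have ja: "join n c (transpose_mat HX *\<^sub>v u) (transpose_mat FX *\<^sub>v u) = cut ?A a" by (simp add: join_def a_def)
  have jb: "join n c (transpose_mat HZ *\<^sub>v w) (transpose_mat FZ *\<^sub>v w) = cut ?A b" by (simp add: join_def b_def)
  let ?y = "restrict (v - cut ?A a) ?A"
  have iff: "(\<forall>s\<in>?A. v s = y s + a s) \<longleftrightarrow> y = ?y" if "y \<in> labels ?A" for y
  proof
    assume *: "\<forall>s\<in>?A. v s = y s + a s"
    show "y = ?y" by (rule labels_eqI[OF that restrict_in_labels]) (use * in \<open>simp add: cut_def\<close>)
  next
    assume "y = ?y" thus "\<forall>s\<in>?A. v s = y s + a s" by (simp add: cut_def)
  qed
  have fy: "fdot ?A b ?y = fdot ?A (cut ?A b) (v - cut ?A a)" by (simp add: fdot_def cut_def)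
  have "op_apply (labels ?A) (eacss_stabilizer n c HX HZ FX FZ u w) \<psi> (restrict v ?A)
      = (\<Sum>y\<in>labels ?A. if y = ?y then add_char (fdot ?A b ?y) * \<psi> ?y else 0)"
    unfolding op_apply_def eacss_stabilizer_def Let_def a_def[symmetric] b_def[symmetric]
  proof (intro sum.cong refl)
    fix y :: "site \<Rightarrow> 'a" assume y: "y \<in> labels ?A"
    have "(\<forall>s\<in>?A. restrict v ?A s = y s + a s) \<longleftrightarrow> y = ?y" using iff[OF y] by simp
    thus "op_tensor (reg_Q n) (reg_B c) (pauli_XZ (reg_Q n) a b) (pauli_XZ (reg_B c) a b) (restrict v ?A) y * \<psi> y
        = (if y = ?y then add_char (fdot ?A b ?y) * \<psi> ?y else 0)"
      unfolding pauli_XZ_tensor_entry[OF restrict_in_labels y] by auto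
  qed
  also have "\<dots> = add_char (fdot ?A b ?y) * \<psi> ?y" by simp
  finally show ?thesis unfolding ja jb fy .
qed

text \<open>The elements with \<open>w = 0\<close> give translation invariance, those with
  \<open>u = 0\<close> make characters equal to 1 on the support. Since \<open>TZ\<close> is closed
  under scaling, a character equal to 1 on all multiples forces the inner product itself to
  vanish.\<close>

lemma stabilized_eq_css_space:
  fixes HX HZ FX FZ :: "'a::{field,finite} mat"
  assumes HX: "HX \<in> carrier_mat m n" and FX: "FX \<in> carrier_mat m c"
    and HZ: "HZ \<in> carrier_mat m' n" and FZ: "FZ \<in> carrier_mat m' c"
  shows "{\<psi> \<in> states (labels (reg n c)). \<forall>u \<in> carrier_vec m. \<forall>v \<in> carrier_vec m'.
            op_apply (labels (reg n c)) (eacss_stabilizer n c HX HZ FX FZ u v) \<psi> = \<psi>}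
       = css_space (reg n c) (row_vecs n c m HX FX) (row_vecs n c m' HZ FZ)"
    (is "?L = ?R")
proof -
  let ?A = "reg n c"
  let ?t = "\<lambda>u. join n c (transpose_mat HX *\<^sub>v u) (transpose_mat FX *\<^sub>v u)"
  let ?z = "\<lambda>w. join n c (transpose_mat HZ *\<^sub>v w) (transpose_mat FZ *\<^sub>v w)"
  have t0: "?t (0\<^sub>v m) = 0" "?z (0\<^sub>v m') = 0"
  proof -
    have "transpose_mat HX *\<^sub>v 0\<^sub>v m = 0\<^sub>v n" "transpose_mat FX *\<^sub>v 0\<^sub>v m = 0\<^sub>v c"
      "transpose_mat HZ *\<^sub>v 0\<^sub>v m' = 0\<^sub>v n" "transpose_mat FZ *\<^sub>v 0\<^sub>v m' = 0\<^sub>v c"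
      using HX FX HZ FZ by (auto intro!: eq_vecI)
    thus "?t (0\<^sub>v m) = 0" "?z (0\<^sub>v m') = 0" by (simp_all add: join_zero)
  qed
  have lin: "linear_set (row_vecs n c m' HZ FZ)" by (rule linear_row_vecs[OF HZ FZ])
  have "\<psi> \<in> ?R" if \<psi>: "\<psi> \<in> ?L" for \<psi>
    unfolding css_space_def
  proof (intro CollectI conjI ballI impI)
    show "\<psi> \<in> states (labels ?A)" using \<psi> by simp
    have fix_eq: "add_char (fdot ?A (?z w) (v - ?t u)) * \<psi> (restrict (v - ?t u) ?A) = \<psi> (restrict v ?A)"
      if "v \<in> vecs ?A" "u \<in> carrier_vec m" "w \<in> carrier_vec m'" for v u w
      using stabilizer_apply[OF that(1), of HX HZ FX FZ u w \<psi>] \<psi> that by simp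
    {
      fix v t :: "site \<Rightarrow> 'a" assume v: "v \<in> vecs ?A" and t: "t \<in> row_vecs n c m HX FX"
      obtain u where u: "u \<in> carrier_vec m" "t = ?t u" using t by (auto simp: row_vecs_def)
      show "\<psi> (restrict (v - t) ?A) = \<psi> (restrict v ?A)"
        using fix_eq[OF v u(1), of "0\<^sub>v m'"] unfolding t0 u(2)[symmetric] by simp
    next
      fix v z :: "site \<Rightarrow> 'a" assume v: "v \<in> vecs ?A" and z: "z \<in> row_vecs n c m' HZ FZ" and nz: "\<psi> (restrict v ?A) \<noteq> 0"
      have one: "add_char (fdot ?A z' v) = 1" if z': "z' \<in> row_vecs n c m' HZ FZ" for z'
      proof -
        obtain w where w: "w \<in> carrier_vec m'" "z' = ?z w" using z' by (auto simp: row_vecs_def)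
        have "add_char (fdot ?A z' v) * \<psi> (restrict v ?A) = \<psi> (restrict v ?A)"
          using fix_eq[OF v zero_carrier_vec w(1)] unfolding t0 w(2)[symmetric] by simp
        thus ?thesis using nz by simp
      qed
      show "fdot ?A z v = 0"
      proof (rule ccontr)
        assume "fdot ?A z v \<noteq> 0"
        then obtain x where x: "add_char (x * fdot ?A z v) \<noteq> 1" using add_char_nontrivial by blast
        have "fdot ?A (\<lambda>s. x * z s) v = x * fdot ?A z v" by (simp add: fdot_def sum_distrib_left mult_ac)
        thus False using one[OF linear_setD(3)[OF lin z]] x by metis
      qed
    }
  qed
  moreover have "\<psi> \<in> ?L" if \<psi>: "\<psi> \<in> ?R" for \<psi>
  proof (intro CollectI conjI ballI)
    show st: "\<psi> \<in> states (labels ?A)" using \<psi> by (simp add: css_space_def)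
    fix u w :: "'a vec" assume u: "u \<in> carrier_vec m" and w: "w \<in> carrier_vec m'"
    have tin: "?t u \<in> row_vecs n c m HX FX" and zin: "?z w \<in> row_vecs n c m' HZ FZ" using u w by (auto simp: row_vecs_def)
    show "op_apply (labels ?A) (eacss_stabilizer n c HX HZ FX FZ u w) \<psi> = \<psi>"
    proof
      fix x show "op_apply (labels ?A) (eacss_stabilizer n c HX HZ FX FZ u w) \<psi> x = \<psi> x"
      proof (cases "x \<in> labels ?A")
        case False
        thus ?thesis using st by (simp add: op_apply_def eacss_stabilizer_def Let_def op_tensor_def states_def reg_def)
      next
        case True
        let ?v = "cut ?A x"
        have v: "?v \<in> vecs ?A" by simp
        have vt: "?v - ?t u \<in> vecs ?A" by (rule linear_setD(2)[OF linear_set_vecs v join_vecs])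
        have "add_char (fdot ?A (?z w) (?v - ?t u)) * \<psi> (restrict (?v - ?t u) ?A) = \<psi> (restrict (?v - ?t u) ?A)"
        proof (cases "\<psi> (restrict (?v - ?t u) ?A) = 0")
          case False
          hence "fdot ?A (?z w) (?v - ?t u) = 0" using \<psi> vt zin unfolding css_space_def by blast
          thus ?thesis by simp
        qed simp
        also have "\<dots> = \<psi> (restrict ?v ?A)" using \<psi> v tin unfolding css_space_def by blast
        finally show ?thesis
          using stabilizer_apply[OF v, of HX HZ FX FZ u w \<psi>] restrict_cut[OF True] by simp
      qed
    qed
  qed
  ultimately show ?thesis by blast
qed

section \<open>Parity-check matrices and the hull\<close>

lemma CARD_field_gt_1: "CARD('a::{field,finite}) > 1"
proof -
  have "card {0, 1 :: 'a} \<le> CARD('a)" by (intro card_mono) auto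
  thus ?thesis by simp
qed

lemma CARD_power_le_iff: "CARD('a::{field,finite}) ^ a \<le> CARD('a) ^ b \<longleftrightarrow> a \<le> b"
  using power_increasing_iff[OF CARD_field_gt_1[where 'a='a]] by blast

lemma CARD_power_eq_iff: "CARD('a::{field,finite}) ^ a = CARD('a) ^ b \<longleftrightarrow> a = b"
  using CARD_field_gt_1[where 'a='a] by (simp add: power_inject_exp)

lemma dual_code_subspace:
  fixes C :: "'a::field vec set"
  assumes "C \<subseteq> carrier_vec n"
  shows "VectorSpace.subspace class_ring (dual_code n C) (module_vec TYPE('a) n)"
proof (rule subspaceI)
  fix x y :: "'a vec" assume "x \<in> dual_code n C" "y \<in> dual_code n C"
  thus "x + y \<in> dual_code n C"
    using assms by (auto simp: dual_code_def add_scalar_prod_distrib[of _ n])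
next
  fix a and x :: "'a vec" assume "x \<in> dual_code n C"
  thus "a \<cdot>\<^sub>v x \<in> dual_code n C"
    using assms by (auto simp: dual_code_def smult_scalar_prod_distrib[of _ n])
qed (use assms in \<open>auto simp: dual_code_def\<close>)

lemma subspace_Int:
  fixes V W :: "'a::field vec set"
  assumes "VectorSpace.subspace class_ring V (module_vec TYPE('a) n)" "VectorSpace.subspace class_ring W (module_vec TYPE('a) n)"
  shows "VectorSpace.subspace class_ring (V \<inter> W) (module_vec TYPE('a) n)"
  using subspaceD[OF assms(1)] subspaceD[OF assms(2)] by (intro subspaceI) auto

context
  fixes C :: "'a::{field,finite} vec set" and n m :: nat
  assumes C: "VectorSpace.subspace class_ring C (module_vec TYPE('a) n)" and m: "m = n - code_dim n C"
begin

lemma code_dim_le: "code_dim n C \<le> n"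
proof -
  have "card C \<le> card (carrier_vec n :: 'a vec set)" by (intro card_mono subspaceD(1)[OF C]) simp
  thus ?thesis by (simp add: card_eq_power_code_dim[OF C] card_carrier_vec CARD_power_le_iff)
qed

lemma parity_check_dual:
  assumes "parity_check_matrix n C H"
  shows "H \<in> carrier_mat m n" and "C = mat_kernel H"
    and "dual_code n C = (*\<^sub>v) (transpose_mat H) ` carrier_vec m"
proof -
  show H: "H \<in> carrier_mat m n" and "C = mat_kernel H" using assms unfolding parity_check_matrix_def m by blast+
  have "dual_code n C = vec_space.row_space n H" using assms unfolding parity_check_matrix_def by blast
  also have "\<dots> = (*\<^sub>v) (transpose_mat H) ` carrier_vec m"
    unfolding vec_space.row_space_eq[OF H] using H by auto
  finally show "dual_code n C = (*\<^sub>v) (transpose_mat H) ` carrier_vec m" .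
qed

text \<open>The matrix has n - k rows and a kernel with q^k elements, so counting makes it
  surjective; its transpose is then injective.\<close>

lemma parity_check_transpose_inj:
  assumes H: "parity_check_matrix n C H"
  shows "inj_on ((*\<^sub>v) (transpose_mat H)) (carrier_vec m)"
proof (rule mult_mat_vec_inj)
  note H' = parity_check_dual[OF H]
  show Ht: "transpose_mat H \<in> carrier_mat n m" using H' by simp
  have "card ((*\<^sub>v) H ` carrier_vec n) * CARD('a) ^ code_dim n C = CARD('a) ^ m * CARD('a) ^ code_dim n C"
    using card_image_mult_card_kernel[OF H'(1)] code_dim_le
    unfolding H'(2)[symmetric] card_eq_power_code_dim[OF C] by (simp add: m power_add[symmetric])
  hence "card ((*\<^sub>v) H ` carrier_vec n) = card (carrier_vec m :: 'a vec set)"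
    by (simp add: card_carrier_vec)
  hence surj: "(*\<^sub>v) H ` carrier_vec n = carrier_vec m"
    using H' by (intro card_subset_eq) auto
  show "u = 0\<^sub>v m" if "u \<in> carrier_vec m" "transpose_mat H *\<^sub>v u = 0\<^sub>v n" for u
    by (rule transpose_inj_of_surj[OF H'(1) surj that])
qed

text \<open>The transpose of \<open>G\<close> carries this kernel bijectively onto the hull: its
  values are the dual words, and being killed by \<open>H\<close> means lying in
  \<open>C\<close>.\<close>

lemma card_kernel_gram:
  assumes H: "parity_check_matrix n C H" and G: "parity_check_matrix n C G"
  shows "card (mat_kernel (H * transpose_mat G)) = card (C \<inter> dual_code n C)"
proof -
  note H' = parity_check_dual[OF H] and G' = parity_check_dual[OF G]
  have Gt: "transpose_mat G \<in> carrier_mat n m" using G' by simp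
  have HG: "H * transpose_mat G \<in> carrier_mat m m" using H' Gt by simp
  have ker: "mat_kernel (H * transpose_mat G) = {v \<in> carrier_vec m. transpose_mat G *\<^sub>v v \<in> C}"
    unfolding H'(2) mat_kernel[OF HG] mat_kernel[OF H'(1)]
    using assoc_mult_mat_vec[OF H'(1) Gt] Gt by auto
  have "(*\<^sub>v) (transpose_mat G) ` mat_kernel (H * transpose_mat G) = C \<inter> dual_code n C"
    unfolding ker G'(3) by auto
  moreover have "inj_on ((*\<^sub>v) (transpose_mat G)) (mat_kernel (H * transpose_mat G))"
    using parity_check_transpose_inj[OF G] by (rule inj_on_subset) (auto simp: ker)
  ultimately show ?thesis using card_image by fastforce
qed

lemma card_image_gram:
  assumes H: "parity_check_matrix n C H" and G: "parity_check_matrix n C G"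
  shows "card ((*\<^sub>v) (H * transpose_mat G) ` carrier_vec m) * card (C \<inter> dual_code n C) = CARD('a) ^ m"
proof -
  have "H * transpose_mat G \<in> carrier_mat m m"
    using parity_check_dual(1)[OF H] parity_check_dual(1)[OF G] by simp
  from card_image_mult_card_kernel[OF this] show ?thesis by (simp add: card_kernel_gram[OF H G])
qed

text \<open>On vectors that vanish on Bob's side the factor \<open>F\<close> is invisible, and what
  remains are the parity checks of the code.\<close>

lemma code_as_orthogonal:
  assumes H: "parity_check_matrix n C H" and F: "F \<in> carrier_mat m c"
  shows "{v \<in> vecs (reg_Q n). \<forall>z\<in>row_vecs n c m H F. fdot (reg n c) z v = 0} = (\<lambda>x. join n c x (0\<^sub>v c)) ` C"
proof -
  note H' = parity_check_dual[OF H]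
  have Ft: "transpose_mat F \<in> carrier_mat c m" using F by simp
  have CC: "C \<subseteq> carrier_vec n" by (rule subspaceD(1)[OF C])
  have dot: "fdot (reg n c) (join n c (transpose_mat H *\<^sub>v u) (transpose_mat F *\<^sub>v u)) (join n c x (0\<^sub>v c)) = u \<bullet> (H *\<^sub>v x)"
    if x: "x \<in> carrier_vec n" and u: "u \<in> carrier_vec m" for x u
  proof -
    have "transpose_mat F *\<^sub>v u \<in> carrier_vec c" using Ft u by auto
    thus ?thesis by (simp add: fdot_join[OF x zero_carrier_vec] transpose_vec_mult_scalar[OF H'(1) x u])
  qed
  have iff: "(\<forall>z\<in>row_vecs n c m H F. fdot (reg n c) z (join n c x (0\<^sub>v c)) = 0) \<longleftrightarrow> x \<in> C"
    if x: "x \<in> carrier_vec n" for x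
  proof
    assume *: "\<forall>z\<in>row_vecs n c m H F. fdot (reg n c) z (join n c x (0\<^sub>v c)) = 0"
    have z: "u \<bullet> (H *\<^sub>v x) = 0" if u: "u \<in> carrier_vec m" for u
      using * u dot[OF x u] by (auto simp: row_vecs_def)
    have Hx: "H *\<^sub>v x \<in> carrier_vec m" using H'(1) x by auto
    have "(H *\<^sub>v x) $ j = 0" if "j < m" for j
      using z[of "unit_vec m j"] scalar_prod_left_unit[OF Hx that] by simp
    hence "H *\<^sub>v x = 0\<^sub>v m" using H'(1) by (intro eq_vecI) auto
    thus "x \<in> C" unfolding H'(2) using x by (simp add: mat_kernel[OF H'(1)])
  next
    assume "x \<in> C"
    hence "H *\<^sub>v x = 0\<^sub>v m" unfolding H'(2) by (simp add: mat_kernel[OF H'(1)])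
    thus "\<forall>z\<in>row_vecs n c m H F. fdot (reg n c) z (join n c x (0\<^sub>v c)) = 0"
      using dot[OF x] by (auto simp: row_vecs_def)
  qed
  have Q: "v = join n c (vec n (\<lambda>i. v (Inl i))) (0\<^sub>v c)" if "v \<in> vecs (reg_Q n)" for v :: "site \<Rightarrow> 'a"
  proof
    fix s show "v s = join n c (vec n (\<lambda>i. v (Inl i))) (0\<^sub>v c) s"
      using that by (cases s) (auto simp: vecs_def)
  qed
  show ?thesis
  proof (intro equalityI subsetI)
    fix v assume "v \<in> {v \<in> vecs (reg_Q n). \<forall>z\<in>row_vecs n c m H F. fdot (reg n c) z v = 0}"
    hence v: "v \<in> vecs (reg_Q n)" "\<forall>z\<in>row_vecs n c m H F. fdot (reg n c) z v = 0" by auto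
    let ?x = "vec n (\<lambda>i. v (Inl i))"
    have "?x \<in> C" using v(2) iff[of ?x] Q[OF v(1)] by simp
    thus "v \<in> (\<lambda>x. join n c x (0\<^sub>v c)) ` C" using Q[OF v(1)] by (rule_tac image_eqI)
  next
    fix v assume "v \<in> (\<lambda>x. join n c x (0\<^sub>v c)) ` C"
    then obtain x where x: "x \<in> C" "v = join n c x (0\<^sub>v c)" by auto
    have "v \<in> vecs (reg_Q n)" unfolding x(2) by (simp add: join_vecs_Q_iff)
    thus "v \<in> {v \<in> vecs (reg_Q n). \<forall>z\<in>row_vecs n c m H F. fdot (reg n c) z v = 0}"
      using iff[of x] x CC by auto
  qed
qed

text \<open>Being trivial on Bob's side means that \<open>F\<close> transposed kills
  \<open>u\<close>. Injectivity of \<open>F'\<close> turns this into a condition on the product of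
  the factors, that is, into the parity checks \<open>G\<close> for the dual word generated by
  \<open>u\<close>.\<close>

lemma hull_as_stabilizer:
  assumes H: "parity_check_matrix n C H" and G: "parity_check_matrix n C G"
    and F: "F \<in> carrier_mat m c" and F': "F' \<in> carrier_mat m c"
    and eq: "- (G * transpose_mat H) = F' * transpose_mat F" and inj: "inj_on ((*\<^sub>v) F') (carrier_vec c)"
  shows "row_vecs n c m H F \<inter> vecs (reg_Q n) = (\<lambda>x. join n c x (0\<^sub>v c)) ` (C \<inter> dual_code n C)"
proof -
  note H' = parity_check_dual[OF H] and G' = parity_check_dual[OF G]
  have Ht: "transpose_mat H \<in> carrier_mat n m" and Ft: "transpose_mat F \<in> carrier_mat c m" using H' F by auto
  have GH: "G * transpose_mat H \<in> carrier_mat m m" using G' Ht by simp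
  have iff: "transpose_mat F *\<^sub>v u = 0\<^sub>v c \<longleftrightarrow> transpose_mat H *\<^sub>v u \<in> C" if u: "u \<in> carrier_vec m" for u
  proof -
    have Fu: "transpose_mat F *\<^sub>v u \<in> carrier_vec c" using Ft u by auto
    have Hu: "transpose_mat H *\<^sub>v u \<in> carrier_vec n" using Ht u by auto
    have F'0: "F' *\<^sub>v 0\<^sub>v c = 0\<^sub>v m" using F' by (auto intro!: eq_vecI)
    have "F' *\<^sub>v (transpose_mat F *\<^sub>v u) = - (G *\<^sub>v (transpose_mat H *\<^sub>v u))"
      unfolding assoc_mult_mat_vec[OF F' Ft u, symmetric] assoc_mult_mat_vec[OF G'(1) Ht u, symmetric] eq[symmetric]
      by (rule uminus_mult_mat_vec) (simp only: carrier_matD(2)[OF GH] carrier_vecD[OF u])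
    moreover have "transpose_mat F *\<^sub>v u = 0\<^sub>v c \<longleftrightarrow> F' *\<^sub>v (transpose_mat F *\<^sub>v u) = 0\<^sub>v m"
      using inj_onD[OF inj _ Fu zero_carrier_vec] F'0 by auto
    moreover have "- (G *\<^sub>v (transpose_mat H *\<^sub>v u)) = 0\<^sub>v m \<longleftrightarrow> G *\<^sub>v (transpose_mat H *\<^sub>v u) = 0\<^sub>v m"
      using G'(1) Hu by (auto simp: vec_eq_iff)
    ultimately show ?thesis unfolding G'(2) using Hu by (simp add: mat_kernel[OF G'(1)])
  qed
  show ?thesis
  proof (intro equalityI subsetI)
    fix v assume "v \<in> row_vecs n c m H F \<inter> vecs (reg_Q n)"
    then obtain u where u: "u \<in> carrier_vec m" "v = join n c (transpose_mat H *\<^sub>v u) (transpose_mat F *\<^sub>v u)"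
      and vQ: "v \<in> vecs (reg_Q n)" by (auto simp: row_vecs_def)
    have Fu: "transpose_mat F *\<^sub>v u \<in> carrier_vec c" using Ft u by auto
    have F0: "transpose_mat F *\<^sub>v u = 0\<^sub>v c" using vQ unfolding u(2) join_vecs_Q_iff[OF Fu] .
    hence "transpose_mat H *\<^sub>v u \<in> C" using iff[OF u(1)] by simp
    moreover have "transpose_mat H *\<^sub>v u \<in> dual_code n C" unfolding H'(3) using u(1) by simp
    ultimately show "v \<in> (\<lambda>x. join n c x (0\<^sub>v c)) ` (C \<inter> dual_code n C)" unfolding u(2) F0 by blast
  next
    fix v assume "v \<in> (\<lambda>x. join n c x (0\<^sub>v c)) ` (C \<inter> dual_code n C)"
    then obtain x where x: "x \<in> C" "x \<in> dual_code n C" "v = join n c x (0\<^sub>v c)" by auto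
    obtain u where u: "u \<in> carrier_vec m" "x = transpose_mat H *\<^sub>v u" using x(2) unfolding H'(3) by auto
    have F0: "transpose_mat F *\<^sub>v u = 0\<^sub>v c" using iff[OF u(1)] x(1) u(2) by simp
    have "v = join n c (transpose_mat H *\<^sub>v u) (transpose_mat F *\<^sub>v u)" unfolding F0 x(3) u(2) ..
    hence "v \<in> row_vecs n c m H F" using u(1) by (auto simp: row_vecs_def)
    moreover have "v \<in> vecs (reg_Q n)" unfolding x(3) by (simp add: join_vecs_Q_iff)
    ultimately show "v \<in> row_vecs n c m H F \<inter> vecs (reg_Q n)" by (rule IntI)
  qed
qed

text \<open>The two registers contribute opposite values, by the minus sign in the factorization.
  This is the commutation of the stabilizer elements.\<close>

lemma row_vecs_orthogonal:
  assumes H: "H \<in> carrier_mat m n" and G: "G \<in> carrier_mat m n"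
    and F: "F \<in> carrier_mat m c" and F': "F' \<in> carrier_mat m c"
    and eq: "- (G * transpose_mat H) = F' * transpose_mat F"
    and t: "t \<in> row_vecs n c m H F" and z: "z \<in> row_vecs n c m G F'"
  shows "fdot (reg n c) z t = 0"
proof -
  obtain u where u: "u \<in> carrier_vec m" "t = join n c (transpose_mat H *\<^sub>v u) (transpose_mat F *\<^sub>v u)"
    using t by (auto simp: row_vecs_def)
  obtain v where v: "v \<in> carrier_vec m" "z = join n c (transpose_mat G *\<^sub>v v) (transpose_mat F' *\<^sub>v v)"
    using z by (auto simp: row_vecs_def)
  have Ht: "transpose_mat H \<in> carrier_mat n m" and Ft: "transpose_mat F \<in> carrier_mat c m" using H F by auto
  have Hu: "transpose_mat H *\<^sub>v u \<in> carrier_vec n" and Fu: "transpose_mat F *\<^sub>v u \<in> carrier_vec c" using Ht Ft u by auto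
  have GH: "G * transpose_mat H \<in> carrier_mat m m" using G Ht by simp
  let ?y = "(G * transpose_mat H) *\<^sub>v u"
  have y: "?y \<in> carrier_vec m" using GH u by auto
  have "fdot (reg n c) z t = v \<bullet> (G *\<^sub>v (transpose_mat H *\<^sub>v u)) + v \<bullet> (F' *\<^sub>v (transpose_mat F *\<^sub>v u))"
    unfolding u(2) v(2) fdot_join[OF Hu Fu] transpose_vec_mult_scalar[OF G Hu v(1)] transpose_vec_mult_scalar[OF F' Fu v(1)] ..
  also have "G *\<^sub>v (transpose_mat H *\<^sub>v u) = ?y" by (rule assoc_mult_mat_vec[OF G Ht u(1), symmetric])
  also have "F' *\<^sub>v (transpose_mat F *\<^sub>v u) = - ?y"
    unfolding assoc_mult_mat_vec[OF F' Ft u(1), symmetric] eq[symmetric]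
    by (rule uminus_mult_mat_vec) (simp only: carrier_matD(2)[OF GH] carrier_vecD[OF u(1)])
  also have "v \<bullet> ?y + v \<bullet> (- ?y) = 0"
    using carrier_vecD[OF v(1)] carrier_vecD[OF y] by (metis scalar_prod_uminus_right add.right_inverse)
  finally show ?thesis .
qed

lemma row_vecs_onto_B:
  assumes H: "H \<in> carrier_mat m n" and F: "F \<in> carrier_mat m c"
    and onto: "(*\<^sub>v) (transpose_mat F) ` carrier_vec m = carrier_vec c" and w: "w \<in> vecs (reg_B c)"
  shows "\<exists>t\<in>row_vecs n c m H F. cut (reg_B c) t = w"
proof -
  have "vec c (\<lambda>j. w (Inr j)) \<in> (*\<^sub>v) (transpose_mat F) ` carrier_vec m" unfolding onto by simp
  then obtain u where u: "u \<in> carrier_vec m" "transpose_mat F *\<^sub>v u = vec c (\<lambda>j. w (Inr j))" by (metis imageE)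
  let ?t = "join n c (transpose_mat H *\<^sub>v u) (transpose_mat F *\<^sub>v u)"
  have "cut (reg_B c) ?t = w"
  proof
    fix s show "cut (reg_B c) ?t s = w s"
      using w unfolding u(2) by (cases s) (auto simp: cut_def vecs_def)
  qed
  moreover have "?t \<in> row_vecs n c m H F" using u(1) by (auto simp: row_vecs_def)
  ultimately show ?thesis by blast
qed
end

section \<open>Locality and distance\<close>

text \<open>One inclusion is clear, and both sides have the same cardinality by
  \<open>card_perp\<close>.\<close>

lemma perp_perp:
  fixes M :: "('s \<Rightarrow> 'a::{field,finite}) set"
  assumes "finite A" "linear_set M" "M \<subseteq> vecs A"
  shows "perp A (perp A M) = M"
proof -
  have sub: "M \<subseteq> perp A (perp A M)"
    using assms(3) by (auto simp: perp_def fdot_commute)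
  have pv: "perp A N \<subseteq> vecs A" for N :: "('s \<Rightarrow> 'a) set" by (auto simp: perp_def)
  have "card M * card (perp A M) = card (perp A (perp A M)) * card (perp A M)"
    using card_perp[OF assms] card_perp[OF assms(1) linear_set_perp pv, of M] by (simp add: mult.commute)
  moreover have "card (perp A M) > 0"
    using linear_setD(1)[OF linear_set_perp, of A M] finite_subset[OF pv finite_vecs[OF assms(1)]] card_gt_0_iff by blast
  ultimately have "card M = card (perp A (perp A M))" by simp
  thus ?thesis using card_subset_eq[OF finite_subset[OF pv finite_vecs[OF assms(1)]] sub] by simp
qed

text \<open>If no dual word supported on \<open>insert i R\<close> involved \<open>i\<close>, biduality would put the unit vector
  at \<open>i\<close> into the restricted code, so the entries on \<open>R\<close> could not determine the entry at \<open>i\<close>.\<close>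

lemma local_dual_word:
  fixes C :: "'a::{field,finite} vec set"
  assumes C: "VectorSpace.subspace class_ring C (module_vec TYPE('a) n)" and i: "i < n"
    and js: "set js \<subseteq> {..<n} - {i}" and f: "\<forall>w\<in>C. w $ i = f (map (($) w) js)"
  shows "\<exists>h\<in>dual_code n C. h $ i \<noteq> 0 \<and> (\<forall>j<n. j \<notin> insert i (set js) \<longrightarrow> h $ j = 0)"
proof -
  let ?S = "insert i (set js)"
  have S: "?S \<subseteq> {..<n}" using i js by auto
  have CC: "C \<subseteq> carrier_vec n" by (rule subspaceD(1)[OF C])
  define M where "M = (\<lambda>w. cut ?S (($) w)) ` C"
  have Mv: "M \<subseteq> vecs ?S" by (auto simp: M_def)
  have lin: "linear_set M"
    unfolding linear_set_def
  proof (intro conjI ballI allI)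
    have "cut ?S (($) (0\<^sub>v n)) = 0" using S by (auto simp: cut_def fun_eq_iff)
    thus "0 \<in> M" using subspaceD(2)[OF C] by (auto simp: M_def intro!: image_eqI[of _ _ "0\<^sub>v n"])
    fix x assume "x \<in> M"
    then obtain w where w: "w \<in> C" "x = cut ?S (($) w)" by (auto simp: M_def)
    have wn: "w \<in> carrier_vec n" using w CC by auto
    show "(\<lambda>s. a * x s) \<in> M" for a
    proof -
      have "(\<lambda>s. a * x s) = cut ?S (($) (a \<cdot>\<^sub>v w))" unfolding w(2) using wn S by (auto simp: cut_def fun_eq_iff)
      thus ?thesis using subspaceD(4)[OF C w(1)] by (auto simp: M_def)
    qed
    fix y assume "y \<in> M"
    then obtain w' where w': "w' \<in> C" "y = cut ?S (($) w')" by (auto simp: M_def)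
    have wn': "w' \<in> carrier_vec n" using w' CC by auto
    have "w + (- 1) \<cdot>\<^sub>v w' \<in> C" using subspaceD(3)[OF C w(1) subspaceD(4)[OF C w'(1)]] .
    moreover have "x - y = cut ?S (($) (w + (- 1) \<cdot>\<^sub>v w'))"
      unfolding w(2) w'(2) using wn wn' S by (auto simp: cut_def fun_eq_iff)
    ultimately show "x - y \<in> M" by (auto simp: M_def)
  qed
  have "\<exists>b\<in>perp ?S M. b i \<noteq> 0"
  proof (rule ccontr)
    assume *: "\<not> ?thesis"
    define e :: "nat \<Rightarrow> 'a" where "e = (\<lambda>j. of_bool (j = i))"
    have "fdot ?S b e = b i" for b
      by (simp add: fdot_def e_def of_bool_def if_distrib[of "\<lambda>t. _ * t"] cong: if_cong)
    moreover have "e \<in> vecs ?S" by (auto simp: e_def vecs_def)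
    ultimately have "e \<in> perp ?S (perp ?S M)" using * by (auto simp: perp_def)
    hence "e \<in> M" using perp_perp[OF _ lin Mv] by simp
    then obtain w where w: "w \<in> C" "e = cut ?S (($) w)" by (auto simp: M_def)
    have ws: "w $ j = e j" if "j \<in> ?S" for j using fun_cong[OF w(2), of j] that by (simp add: cut_def)
    \<comment> \<open>This codeword and the zero word agree on \<open>js\<close>, so
      \<open>f\<close> would have to return both 1 and 0 at position \<open>i\<close>.\<close>
    have "map (($) w) js = map (($) (0\<^sub>v n)) js"
      using ws js by (auto simp: e_def)
    hence "w $ i = 0\<^sub>v n $ i" using f w(1) subspaceD(2)[OF C] by metis
    thus False using ws[of i] i by (simp add: e_def)
  qed
  then obtain b where b: "b \<in> perp ?S M" "b i \<noteq> 0" by blast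
  have bv: "b j = 0" if "j \<notin> ?S" for j using b(1) that by (auto simp: perp_def vecs_def)
  have "vec n b \<bullet> w = 0" if w: "w \<in> C" for w
  proof -
    have wn: "dim_vec w = n" using w CC by auto
    have "vec n b \<bullet> w = (\<Sum>j<n. b j * w $ j)" by (simp add: scalar_prod_def wn atLeast0LessThan)
    also have "\<dots> = (\<Sum>j\<in>?S. b j * w $ j)" using S bv by (intro sum.mono_neutral_right) auto
    also have "\<dots> = fdot ?S (cut ?S (($) w)) b" by (simp add: fdot_def cut_def mult.commute)
    also have "\<dots> = 0" using b(1) w by (auto simp: perp_def M_def)
    finally show ?thesis .
  qed
  hence "vec n b \<in> dual_code n C" by (simp add: dual_code_def)
  thus ?thesis using b(2) bv i by (intro bexI[of _ "vec n b"]) auto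
qed

lemma low_weight_codeword_in_dual:
  fixes C :: "'a::{field,finite} vec set"
  assumes CC: "C \<subseteq> carrier_vec n" and x: "x \<in> C"
    and weight: "hamming_weight x \<le> (if C \<subseteq> dual_code n C then d else wt (C - (C \<inter> dual_code n C))) - 1"
  shows "x \<in> dual_code n C"
proof (rule ccontr)
  assume nd: "x \<notin> dual_code n C"
  hence nsub: "\<not> C \<subseteq> dual_code n C" using x by blast
  let ?S = "C - (C \<inter> dual_code n C)"
  have xn: "x \<in> carrier_vec n" using x CC by auto
  have "0\<^sub>v n \<in> dual_code n C" using CC by (auto simp: dual_code_def)
  hence x0: "x \<noteq> 0\<^sub>v n" using nd by auto
  have fin: "finite {hamming_weight x |x. x \<in> ?S \<and> x \<noteq> 0\<^sub>v (dim_vec x)}"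
    using finite_subset[OF CC finite_carrier_vec] by simp
  have "wt ?S \<le> hamming_weight x"
    unfolding wt_def using x nd x0 xn by (intro Min_le fin) auto
  \<comment> \<open>Subtraction on naturals truncates: without a positive weight, the bound by
    \<open>wt\<close> minus 1 would not contradict minimality.\<close>
  moreover have "hamming_weight x > 0"
  proof -
    obtain j where "j < n" "x $ j \<noteq> 0" using x0 xn by (metis carrier_vecD eq_vecI index_zero_vec(1) index_zero_vec(2))
    thus ?thesis using xn by (auto simp: hamming_weight_def card_gt_0_iff)
  qed
  ultimately show False using weight nsub by simp
qed

lemma on_subregister_full:
  assumes "\<rho> \<in> opers (labels A)" "\<Phi> \<rho> \<in> opers (labels A)"
  shows "on_subregister A A \<Phi> \<rho> = \<Phi> \<rho>"
proof (intro ext)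
  fix x y
  have ov: "override_on z z' A = z'" if "z \<in> labels A" "z' \<in> labels A" for z z' :: "'a \<Rightarrow> 'b"
    using that by (auto simp: labels_def override_on_def PiE_def extensional_def fun_eq_iff)
  have re: "restrict z A = z" if "z \<in> labels A" for z :: "'a \<Rightarrow> 'b"
    using that by (simp add: labels_def)
  show "on_subregister A A \<Phi> \<rho> x y = \<Phi> \<rho> x y"
  proof (cases "x \<in> labels A \<and> y \<in> labels A")
    case True
    have "(\<lambda>x' y'. if x' \<in> labels A \<and> y' \<in> labels A then \<rho> (override_on x x' A) (override_on y y' A) else 0) = \<rho>"
      using assms(1) True ov by (intro ext) (simp add: opers_def)
    thus ?thesis using True re by (simp add: on_subregister_def)
  next
    case False
    thus ?thesis using assms(2) by (auto simp: on_subregister_def opers_def)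
  qed
qed

lemma erasure_opers: "E \<subseteq> A \<Longrightarrow> erasure A E \<rho> \<in> opers (labels A)"
  by (auto simp: erasure_def op_tensor_def opers_def Un_absorb1)

text \<open>The distance enters through \<open>low\<close> alone: an undetected error on at most
  \<open>\<delta> - 1\<close> transmitted qudits is a codeword of at most that weight. The case
  distinction defining \<delta> is thus kept apart from the quantum part.\<close>

theorem eacss_code_is_eaqlrc:
  fixes C :: "'a::{field,finite} vec set" and \<Q> :: "(site \<Rightarrow> 'a) state set"
  assumes C: "VectorSpace.subspace class_ring C (module_vec TYPE('a) n)"
    and k: "code_dim n C = k" and l: "code_dim n (C \<inter> dual_code n C) = l"
    and loc: "has_locality n C r" and code: "eacss_code n C C \<Q>"
    and low: "\<And>x. x \<in> C \<Longrightarrow> hamming_weight x \<le> \<delta> - 1 \<Longrightarrow> x \<in> dual_code n C"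
  shows "eaqlrc n (k - l) \<delta> (n - k - l) r \<Q>"
proof -
  define m where "m = n - code_dim n C"
  obtain HX HZ FX FZ c where HX: "parity_check_matrix n C HX" and HZ: "parity_check_matrix n C HZ"
    and c: "c = vec_space.rank m (HX * transpose_mat HZ)"
    and FX: "FX \<in> carrier_mat m c" and FZ: "FZ \<in> carrier_mat m c"
    and eq: "- (HX * transpose_mat HZ) = FX * transpose_mat FZ"
    and \<Q>: "\<Q> = {\<psi> \<in> states (labels (reg n c)).
              \<forall>u \<in> carrier_vec m. \<forall>v \<in> carrier_vec m.
                op_apply (labels (reg n c)) (eacss_stabilizer n c HX HZ FX FZ u v) \<psi> = \<psi>}"
    using code unfolding eacss_code_def m_def by blast
  let ?D = "dual_code n C"
  have CC: "C \<subseteq> carrier_vec n" by (rule subspaceD(1)[OF C])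
  have sub_hull: "VectorSpace.subspace class_ring (C \<inter> ?D) (module_vec TYPE('a) n)"
    by (rule subspace_Int[OF C dual_code_subspace[OF CC]])
  have card_C: "card C = CARD('a) ^ k" using card_eq_power_code_dim[OF C] k by simp
  have card_hull: "card (C \<inter> ?D) = CARD('a) ^ l" using card_eq_power_code_dim[OF sub_hull] l by simp
  have "card (C \<inter> ?D) \<le> card C" using finite_subset[OF CC finite_carrier_vec] by (intro card_mono) auto
  hence lk: "l \<le> k" unfolding card_C card_hull CARD_power_le_iff .
  have kn: "k \<le> n" using code_dim_le[OF C] k by simp
  note HX' = parity_check_dual[OF C m_def HX] and HZ' = parity_check_dual[OF C m_def HZ]
  have HXZ: "HX * transpose_mat HZ \<in> carrier_mat m m" and HZX: "HZ * transpose_mat HX \<in> carrier_mat m m"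
    using HX' HZ' by simp_all
  have card_XZ: "card ((*\<^sub>v) (HX * transpose_mat HZ) ` carrier_vec m) = CARD('a) ^ c"
    unfolding c by (rule card_image_eq_power_rank[OF HXZ])
  have "CARD('a) ^ (c + l) = CARD('a) ^ m"
    using card_image_gram[OF C m_def HX HZ] unfolding card_XZ card_hull by (simp add: power_add)
  \<comment> \<open>The Gram matrix has q^c values and its kernel has the size of the hull, which
    fixes the number of entangled pairs.\<close>
  hence cl: "c + l = m" unfolding CARD_power_eq_iff .
  have c_eq: "c = n - k - l" using cl by (simp add: m_def k)
  have "card ((*\<^sub>v) (HZ * transpose_mat HX) ` carrier_vec m) * CARD('a) ^ l = CARD('a) ^ c * CARD('a) ^ l"
    using card_image_gram[OF C m_def HZ HX] unfolding card_hull by (simp add: power_add[symmetric] cl)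
  hence card_ZX: "card ((*\<^sub>v) (HZ * transpose_mat HX) ` carrier_vec m) = CARD('a) ^ c" by simp
  \<comment> \<open>The transposed factorization, so that the roles of shifts and phases can be
    exchanged.\<close>
  have eq': "- (HZ * transpose_mat HX) = FZ * transpose_mat FX"
  proof -
    have "transpose_mat (- (HX * transpose_mat HZ)) = transpose_mat (FX * transpose_mat FZ)" using eq by simp
    thus ?thesis using HX'(1) HZ'(1) FX FZ
      by (simp add: transpose_uminus transpose_mult[of _ m n _ m] transpose_mult[of _ m c _ m])
  qed
  \<comment> \<open>The factorization is that of the negated Gram matrix, so the rank must be
    carried across the sign.\<close>
  have uminus_card: "card ((*\<^sub>v) (- M) ` carrier_vec m) = card ((*\<^sub>v) M ` carrier_vec m)"
    if M: "M \<in> carrier_mat m m" for M :: "'a mat"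
  proof -
    have "(*\<^sub>v) (- M) ` carrier_vec m = uminus ` ((*\<^sub>v) M ` carrier_vec m)"
      unfolding image_image using M by (intro image_cong refl uminus_mult_mat_vec) auto
    moreover have "inj_on uminus ((*\<^sub>v) M ` carrier_vec m)"
      by (rule inj_on_inverseI[of _ uminus]) (auto intro!: eq_vecI)
    ultimately show ?thesis by (simp add: card_image)
  qed
  have invX: "inj_on ((*\<^sub>v) FX) (carrier_vec c)" and ontoZ: "(*\<^sub>v) (transpose_mat FZ) ` carrier_vec m = carrier_vec c"
    using rank_factor_full_rank[OF FX FZ] uminus_card[OF HXZ] card_XZ unfolding eq[symmetric] by simp_all
  have invZ: "inj_on ((*\<^sub>v) FZ) (carrier_vec c)" and ontoX: "(*\<^sub>v) (transpose_mat FX) ` carrier_vec m = carrier_vec c"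
    using rank_factor_full_rank[OF FZ FX] uminus_card[OF HZX] card_ZX unfolding eq'[symmetric] by simp_all
  define TX where "TX = row_vecs n c m HX FX"
  define TZ where "TZ = row_vecs n c m HZ FZ"
  let ?A = "reg n c"
  let ?J = "\<lambda>x :: 'a vec. join n c x (0\<^sub>v c)"
  have linX: "linear_set TX" unfolding TX_def by (rule linear_row_vecs[OF HX'(1) FX])
  have linZ: "linear_set TZ" unfolding TZ_def by (rule linear_row_vecs[OF HZ'(1) FZ])
  have TXv: "TX \<subseteq> vecs ?A" and TZv: "TZ \<subseteq> vecs ?A" unfolding TX_def TZ_def by (rule row_vecs_vecs)+
  have orth: "fdot ?A z t = 0" if "t \<in> TX" "z \<in> TZ" for t z
    using row_vecs_orthogonal[OF C m_def HX'(1) HZ'(1) FX FZ eq'] that unfolding TX_def TZ_def by blast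
  have WZ: "{v \<in> vecs (reg_Q n). \<forall>z\<in>TZ. fdot ?A z v = 0} = ?J ` C"
    unfolding TZ_def by (rule code_as_orthogonal[OF C m_def HZ FZ])
  have WX: "{v \<in> vecs (reg_Q n). \<forall>z\<in>TX. fdot ?A z v = 0} = ?J ` C"
    unfolding TX_def by (rule code_as_orthogonal[OF C m_def HX FX])
  have hullX: "TX \<inter> vecs (reg_Q n) = ?J ` (C \<inter> ?D)"
    unfolding TX_def by (rule hull_as_stabilizer[OF C m_def HX HZ FX FZ eq' invZ])
  have hullZ: "TZ \<inter> vecs (reg_Q n) = ?J ` (C \<inter> ?D)"
    unfolding TZ_def by (rule hull_as_stabilizer[OF C m_def HZ HX FZ FX eq invX])
  have injJ: "inj_on ?J (carrier_vec n)" by (auto intro!: inj_onI dest: join_inj(1))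
  have cardJ: "card (?J ` B) = card B" if "B \<subseteq> C" for B
    using that CC by (intro card_image inj_on_subset[OF injJ]) auto
  interpret iso: ea_css n "k - l" c l TX TZ
  proof
    show "card {v \<in> vecs (reg_Q n). \<forall>z\<in>TZ. fdot ?A z v = 0} = CARD('a) ^ (k - l + l)"
      unfolding WZ using lk by (simp add: cardJ card_C)
    show "card (TX \<inter> vecs (reg_Q n)) = CARD('a) ^ l" unfolding hullX by (simp add: cardJ card_hull)
    show "k - l + c \<le> n" using c_eq lk kn by simp
    show "\<exists>t\<in>TX. cut (reg_B c) t = w" if "w \<in> vecs (reg_B c)" for w
      unfolding TX_def by (rule row_vecs_onto_B[OF C m_def HX'(1) FX ontoX that])
    show "\<exists>t\<in>TZ. cut (reg_B c) t = w" if "w \<in> vecs (reg_B c)" for w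
      unfolding TZ_def by (rule row_vecs_onto_B[OF C m_def HZ'(1) FZ ontoZ that])
  qed (use linX linZ TXv TZv orth in auto)
  have \<Q>_css: "\<Q> = css_space ?A TX TZ"
    unfolding \<Q> TX_def TZ_def by (rule stabilized_eq_css_space[OF HX'(1) FX HZ'(1) FZ])
  have recovery: "\<exists>\<Phi>. quantum_channel (labels S) \<Phi> \<and>
      (\<forall>\<psi>\<in>\<Q>. on_subregister ?A S \<Phi> (erasure ?A E (proj_op \<psi>)) = proj_op \<psi>)"
    if "css_recovery ?A S E TX TZ" for S E
  proof -
    interpret css_recovery ?A S E TX TZ by (rule that)
    show ?thesis using recovery_channel_exists unfolding \<Q>_css css_space_def by blast
  qed
  have global: "css_recovery ?A ?A (Inl ` E) TX TZ" if E: "E \<subseteq> {..<n}" "card E \<le> \<delta> - 1" for E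
  proof
    have fE: "finite E" using E(1) finite_subset by blast
    have EQ: "vecs (Inl ` E) \<subseteq> (vecs (reg_Q n) :: (site \<Rightarrow> 'a) set)"
      using E(1) by (intro vecs_mono) (auto simp: reg_Q_def)
    have light: "x \<in> C \<inter> ?D" if x: "x \<in> C" and J: "?J x \<in> vecs (Inl ` E)" for x
    proof -
      have "{i. i < dim_vec x \<and> x $ i \<noteq> 0} \<subseteq> E"
      proof
        fix i assume i: "i \<in> {i. i < dim_vec x \<and> x $ i \<noteq> 0}"
        hence "?J x (Inl i) \<noteq> 0" using x CC by auto
        hence "Inl i \<in> Inl ` E" using J unfolding vecs_def by blast
        thus "i \<in> E" by auto
      qed
      hence "hamming_weight x \<le> card E" unfolding hamming_weight_def by (intro card_mono fE)
      thus ?thesis using low[OF x] x E(2) by simp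
    qed
    show "Inl ` E \<subseteq> ?A" using E(1) by auto
    show "a \<in> TX" if a: "a \<in> vecs (Inl ` E)" and z: "\<And>z. z \<in> TZ \<Longrightarrow> z \<in> vecs ?A \<Longrightarrow> fdot ?A z a = 0" for a
    proof -
      have "a \<in> ?J ` C" unfolding WZ[symmetric] using a EQ z TZv by blast
      then obtain x where "x \<in> C" "a = ?J x" by auto
      hence "a \<in> ?J ` (C \<inter> ?D)" using light a by blast
      thus ?thesis unfolding hullX[symmetric] by blast
    qed
    show "a \<in> TZ" if a: "a \<in> vecs (Inl ` E)" and z: "\<And>z. z \<in> TX \<Longrightarrow> z \<in> vecs ?A \<Longrightarrow> fdot ?A z a = 0" for a
    proof -
      have "a \<in> ?J ` C" unfolding WX[symmetric] using a EQ z TXv by blast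
      then obtain x where "x \<in> C" "a = ?J x" by auto
      hence "a \<in> ?J ` (C \<inter> ?D)" using light a by blast
      thus ?thesis unfolding hullZ[symmetric] by blast
    qed
  qed (use linX linZ TXv TZv orth in auto)
  have corrects: "corrects_erasure n c \<Q> E" if E: "E \<subseteq> {..<n}" "card E \<le> \<delta> - 1" for E
  proof -
    obtain \<Phi> where \<Phi>: "quantum_channel (labels ?A) \<Phi>"
      "\<forall>\<psi>\<in>\<Q>. on_subregister ?A ?A \<Phi> (erasure ?A (Inl ` E) (proj_op \<psi>)) = proj_op \<psi>"
      using recovery[OF global[OF E]] by blast
    have er: "erasure ?A (Inl ` E) \<rho> \<in> opers (labels ?A)" for \<rho> :: "(site \<Rightarrow> 'a) oper"
      using E(1) by (intro erasure_opers) auto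
    have "\<Phi> (erasure ?A (Inl ` E) \<rho>) \<in> opers (labels ?A)" for \<rho>
      using \<Phi>(1) er unfolding quantum_channel_def by blast
    hence "\<forall>\<psi>\<in>\<Q>. \<Phi> (erasure ?A (Inl ` E) (proj_op \<psi>)) = proj_op \<psi>"
      using \<Phi>(2) on_subregister_full[OF er] by metis
    thus ?thesis unfolding corrects_erasure_def using \<Phi>(1) by blast
  qed
  have "eaqecc n (k - l) \<delta> c \<Q>"
    unfolding eaqecc_def
  proof (intro conjI allI impI)
    show "k - l + c \<le> n" by (rule iso.size)
    show "\<exists>U. unitary_op (labels (reg_Q n)) U \<and> \<Q> = ea_isometry n (k - l) c U ` states (labels (reg_Q (k - l)))"
      unfolding \<Q>_css by (rule iso.ea_isometry_image)
  qed (rule corrects)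
  moreover have "\<exists>R. recovery_set n c \<Q> i R \<and> card R \<le> r" if i: "i < n" for i
  proof -
    obtain js f where js: "set js \<subseteq> {..<n} - {i}" "length js \<le> r" and f: "\<forall>w\<in>C. w $ i = f (map (($) w) js)"
      using loc i unfolding has_locality_def by blast
    obtain h where h: "h \<in> ?D" "h $ i \<noteq> 0" "\<And>j. j < n \<Longrightarrow> j \<notin> insert i (set js) \<Longrightarrow> h $ j = 0"
      using local_dual_word[OF C i js(1) f] by blast
    let ?S = "Inl ` insert i (set js) \<union> reg_B c"
    \<comment> \<open>Bob's whole register belongs to \<open>?S\<close>, so the local dual word
      \<open>h\<close> extends to an exponent vector supported there, whatever its entries on Bob's
      side. It is nonzero at \<open>i\<close>, so the undetected error is zero and lies in every
      linear set.\<close>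
    have detect: "a = 0"
      if H: "parity_check_matrix n C H" and a: "a \<in> vecs {Inl i}"
        and z: "\<And>z. z \<in> row_vecs n c m H F \<Longrightarrow> z \<in> vecs ?S \<Longrightarrow> fdot ?A z a = 0" for H F and a :: "site \<Rightarrow> 'a"
    proof -
      obtain u where u: "u \<in> carrier_vec m" "h = transpose_mat H *\<^sub>v u"
        using h(1) unfolding parity_check_dual(3)[OF C m_def H] by auto
      let ?z = "join n c h (transpose_mat F *\<^sub>v u)"
      have "?z \<in> row_vecs n c m H F" using u by (auto simp: row_vecs_def)
      moreover have "?z \<in> vecs ?S"
        unfolding vecs_def
      proof (intro CollectI allI impI)
        fix s assume "s \<notin> ?S" thus "?z s = 0" using h(3) by (cases s) auto
      qed
      ultimately have "fdot ?A ?z a = 0" by (rule z)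
      moreover have "fdot ?A ?z a = fdot {Inl i} a ?z"
        unfolding fdot_commute[of ?A ?z a] using a i by (intro fdot_mono_left) auto
      ultimately have "a (Inl i) = 0" using h(2) i by (simp add: fdot_def)
      show "a = 0"
      proof
        fix s show "a s = 0 s" using a \<open>a (Inl i) = 0\<close> by (cases "s = Inl i") (auto simp: vecs_def)
      qed
    qed
    have "css_recovery ?A ?S {Inl i} TX TZ"
    proof
      show "?S \<subseteq> ?A" using i js(1) by (auto simp: reg_def reg_Q_def)
      show "a \<in> TX" if "a \<in> vecs {Inl i}" "\<And>z. z \<in> TZ \<Longrightarrow> z \<in> vecs ?S \<Longrightarrow> fdot ?A z a = 0" for a
        using detect[OF HZ that(1)] that(2) linear_setD(1)[OF linX] unfolding TZ_def by metis
      show "a \<in> TZ" if "a \<in> vecs {Inl i}" "\<And>z. z \<in> TX \<Longrightarrow> z \<in> vecs ?S \<Longrightarrow> fdot ?A z a = 0" for a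
        using detect[OF HX that(1)] that(2) linear_setD(1)[OF linZ] unfolding TX_def by metis
    qed (use linX linZ TXv TZv orth in auto)
    from recovery[OF this] have "recovery_set n c \<Q> i (set js)"
      unfolding recovery_set_def Let_def using js(1) by blast
    moreover have "card (set js) \<le> r" using card_length[of js] js(2) by simp
    ultimately show ?thesis by blast
  qed
  ultimately show ?thesis unfolding eaqlrc_def c_eq by blast
qed

theorem corollary1:
  fixes C :: "'a::{field,finite} vec set"
    and \<Q> :: "(site \<Rightarrow> 'a) state set"
    and n k d r l \<delta> :: nat
  assumes "linear_code n k d C"
    and "has_locality n C r"
    and "code_dim n (C \<inter> dual_code n C) = l"
    and "eacss_code n C C \<Q>"
    and "\<delta> = (if C \<subseteq> dual_code n C then d else wt (C - (C \<inter> dual_code n C)))"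
  shows "eaqlrc n (k - l) \<delta> (n - k - l) r \<Q> \<and>
         (\<delta> = d \<longrightarrow> eacss_pure n C C) \<and> (\<delta> \<noteq> d \<longrightarrow> eacss_impure n C C)"
proof -
  have C: "VectorSpace.subspace class_ring C (module_vec TYPE('a) n)" and k: "code_dim n C = k" and d: "min_dist C = d"
    using assms(1) by (simp_all add: linear_code_def)
  have "x \<in> dual_code n C" if "x \<in> C" "hamming_weight x \<le> \<delta> - 1" for x
    using low_weight_codeword_in_dual[OF subspaceD(1)[OF C] that(1)] that(2) unfolding assms(5) .
  hence "eaqlrc n (k - l) \<delta> (n - k - l) r \<Q>"
    by (intro eacss_code_is_eaqlrc[OF C k assms(3) assms(2) assms(4)])
  \<comment> \<open>With equal codes the two arguments of each minimum coincide, up to the order of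
    an intersection.\<close>
  moreover have "eacss_dist n C C = \<delta>"
    unfolding assms(5) eacss_dist_def by (simp add: d Int_commute)
  hence "eacss_pure n C C \<longleftrightarrow> \<delta> = d" by (simp add: eacss_pure_def d)
  ultimately show ?thesis by blast
qed

end
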